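(* Let $(t_1,x_1),(t_2,x_2)\in\mathbb{R}\times\mathbb{T}$, $v_1,v_2\in\mathbb{R}$, $v_1\ne v_2$, $\gamma'(v_1)>0$, $\gamma'(v_2)>0$, and $T>2\pi/\min\{\gamma'(v_1),\gamma'(v_2)\}$. Assume that (H1) $n_k(v)<\infty$ for all $k\in\mathbb{Z}$ and $v\in\mathbb{R}$; and (H2) for each $v\in\mathbb{R}$ there exists $N_v\in\mathbb{N}$ such that $n_k(v)\le2$ for all $k\in\mathbb{Z}$ with $|k|\ge N_v$. Then: (i) The qualitative observability $$u(t_i+t,x_i-v_it)=0\ \ \forall i=1,2,\ t\in(0,T)\ \Longrightarrow\ u_0=0$$ holds for all solutions $u(t,x)$ of $\partial_tu=iP(D)u$, $u(0,x)=u_0(x)\in L^2(\mathbb{T})$, if and only if the graph $G(v_1,v_2)$ has no two-colored cycle. (ii) The quantitative observability $$\int_{\mathbb{T}}|u_0(x)|^2\,dx\lesssim\int_0^T\sum_{i=1}^2|u(t_i+t,x_i-v_it)|^2\,dt$$ holds for all solutions $u(t,x)$ of $\partial_tu=iP(D)u$, $u(0,x)=u_0(x)\in L^2(\mathbb{T})$, if and only if the graph $G(v_1,v_2)$ has no two-colored cycle and $g(v_1,v_2)<\infty$.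
   Context: $\mathbb{T}=\mathbb{R}/2\pi\mathbb{Z}$, $\mathbb{N}=\{1,2,3,\dots\}$. Let $p:\mathbb{Z}\to\mathbb{R}$ be a real-valued function (not necessarily a polynomial) and let $P(D)$ be the Fourier multiplier on $\mathbb{T}$ with symbol $p$, i.e. $\widehat{P(D)u}(k)=p(k)\widehat u(k)$. For $u_0=\sum_{k\in\mathbb{Z}}c_ke^{ikx}\in L^2(\mathbb{T})$, the solution of $\partial_tu=iP(D)u$, $u(0,\cdot)=u_0$, is $u(t,x)=\sum_{k\in\mathbb{Z}}c_ke^{ip(k)t}e^{ikx}$, and the restriction to a line is given by the series $u(t_0+t,x_0-vt)=\sum_{k\in\mathbb{Z}}c_ke^{i(p(k)t_0+kx_0)}e^{i\lambda_k(v)t}$. For $v\in\mathbb{R}$, $k\in\mathbb{Z}$ put $\lambda_k(v):=p(k)-kv$, $\Xi_k(v):=\{m\in\mathbb{Z}:\lambda_m(v)=\lambda_k(v)\}$, $n_k(v):=|\Xi_k(v)|$, $\Pi(v):=\{k\in\mathbb{Z}:\exists m\in\mathbb{Z},\ m\neq k,\ \lambda_k(v)=\lambda_m(v)\}$, $\Lambda(v):=\{\lambda_k(v):k\in\mathbb{Z}\}$, and $$\gamma'(v):=\sup_W\ \inf_{\lambda,\lambda'\in\Lambda(v)\setminus W,\ \lambda\ne\lambda'}|\lambda-\lambda'|,$$ $W$ running over all finite subsets of $\Lambda(v)$ ($\gamma'(v)=\infty$ is allowed, with $2\pi/\infty=0$). For $v_1\ne v_2$, the edge-colored graph $G(v_1,v_2)$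 has vertex set $\Pi(v_1)\cup\Pi(v_2)$; two distinct vertices $k_1,k_2$ are joined by a red edge if $\lambda_{k_1}(v_1)=\lambda_{k_2}(v_1)$ and by a blue edge if $\lambda_{k_1}(v_2)=\lambda_{k_2}(v_2)$ (both cannot happen simultaneously, so the graph is simple). A cycle is a (finite) simple graph whose vertices can be arranged in a cyclic sequence so that two vertices are adjacent if and only if they are consecutive; $G(v_1,v_2)$ has a cycle if it contains one as a subgraph. A cycle is two-colored if its edges contain both colors. $g(v_1,v_2):=\max|H|$, the maximum (possibly $\infty$) over connected components $H$ of $G(v_1,v_2)$ of the number $|H|$ of vertices of $H$. $A\lesssim B$ means $A\le CB$ with a constant $C>0$ independent of the solution $u$ (it may depend on $p,v_i,T$ and other data). *)

theory Defs
  imports "HOL-Analysis.Analysis" "HOL-Library.Extended_Nat"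
begin

section \<open>Square-integrable functions on the circle and Fourier coefficients\<close>

definition square_integrable_on :: "(real \<Rightarrow> complex) \<Rightarrow> real set \<Rightarrow> bool" where
  "square_integrable_on f S \<longleftrightarrow>
     f \<in> borel_measurable (lebesgue_on S) \<and>
     integrable (lebesgue_on S) (\<lambda>x. (cmod (f x))\<^sup>2)"

text \<open>Functions on the circle are \<open>2\<pi>\<close>-periodic functions on the line; points of the circle are
  represented by real numbers. Elements of \<open>L\<^sup>2\<close> are represented by functions, so equality in
  \<open>L\<^sup>2\<close> is equality almost everywhere on the period interval.\<close>

definition L2_circle :: "(real \<Rightarrow> complex) \<Rightarrow> bool" where
  "L2_circle f \<longleftrightarrow> (\<forall>x. f (x + 2 * pi) = f x) \<and> square_integrable_on f {0..2 * pi}"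

definition fourier_coeff :: "(real \<Rightarrow> complex) \<Rightarrow> int \<Rightarrow> complex" where
  "fourier_coeff f k =
     (LINT x|lebesgue_on {0..2 * pi}. f x * cis (- (of_int k * x))) / complex_of_real (2 * pi)"

section \<open>Solutions and their restrictions to lines\<close>

text \<open>\<open>\<partial>\<^sub>t u = i P(D) u\<close> with \<open>u(0) = u0\<close>, where \<open>P(D)\<close> is the Fourier multiplier with symbol \<open>p\<close>:
  since \<open>P(D) u(t)\<close> need not be a function, the equation is read off on the Fourier side. By
  \<open>fourier_coeff_solution\<close> below, \<open>u(t)\<close> is then the \<open>L\<^sup>2\<close> function with Fourier series
  \<open>\<Sum>k. c\<^sub>k e\<^bsup>ip(k)t\<^esup> e\<^bsup>ikx\<^esup>\<close>, where \<open>c\<^sub>k\<close> are the Fourier coefficients of \<open>u0\<close>.\<close>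

definition solution ::
  "(int \<Rightarrow> real) \<Rightarrow> (real \<Rightarrow> complex) \<Rightarrow> (real \<Rightarrow> real \<Rightarrow> complex) \<Rightarrow> bool" where
  "solution p u0 u \<longleftrightarrow>
     L2_circle u0 \<and>
     (\<forall>t. L2_circle (u t)) \<and>
     (AE x in lebesgue_on {0..2 * pi}. u 0 x = u0 x) \<and>
     (\<forall>k t. ((\<lambda>s. fourier_coeff (u s) k) has_vector_derivative
               \<i> * of_real (p k) * fourier_coeff (u t) k) (at t))"

definition lam :: "(int \<Rightarrow> real) \<Rightarrow> real \<Rightarrow> int \<Rightarrow> real" where
  "lam p v k = p k - of_int k * v"

text \<open>The restriction \<open>t \<mapsto> u(t0 + t, x0 - v t)\<close> cannot be obtained by evaluating \<open>L\<^sup>2\<close> classes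
  pointwise. It is the limit in \<open>L\<^sup>2(0,T)\<close> of the restrictions of the partial sums of the Fourier
  series of \<open>u\<close>, that is, the sum of the series
  \<open>\<Sum>k. c\<^sub>k e\<^bsup>i(p(k)t0 + k x0)\<^esup> e\<^bsup>i \<lambda>\<^sub>k(v) t\<^esup>\<close> (lemma \<open>line_partial_sum_eq\<close>). As an \<open>L\<^sup>2\<close> limit it is
  determined up to a null set only, so it is given as a relation
  between \<open>u\<close> and the representatives \<open>f\<close> of its restriction.\<close>

definition line_partial_sum ::
  "(real \<Rightarrow> real \<Rightarrow> complex) \<Rightarrow> real \<Rightarrow> real \<Rightarrow> real \<Rightarrow> nat \<Rightarrow> real \<Rightarrow> complex" where
  "line_partial_sum u t0 x0 v N t =
     (\<Sum>k\<in>{- int N..int N}. fourier_coeff (u (t0 + t)) k * cis (of_int k * (x0 - v * t)))"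

definition line_restriction ::
  "(real \<Rightarrow> real \<Rightarrow> complex) \<Rightarrow> real \<Rightarrow> real \<Rightarrow> real \<Rightarrow> real \<Rightarrow> (real \<Rightarrow> complex) \<Rightarrow> bool" where
  "line_restriction u t0 x0 v T f \<longleftrightarrow>
     square_integrable_on f {0<..<T} \<and>
     (\<lambda>N. LINT t|lebesgue_on {0<..<T}. (cmod (f t - line_partial_sum u t0 x0 v N t))\<^sup>2)
       \<longlonglongrightarrow> 0"

lemma fourier_coeff_solution:
  assumes "solution p u0 u"
  shows "fourier_coeff (u t) k = fourier_coeff u0 k * cis (p k * t)"
proof -
  define h where "h s = fourier_coeff (u s) k * cis (- (p k * s))" for s
  have d: "((\<lambda>s. fourier_coeff (u s) k) has_vector_derivative
               \<i> * of_real (p k) * fourier_coeff (u s) k) (at s)" for s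
    using assms by (simp add: solution_def)
  have e: "((\<lambda>s. cis (- (p k * s))) has_vector_derivative
               - (\<i> * of_real (p k)) * cis (- (p k * s))) (at s)" for s
  proof -
    have "((\<lambda>z. exp (- (\<i> * of_real (p k)) * z)) has_field_derivative
             - (\<i> * of_real (p k)) * exp (- (\<i> * of_real (p k)) * of_real s)) (at (of_real s))"
      by (auto intro!: derivative_eq_intros)
    from has_vector_derivative_real_field[OF this] show ?thesis
      by (simp add: cis_conv_exp mult_ac)
  qed
  have "(h has_vector_derivative 0) (at s)" for s
    unfolding h_def
    by (rule has_vector_derivative_eq_rhs[OF has_vector_derivative_mult[OF d e]])
       (simp add: algebra_simps)
  then obtain c where "\<And>s. h s = c"
    using has_vector_derivative_zero_constant[of UNIV h] by auto
  then have "h t = h 0"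
    by simp
  moreover have "fourier_coeff (u 0) k = fourier_coeff u0 k"
  proof -
    have meas: "u 0 \<in> borel_measurable (lebesgue_on {0..2 * pi})"
      "u0 \<in> borel_measurable (lebesgue_on {0..2 * pi})"
      using assms by (auto simp: solution_def L2_circle_def square_integrable_on_def)
    have cm: "(\<lambda>x. cis (- (of_int k * x))) \<in> borel_measurable (lebesgue_on {0..2 * pi})"
      by (intro continuous_imp_measurable_on_sets_lebesgue continuous_intros) auto
    have "AE x in lebesgue_on {0..2 * pi}. u 0 x = u0 x"
      using assms by (simp add: solution_def)
    then show ?thesis
      unfolding fourier_coeff_def
      by (intro arg_cong2[where f = "(/)"] refl integral_cong_AE borel_measurable_times meas cm)
         auto
  qed
  ultimately have "fourier_coeff (u t) k * cis (- (p k * t)) = fourier_coeff u0 k"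
    by (simp add: h_def)
  then have "fourier_coeff (u t) k * (cis (- (p k * t)) * cis (p k * t))
      = fourier_coeff u0 k * cis (p k * t)"
    by (metis mult.assoc)
  then show ?thesis
    by (simp add: cis_mult)
qed

lemma line_partial_sum_eq:
  assumes "solution p u0 u"
  shows "line_partial_sum u t0 x0 v N t =
    (\<Sum>k\<in>{- int N..int N}. fourier_coeff u0 k * cis (p k * t0 + of_int k * x0) * cis (lam p v k * t))"
  unfolding line_partial_sum_def fourier_coeff_solution[OF assms]
  by (intro sum.cong refl) (simp add: mult.assoc cis_mult lam_def algebra_simps)

section \<open>Frequencies, multiplicities and gaps\<close>

definition ecard :: "'a set \<Rightarrow> enat" where
  "ecard A = (if finite A then enat (card A) else \<infinity>)"

definition Xi :: "(int \<Rightarrow> real) \<Rightarrow> real \<Rightarrow> int \<Rightarrow> int set" where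
  "Xi p v k = {m. lam p v m = lam p v k}"

definition n_mult :: "(int \<Rightarrow> real) \<Rightarrow> real \<Rightarrow> int \<Rightarrow> enat" where
  "n_mult p v k = ecard (Xi p v k)"

definition Pi_set :: "(int \<Rightarrow> real) \<Rightarrow> real \<Rightarrow> int set" where
  "Pi_set p v = {k. \<exists>m. m \<noteq> k \<and> lam p v k = lam p v m}"

definition Lam :: "(int \<Rightarrow> real) \<Rightarrow> real \<Rightarrow> real set" where
  "Lam p v = range (lam p v)"

text \<open>Extended reals are used so that the infimum over the empty set is \<open>\<infinity>\<close>; in \<open>ereal\<close>,
  \<open>a / \<infinity> = 0\<close> for real \<open>a\<close>.\<close>

definition gamma' :: "(int \<Rightarrow> real) \<Rightarrow> real \<Rightarrow> ereal" where
  "gamma' p v =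
     (SUP W\<in>{W. finite W \<and> W \<subseteq> Lam p v}.
        INF (a, b)\<in>{(a, b). a \<in> Lam p v - W \<and> b \<in> Lam p v - W \<and> a \<noteq> b}. ereal \<bar>a - b\<bar>)"

section \<open>The edge-colored graph\<close>

text \<open>Undirected edges are given by symmetric, irreflexive relations on the vertex set.\<close>

definition G_verts :: "(int \<Rightarrow> real) \<Rightarrow> real \<Rightarrow> real \<Rightarrow> int set" where
  "G_verts p v1 v2 = Pi_set p v1 \<union> Pi_set p v2"

definition red_edges :: "(int \<Rightarrow> real) \<Rightarrow> real \<Rightarrow> real \<Rightarrow> (int \<times> int) set" where
  "red_edges p v1 v2 =
     {(k, m). k \<in> G_verts p v1 v2 \<and> m \<in> G_verts p v1 v2 \<and> k \<noteq> m \<and> lam p v1 k = lam p v1 m}"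

definition blue_edges :: "(int \<Rightarrow> real) \<Rightarrow> real \<Rightarrow> real \<Rightarrow> (int \<times> int) set" where
  "blue_edges p v1 v2 =
     {(k, m). k \<in> G_verts p v1 v2 \<and> m \<in> G_verts p v1 v2 \<and> k \<noteq> m \<and> lam p v2 k = lam p v2 m}"

definition G_edges :: "(int \<Rightarrow> real) \<Rightarrow> real \<Rightarrow> real \<Rightarrow> (int \<times> int) set" where
  "G_edges p v1 v2 = red_edges p v1 v2 \<union> blue_edges p v1 v2"

text \<open>A cycle contained as a (not necessarily induced) subgraph is given by the cyclic sequence \<open>ks\<close>
  of its at least three distinct vertices; its edges are those between cyclically consecutive
  entries.\<close>

definition cycle_edges :: "int list \<Rightarrow> (int \<times> int) set" where
  "cycle_edges ks = {(ks ! i, ks ! (Suc i mod length ks)) |i. i < length ks}"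

definition is_cycle :: "(int \<Rightarrow> real) \<Rightarrow> real \<Rightarrow> real \<Rightarrow> int list \<Rightarrow> bool" where
  "is_cycle p v1 v2 ks \<longleftrightarrow>
     3 \<le> length ks \<and> distinct ks \<and> set ks \<subseteq> G_verts p v1 v2 \<and> cycle_edges ks \<subseteq> G_edges p v1 v2"

definition has_two_colored_cycle :: "(int \<Rightarrow> real) \<Rightarrow> real \<Rightarrow> real \<Rightarrow> bool" where
  "has_two_colored_cycle p v1 v2 \<longleftrightarrow>
     (\<exists>ks. is_cycle p v1 v2 ks \<and>
           cycle_edges ks \<inter> red_edges p v1 v2 \<noteq> {} \<and>
           cycle_edges ks \<inter> blue_edges p v1 v2 \<noteq> {})"

definition G_components :: "(int \<Rightarrow> real) \<Rightarrow> real \<Rightarrow> real \<Rightarrow> int set set" where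
  "G_components p v1 v2 = {{m. (k, m) \<in> (G_edges p v1 v2)\<^sup>*} |k. k \<in> G_verts p v1 v2}"

definition g_max :: "(int \<Rightarrow> real) \<Rightarrow> real \<Rightarrow> real \<Rightarrow> enat" where
  "g_max p v1 v2 = (SUP H\<in>G_components p v1 v2. ecard H)"

end

theory Submission
  imports Defs
begin

text \<open>
  The two lines meet at a point of the universal cover. Measuring phases from that point, the
  restriction to either line is \<open>\<Sum>k. e\<^sub>k e\<^bsup>i \<lambda>\<^sub>k(v) s\<^esup>\<close> with the same coefficients \<open>e\<^sub>k\<close>,
  \<open>\<bar>e\<^sub>k\<bar> = \<bar>c\<^sub>k\<bar>\<close>. By the inequalities of Ingham and Haraux the two restrictions control
  exactly the sums of \<open>e\<close> over the classes \<open>\<Xi>\<^sub>k(v\<^sub>1)\<close> and \<open>\<Xi>\<^sub>k(v\<^sub>2)\<close>, and the question becomes whether these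
  class sums determine (respectively, bound) the coefficients.

  A coefficient that is not small compared with the class sums forces another large one in its red
  class, that one forces another in its blue class, and so on. Without two-colored cycles this
  alternating walk never repeats a vertex. In a component of bounded size it must stop, which
  bounds the coefficients; in an infinite component with vanishing class sums the coefficients
  eventually have constant modulus, by (H2), contradicting square summability. Conversely, the
  boundary of the red part of a two-colored cycle has vanishing class sums, and alternating signs
  along long alternating paths, which exist when the components are unbounded, have class sums
  supported at the two endpoints.
\<close>

section \<open>Square-integrable functions\<close>

text \<open>Only finite sums are ever estimated. A restriction is an L^2 limit of partial sums over
  {-N..N}, so the inequalities for exponential sums and the combinatorial bound are proved with
  constants uniform over all finite index sets, and N tends to infinity at the very end, with
  Parseval in epsilon form on the other side. Truncation cuts classes apart, which is why the
  quantitative bound speaks of classes intersected with an arbitrary finite set.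

  The definition of \<open>gamma'\<close> ignores finitely many frequencies, whereas Ingham's
  argument requires a uniform gap. The strict inequality for T leaves spare time, and each
  exceptional frequency is restored at the cost of a part of it.

  For necessity, class sums are tested against the exponentials of a line, which are constant on
  classes and bounded by 1; cancellation along a cycle or a path thus controls the restrictions
  pointwise in t.

  Since no two vertices are joined by both colors, an alternating walk cannot backtrack, so its
  shortest closed subwalk has at least three vertices and is a genuine cycle.\<close>

lemma norm_sq_add_le: "(norm (x + y))\<^sup>2 \<le> 2 * (norm x)\<^sup>2 + 2 * (norm (y::'a::real_normed_vector))\<^sup>2"
proof -
  have "(norm (x + y))\<^sup>2 \<le> (norm x + norm y)\<^sup>2"
    by (intro power_mono norm_triangle_ineq) auto
  also have "\<dots> \<le> 2 * (norm x)\<^sup>2 + 2 * (norm y)\<^sup>2"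
    using sum_squares_bound[of "norm x" "norm y"] by (simp add: power2_sum)
  finally show ?thesis .
qed

lemma norm_sq_diff_le: "(norm (x - y))\<^sup>2 \<le> 2 * (norm x)\<^sup>2 + 2 * (norm (y::'a::real_normed_vector))\<^sup>2"
  using norm_sq_add_le[of x "-y"] by simp

lemma square_integrable_on_diff:
  assumes "square_integrable_on f S" "square_integrable_on g S"
  shows "square_integrable_on (\<lambda>x. f x - g x) S"
  unfolding square_integrable_on_def
proof
  have m: "f \<in> borel_measurable (lebesgue_on S)" "g \<in> borel_measurable (lebesgue_on S)"
    using assms by (auto simp: square_integrable_on_def)
  then show "(\<lambda>x. f x - g x) \<in> borel_measurable (lebesgue_on S)" by simp
  have "integrable (lebesgue_on S) (\<lambda>x. 2 * (cmod (f x))\<^sup>2 + 2 * (cmod (g x))\<^sup>2)"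
    using assms by (simp add: square_integrable_on_def)
  then show "integrable (lebesgue_on S) (\<lambda>x. (cmod (f x - g x))\<^sup>2)"
    by (rule Bochner_Integration.integrable_bound) (use m norm_sq_diff_le in auto)
qed

lemma integral_norm_sq_diff_le:
  assumes "square_integrable_on f S" "square_integrable_on g S"
  shows "(LINT x|lebesgue_on S. (cmod (f x - g x))\<^sup>2)
    \<le> 2 * (LINT x|lebesgue_on S. (cmod (f x))\<^sup>2) + 2 * (LINT x|lebesgue_on S. (cmod (g x))\<^sup>2)"
proof -
  have "(LINT x|lebesgue_on S. (cmod (f x - g x))\<^sup>2) \<le> (LINT x|lebesgue_on S. 2 * (cmod (f x))\<^sup>2 + 2 * (cmod (g x))\<^sup>2)"
    using assms square_integrable_on_diff[OF assms]
    by (intro integral_mono norm_sq_diff_le) (auto simp: square_integrable_on_def)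
  also have "\<dots> = 2 * (LINT x|lebesgue_on S. (cmod (f x))\<^sup>2) + 2 * (LINT x|lebesgue_on S. (cmod (g x))\<^sup>2)"
    using assms by (simp add: square_integrable_on_def)
  finally show ?thesis .
qed

lemma square_integrable_on_continuous:
  fixes f :: "real \<Rightarrow> complex"
  assumes "continuous_on {a..b} f"
  shows "square_integrable_on f {a..b}"
  unfolding square_integrable_on_def
  using assms by (auto intro!: continuous_imp_integrable_real continuous_intros borel_measurable_integrable)

text \<open>Restrictions live on the open interval, while exponential sums are integrated in the
  gauge sense over the closed one; for continuous integrands the two agree.\<close>

lemma continuous_open_interval:
  fixes f :: "real \<Rightarrow> 'a::euclidean_space"
  assumes "continuous_on UNIV f"
  shows "integrable (lebesgue_on {a<..<b}) f" "(LINT t|lebesgue_on {a<..<b}. f t) = integral {a..b} f"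
proof -
  have "integrable (lebesgue_on {a..b}) f"
    using assms by (intro continuous_imp_integrable_real) (rule continuous_on_subset, auto)
  then have "set_integrable lebesgue {a..b} f"
    by (simp add: set_integrable_def integrable_restrict_space)
  then have "set_integrable lebesgue {a<..<b} f" by (rule set_integrable_subset) auto
  then show int: "integrable (lebesgue_on {a<..<b}) f"
    by (simp add: set_integrable_def integrable_restrict_space)
  then show "(LINT t|lebesgue_on {a<..<b}. f t) = integral {a..b} f"
    by (simp add: lebesgue_integral_eq_integral integral_open_interval_real)
qed

lemma square_integrable_on_continuous_open:
  assumes "continuous_on UNIV (f :: real \<Rightarrow> complex)"
  shows "square_integrable_on f {a<..<b}"
  unfolding square_integrable_on_def
  using assms by (auto intro!: borel_measurable_integrable continuous_open_interval continuous_intros)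

lemma square_integrable_on_imp_integrable:
  assumes "square_integrable_on f {a..b::real}"
  shows "integrable (lebesgue_on {a..b}) f"
proof (rule Bochner_Integration.integrable_bound)
  show "integrable (lebesgue_on {a..b}) (\<lambda>x. 1 + (cmod (f x))\<^sup>2)"
    using assms continuous_imp_integrable_real[of a b "\<lambda>x. 1::real"]
    by (auto simp: square_integrable_on_def)
  have "norm (f x) \<le> norm (1 + (cmod (f x))\<^sup>2)" for x
    using sum_squares_bound[of 1 "cmod (f x)"] by (simp add: power2_eq_square) (smt (verit) norm_ge_zero)
  then show "AE x in lebesgue_on {a..b}. norm (f x) \<le> norm (1 + (cmod (f x))\<^sup>2)" by simp
qed (use assms in \<open>auto simp: square_integrable_on_def\<close>)

section \<open>Trigonometric polynomials\<close>

definition trig_poly :: "int set \<Rightarrow> (int \<Rightarrow> complex) \<Rightarrow> real \<Rightarrow> complex" where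
  "trig_poly S b x = (\<Sum>k\<in>S. b k * cis (of_int k * x))"

definition is_trig_poly :: "(real \<Rightarrow> complex) \<Rightarrow> bool" where
  "is_trig_poly f \<longleftrightarrow> (\<exists>S b. finite S \<and> f = trig_poly S b)"

lemma continuous_on_trig_poly [continuous_intros]:
  "continuous_on A g \<Longrightarrow> continuous_on A (\<lambda>x. trig_poly S b (g x))"
  unfolding trig_poly_def by (intro continuous_intros)

lemma square_integrable_on_trig_poly: "square_integrable_on (trig_poly S b) {x..y}"
  by (intro square_integrable_on_continuous continuous_intros)

lemma trig_poly_extend:
  "finite T \<Longrightarrow> S \<subseteq> T \<Longrightarrow> trig_poly S b = trig_poly T (\<lambda>k. if k \<in> S then b k else 0)"
  unfolding trig_poly_def by (intro ext sum.mono_neutral_cong_left) auto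

lemma is_trig_poly_monom: "is_trig_poly (\<lambda>x. c * cis (of_int k * x))"
  unfolding is_trig_poly_def by (rule exI[of _ "{k}"], rule exI[of _ "\<lambda>_. c"]) (auto simp: trig_poly_def)

lemma is_trig_poly_add:
  assumes "is_trig_poly f" "is_trig_poly g"
  shows "is_trig_poly (\<lambda>x. f x + g x)"
proof -
  obtain S b T c where *: "finite S" "f = trig_poly S b" "finite T" "g = trig_poly T c"
    using assms unfolding is_trig_poly_def by auto
  have "(\<lambda>x. f x + g x) = trig_poly (S \<union> T) (\<lambda>k. (if k \<in> S then b k else 0) + (if k \<in> T then c k else 0))"
    using * trig_poly_extend[of "S \<union> T" S b] trig_poly_extend[of "S \<union> T" T c]
    by (simp add: fun_eq_iff) (simp add: trig_poly_def distrib_right sum.distrib)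
  then show ?thesis unfolding is_trig_poly_def using * by blast
qed

lemma is_trig_poly_sum:
  "(\<And>i. i \<in> A \<Longrightarrow> is_trig_poly (f i)) \<Longrightarrow> is_trig_poly (\<lambda>x. \<Sum>i\<in>A. f i x)"
proof (induction A rule: infinite_finite_induct)
  case (insert a A)
  then show ?case using is_trig_poly_add[of "f a" "\<lambda>x. \<Sum>i\<in>A. f i x"] by simp
qed (use is_trig_poly_monom[of 0] in simp_all)

lemma is_trig_poly_mult:
  assumes "is_trig_poly f" "is_trig_poly g"
  shows "is_trig_poly (\<lambda>x. f x * g x)"
proof -
  obtain S b T c where *: "finite S" "f = trig_poly S b" "finite T" "g = trig_poly T c"
    using assms unfolding is_trig_poly_def by auto
  have "(\<lambda>x. f x * g x) = (\<lambda>x. \<Sum>k\<in>S. \<Sum>j\<in>T. (b k * c j) * cis (of_int (k + j) * x))"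
    using * by (simp add: fun_eq_iff trig_poly_def sum_product distrib_right mult_ac cis_mult distrib_left)
  then show ?thesis by (simp only: is_trig_poly_sum is_trig_poly_monom)
qed

lemma is_trig_poly_real_polynomial_function:
  assumes "real_polynomial_function g"
  shows "is_trig_poly (\<lambda>x. complex_of_real (g (cis x)))"
  using assms
proof induction
  case (linear f)
  then interpret bounded_linear f .
  have "f (cis x) = cos x * f 1 + sin x * f \<i>" for x
  proof -
    have "cis x = cos x *\<^sub>R 1 + sin x *\<^sub>R \<i>" by (simp add: complex_eq_iff)
    then show ?thesis by (metis add scaleR real_scaleR_def)
  qed
  \<comment> \<open>Euler's formulas for cos and sin: a real linear functional becomes a combination
    of the frequencies 1 and -1.\<close>
  then have "(\<lambda>x. complex_of_real (f (cis x))) = (\<lambda>x. (of_real (f 1 / 2) - \<i> * of_real (f \<i> / 2)) * cis (of_int 1 * x)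
      + (of_real (f 1 / 2) + \<i> * of_real (f \<i> / 2)) * cis (of_int (- 1) * x))"
    by (simp add: fun_eq_iff complex_eq_iff algebra_simps)
  then show ?case by (simp only: is_trig_poly_add is_trig_poly_monom)
next
  case (const c)
  show ?case using is_trig_poly_monom[of "of_real c" 0] by simp
qed (auto intro: is_trig_poly_add is_trig_poly_mult)

lemma is_trig_poly_polynomial_function:
  fixes g :: "complex \<Rightarrow> complex"
  assumes "polynomial_function g"
  shows "is_trig_poly (\<lambda>x. g (cis x))"
proof -
  have "real_polynomial_function (Re \<circ> g)" "real_polynomial_function (Im \<circ> g)"
    using assms bounded_linear_Re bounded_linear_Im unfolding polynomial_function_def by auto
  then have "is_trig_poly (\<lambda>x. complex_of_real (Re (g (cis x))) + \<i> * complex_of_real (Im (g (cis x))))"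
    using is_trig_poly_monom[of \<i> 0]
    by (intro is_trig_poly_add is_trig_poly_mult) (auto dest: is_trig_poly_real_polynomial_function)
  then show ?thesis by (simp flip: complex_eq)
qed

text \<open>Stone-Weierstrass on the unit circle, where real polynomials in the coordinates of
  \<open>cis x\<close> are trigonometric polynomials. \<open>Arg2pi\<close> jumps at 1, and
  \<open>h 0 = h (2 * pi)\<close> is what keeps the transported function continuous there.\<close>

lemma trig_poly_uniform_approx:
  fixes h :: "real \<Rightarrow> complex"
  assumes cont: "continuous_on {0..2 * pi} h" and h: "h 0 = h (2 * pi)" and e: "e > 0"
  obtains P where "is_trig_poly P" "\<And>x. x \<in> {0..2 * pi} \<Longrightarrow> cmod (h x - P x) < e"
proof -
  define q where "q t = h (2 * pi * t)" for t
  have "path q" unfolding path_def q_def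
    by (rule continuous_on_compose2[OF cont]) (auto intro!: continuous_intros)
  \<comment> \<open>The constant homotopy carries the loop over to a continuous function on the circle.\<close>
  then have "homotopic_loops UNIV q q"
    using h by (simp add: homotopic_loops_refl q_def pathfinish_def pathstart_def)
  from homotopic_with_imp_continuous[OF homotopic_loops_imp_homotopic_circlemaps[OF this]]
  have "continuous_on (sphere 0 1) (\<lambda>z. h (Arg2pi z))"
    by (simp add: o_def q_def)
  then obtain g :: "complex \<Rightarrow> complex" where g: "polynomial_function g" "\<And>z. z \<in> sphere 0 1 \<Longrightarrow> cmod (h (Arg2pi z) - g z) < e"
    using Stone_Weierstrass_polynomial_function[of "sphere 0 1" "\<lambda>z. h (Arg2pi z)" e] e by auto
  have "h (Arg2pi (cis x)) = h x" if "x \<in> {0..2 * pi}" for x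
  proof (cases "x = 2 * pi")
    case True
    then show ?thesis using h Arg2pi_of_real[of 1] by simp
  next
    case False
    then have "Arg2pi (cis x) = x" using that by (intro Arg2pi_unique[of 1]) (auto simp: cis_conv_exp)
    then show ?thesis by simp
  qed
  then have "cmod (h x - g (cis x)) < e" if "x \<in> {0..2 * pi}" for x
    using g(2)[of "cis x"] that by simp
  then show ?thesis using that[OF is_trig_poly_polynomial_function[OF g(1)]] by blast
qed

section \<open>Density of trigonometric polynomials in L^2\<close>

lemma square_integrable_on_clamp_approx:
  fixes f :: "real \<Rightarrow> complex"
  assumes f: "square_integrable_on f S"
  shows "(\<lambda>n. LINT x|lebesgue_on S. (cmod (f x - closest_point (cball 0 (real n)) (f x)))\<^sup>2) \<longlonglongrightarrow> 0"
proof -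
  define c where "c n = closest_point (cball (0::complex) (real n))" for n
  have meas: "f \<in> borel_measurable (lebesgue_on S)" using f by (simp add: square_integrable_on_def)
  have c: "continuous_on UNIV (c n)" for n unfolding c_def by (intro continuous_on_closest_point) auto
  have [measurable]: "(\<lambda>x. c n (f x)) \<in> borel_measurable (lebesgue_on S)" for n
    using measurable_compose[OF meas borel_measurable_continuous_onI[OF c]] .
  have "(\<lambda>n. LINT x|lebesgue_on S. (cmod (f x - c n (f x)))\<^sup>2) \<longlonglongrightarrow> (LINT x|lebesgue_on S. 0)"
  proof (rule integral_dominated_convergence)
    show "integrable (lebesgue_on S) (\<lambda>x. (cmod (f x))\<^sup>2)" using f by (simp add: square_integrable_on_def)
    show "AE x in lebesgue_on S. (\<lambda>n. (cmod (f x - c n (f x)))\<^sup>2) \<longlonglongrightarrow> 0"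
    proof (rule AE_I2)
      fix x
      obtain N :: nat where N: "cmod (f x) \<le> N" using real_arch_simple by blast
      have "\<forall>n\<ge>N. (cmod (f x - c n (f x)))\<^sup>2 = 0"
        using N unfolding c_def by (auto simp: closest_point_self)
      then show "(\<lambda>n. (cmod (f x - c n (f x)))\<^sup>2) \<longlonglongrightarrow> 0"
        by (intro tendsto_eventually) (auto simp: eventually_sequentially)
    qed
    show "AE x in lebesgue_on S. norm ((cmod (f x - c n (f x)))\<^sup>2) \<le> (cmod (f x))\<^sup>2" for n
    proof (rule AE_I2)
      fix x
      \<comment> \<open>Since 0 lies in the ball, the projection moves \<open>f x\<close> by at most
        its own modulus, which serves as the dominating function.\<close>
      have "dist (f x) (c n (f x)) \<le> dist (f x) 0" unfolding c_def by (intro closest_point_le) auto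
      then show "norm ((cmod (f x - c n (f x)))\<^sup>2) \<le> (cmod (f x))\<^sup>2" by (simp add: dist_norm)
    qed
  qed (use meas in measurable)
  then show ?thesis by (simp add: c_def)
qed

text \<open>Lebesgue measurability supplies continuous functions converging almost everywhere;
  projecting them to the ball keeps them bounded, so dominated convergence applies on the finite
  interval.\<close>

lemma bounded_continuous_approx:
  fixes f :: "real \<Rightarrow> complex"
  assumes f: "square_integrable_on f {0..2 * pi}" and B: "B \<ge> 0"
  obtains h where "\<And>n. continuous_on {0..2 * pi} (h n)" "\<And>n. h n 0 = h n (2 * pi)"
    "(\<lambda>n. LINT x|lebesgue_on {0..2 * pi}. (cmod (closest_point (cball 0 B) (f x) - h n x))\<^sup>2) \<longlonglongrightarrow> 0"
proof -
  define c where "c = closest_point (cball (0::complex) B)"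
  have meas: "f \<in> borel_measurable (lebesgue_on {0..2 * pi})" using f by (simp add: square_integrable_on_def)
  then have "f measurable_on {0..2 * pi}" by (subst measurable_on_iff_borel_measurable) auto
  then obtain N g where N: "negligible N" and g: "\<And>n. continuous_on UNIV (g n)"
    and lim: "\<And>x. x \<notin> N \<Longrightarrow> (\<lambda>n. g n x) \<longlonglongrightarrow> (if x \<in> {0..2 * pi} then f x else 0)"
    unfolding measurable_on_def by metis
  have c: "continuous_on A c" for A unfolding c_def using B by (intro continuous_on_closest_point) auto
  have cB: "cmod (c z) \<le> B" for z
    using closest_point_in_set[of "cball (0::complex) B" z] B by (simp add: c_def)
  \<comment> \<open>The cutoff \<open>x n\<close> vanishes at both endpoints, which makes the approximants periodic.\<close>
  define x where "x n t = min 1 (real n * (t * (2 * pi - t)))" for n t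
  define h where "h n t = complex_of_real (x n t) * c (g n t)" for n t
  have x01: "0 \<le> x n t" "x n t \<le> 1" if "t \<in> {0..2 * pi}" for n t using that by (auto simp: x_def)
  show thesis
  proof
    show cont: "continuous_on {0..2 * pi} (h n)" for n
      unfolding h_def x_def
      by (intro continuous_intros continuous_on_compose2[OF c continuous_on_subset[OF g]]) auto
    show "h n 0 = h n (2 * pi)" for n by (simp add: h_def x_def)
    have [measurable]: "h n \<in> borel_measurable (lebesgue_on {0..2 * pi})" for n
      using square_integrable_on_continuous[OF cont] by (simp add: square_integrable_on_def)
    have [measurable]: "(\<lambda>t. c (f t)) \<in> borel_measurable (lebesgue_on {0..2 * pi})"
      using measurable_compose[OF meas borel_measurable_continuous_onI[OF c]] .
    have "(\<lambda>n. LINT t|lebesgue_on {0..2 * pi}. (cmod (c (f t) - h n t))\<^sup>2) \<longlonglongrightarrow> (LINT t|lebesgue_on {0..2 * pi}. 0)"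
    proof (rule integral_dominated_convergence)
      show "integrable (lebesgue_on {0..2 * pi}) (\<lambda>t. (2 * B)\<^sup>2)" by (rule continuous_imp_integrable_real) auto
      show "AE t in lebesgue_on {0..2 * pi}. norm ((cmod (c (f t) - h n t))\<^sup>2) \<le> (2 * B)\<^sup>2" for n
      proof (rule AE_I2)
        fix t assume "t \<in> space (lebesgue_on {0..2 * pi})"
        then have t: "t \<in> {0..2 * pi}" by simp
        have "cmod (h n t) \<le> 1 * B"
          unfolding h_def norm_mult using x01[OF t] cB by (intro mult_mono) auto
        then have "cmod (c (f t) - h n t) \<le> 2 * B"
          using norm_triangle_ineq4[of "c (f t)" "h n t"] cB[of "f t"] by simp
        then have "(cmod (c (f t) - h n t))\<^sup>2 \<le> (2 * B)\<^sup>2" by (intro power_mono) auto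
        then show "norm ((cmod (c (f t) - h n t))\<^sup>2) \<le> (2 * B)\<^sup>2" by simp
      qed
      \<comment> \<open>The endpoints are discarded because the cutoff vanishes there for every
        n.\<close>
      have "negligible (N \<union> {0, 2 * pi})" using N by simp
      then have "N \<union> {0, 2 * pi} \<in> null_sets lebesgue" by (simp only: negligible_iff_null_sets)
      then have "AE t in lebesgue. t \<notin> N \<union> {0, 2 * pi}" by (rule AE_not_in)
      then have "AE t in lebesgue_on {0..2 * pi}. t \<notin> N \<union> {0, 2 * pi}"
        by (subst AE_restrict_space_iff) auto
      then show "AE t in lebesgue_on {0..2 * pi}. (\<lambda>n. (cmod (c (f t) - h n t))\<^sup>2) \<longlonglongrightarrow> 0"
        using AE_space
      proof eventually_elim
        fix t assume "t \<notin> N \<union> {0, 2 * pi}" "t \<in> space (lebesgue_on {0..2 * pi})"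
        then have t: "t \<notin> N" "0 < t" "t < 2 * pi" by auto
        then have p: "t * (2 * pi - t) > 0" by simp
        obtain n0 :: nat where n0: "1 / (t * (2 * pi - t)) \<le> n0" using real_arch_simple by blast
        have "x n t = 1" if "n \<ge> n0" for n
        proof -
          have "1 / (t * (2 * pi - t)) \<le> n" using n0 that by linarith
          then show ?thesis using p by (simp add: x_def divide_le_eq)
        qed
        then have 1: "(\<lambda>n. complex_of_real (x n t)) \<longlonglongrightarrow> 1"
          by (intro tendsto_eventually) (auto simp: eventually_sequentially)
        have "(\<lambda>n. g n t) \<longlonglongrightarrow> f t" using lim[OF t(1)] t by simp
        moreover have "isCont c (f t)" using c[of UNIV] by (simp add: continuous_on_eq_continuous_at)
        ultimately have "(\<lambda>n. c (g n t)) \<longlonglongrightarrow> c (f t)" by (rule isCont_tendsto_compose[rotated])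
        then have "(\<lambda>n. h n t) \<longlonglongrightarrow> 1 * c (f t)"
          unfolding h_def by (intro tendsto_mult 1)
        then have "(\<lambda>n. (cmod (c (f t) - h n t))\<^sup>2) \<longlonglongrightarrow> (cmod (c (f t) - 1 * c (f t)))\<^sup>2"
          by (intro tendsto_intros)
        then show "(\<lambda>n. (cmod (c (f t) - h n t))\<^sup>2) \<longlonglongrightarrow> 0" by simp
      qed
    qed measurable
    then show "(\<lambda>n. LINT t|lebesgue_on {0..2 * pi}. (cmod (closest_point (cball 0 B) (f t) - h n t))\<^sup>2) \<longlonglongrightarrow> 0"
      by (simp add: c_def)
  qed
qed

lemma trig_poly_dense_L2:
  assumes f: "square_integrable_on f {0..2 * pi}" and e: "e > 0"
  obtains P where "is_trig_poly P" "(LINT x|lebesgue_on {0..2 * pi}. (cmod (f x - P x))\<^sup>2) < e"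
proof -
  let ?I = "\<lambda>f. LINT x|lebesgue_on {0..2 * pi}. (cmod (f x))\<^sup>2"
  define c where "c n x = closest_point (cball 0 (real n)) (f x)" for n x
  have "\<forall>\<^sub>F n in sequentially. ?I (\<lambda>x. f x - c n x) < e / 8"
    using order_tendstoD(2)[OF square_integrable_on_clamp_approx[OF f], of "e / 8"] e by (simp add: c_def)
  then obtain n where n: "?I (\<lambda>x. f x - c n x) < e / 8" by (auto simp: eventually_sequentially)
  obtain h where h: "\<And>n. continuous_on {0..2 * pi} (h n)" "\<And>n. h n 0 = h n (2 * pi)"
    "(\<lambda>m. ?I (\<lambda>x. c n x - h m x)) \<longlonglongrightarrow> 0"
    using bounded_continuous_approx[OF f, of "real n"] unfolding c_def by auto
  have "\<forall>\<^sub>F m in sequentially. ?I (\<lambda>x. c n x - h m x) < e / 16"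
    using order_tendstoD(2)[OF h(3), of "e / 16"] e by simp
  then obtain m where m: "?I (\<lambda>x. c n x - h m x) < e / 16" by (auto simp: eventually_sequentially)
  \<comment> \<open>A uniform error below d costs at most 2 * pi * d^2 = e / 16. Two uses of |a -
    b|^2 <= 2 |a|^2 + 2 |b|^2 then give a total below 2 * e / 8 + 2 * (2 * e / 16 + 2 * e / 16) = 3
    * e / 4.\<close>
  define d where "d = sqrt (e / (32 * pi))"
  have d: "d > 0" "d\<^sup>2 = e / (32 * pi)" using e by (auto simp: d_def)
  obtain P where P: "is_trig_poly P" "\<And>x. x \<in> {0..2 * pi} \<Longrightarrow> cmod (h m x - P x) < d"
    using trig_poly_uniform_approx[OF h(1,2) d(1)] by metis
  obtain S b where SP: "P = trig_poly S b" using P by (auto simp: is_trig_poly_def)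
  have sqP: "square_integrable_on P {0..2 * pi}" by (simp add: SP square_integrable_on_trig_poly)
  have sqh: "square_integrable_on (h m) {0..2 * pi}" by (intro square_integrable_on_continuous h)
  have cc: "continuous_on UNIV (closest_point (cball (0::complex) (real n)))" by (intro continuous_on_closest_point) auto
  have meas: "f \<in> borel_measurable (lebesgue_on {0..2 * pi})" using f by (simp add: square_integrable_on_def)
  have cmeas: "c n \<in> borel_measurable (lebesgue_on {0..2 * pi})"
    unfolding c_def using measurable_compose[OF meas borel_measurable_continuous_onI[OF cc]] .
  have sqc: "square_integrable_on (c n) {0..2 * pi}"
    unfolding square_integrable_on_def
  proof (rule conjI[OF cmeas], rule Bochner_Integration.integrable_bound)
    show "integrable (lebesgue_on {0..2 * pi}) (\<lambda>x. (real n)\<^sup>2)" by (rule continuous_imp_integrable_real) auto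
    show "(\<lambda>x. (cmod (c n x))\<^sup>2) \<in> borel_measurable (lebesgue_on {0..2 * pi})" using cmeas by measurable
    have "cmod (c n x) \<le> n" for x
      using closest_point_in_set[of "cball (0::complex) n" "f x"] by (simp add: c_def)
    then show "AE x in lebesgue_on {0..2 * pi}. norm ((cmod (c n x))\<^sup>2) \<le> norm ((real n)\<^sup>2)"
      by (intro AE_I2) (simp add: power_mono)
  qed
  have sq1: "square_integrable_on (\<lambda>x. f x - c n x) {0..2 * pi}" "square_integrable_on (\<lambda>x. P x - c n x) {0..2 * pi}"
     "square_integrable_on (\<lambda>x. c n x - h m x) {0..2 * pi}" "square_integrable_on (\<lambda>x. P x - h m x) {0..2 * pi}"
    by (intro square_integrable_on_diff f sqc sqP sqh)+
  have 1: "?I (\<lambda>x. P x - h m x) \<le> (LINT x|lebesgue_on {0..2 * pi}. d\<^sup>2)"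
  proof (rule integral_mono)
    show "integrable (lebesgue_on {0..2 * pi}) (\<lambda>x. d\<^sup>2)" by (rule continuous_imp_integrable_real) auto
    show "(cmod (P x - h m x))\<^sup>2 \<le> d\<^sup>2" if "x \<in> space (lebesgue_on {0..2 * pi})" for x
      using P(2)[of x] that by (intro power_mono) (auto simp: norm_minus_commute)
  qed (use sq1 in \<open>auto simp: square_integrable_on_def\<close>)
  also have "\<dots> = e / 16" by (simp add: d measure_restrict_space)
  finally have "?I (\<lambda>x. P x - h m x) \<le> e / 16" .
  moreover have "?I (\<lambda>x. P x - c n x) \<le> 2 * ?I (\<lambda>x. P x - h m x) + 2 * ?I (\<lambda>x. c n x - h m x)"
    using integral_norm_sq_diff_le[OF sq1(4,3)] by simp
  moreover have "?I (\<lambda>x. f x - P x) \<le> 2 * ?I (\<lambda>x. f x - c n x) + 2 * ?I (\<lambda>x. P x - c n x)"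
    using integral_norm_sq_diff_le[OF sq1(1,2)] by simp
  ultimately have "?I (\<lambda>x. f x - P x) < e" using n m e by linarith
  then show thesis using that P by blast
qed

section \<open>Bessel and Parseval\<close>

lemma integral_cis_int:
  "(LINT x|lebesgue_on {0..2 * pi}. cis (of_int k * x)) = (if k = 0 then 2 * pi else 0)"
proof (cases "k = 0")
  case True
  then show ?thesis by (simp add: measure_restrict_space scaleR_conv_of_real)
next
  case False
  have "((\<lambda>x. cis (of_int k * x) / (\<i> * of_int k)) has_vector_derivative cis (of_int k * x)) (at x within {0..2 * pi})" for x
  proof -
    have "((\<lambda>z. exp (\<i> * of_int k * z) / (\<i> * of_int k)) has_field_derivative exp (\<i> * of_int k * of_real x)) (at (of_real x))"
      using False by (auto intro!: derivative_eq_intros)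
    from has_vector_derivative_at_within[OF has_vector_derivative_real_field[OF this]]
    show ?thesis by (simp add: cis_conv_exp mult_ac)
  qed
  from fundamental_theorem_of_calculus[OF _ this]
  have "((\<lambda>x. cis (of_int k * x)) has_integral (cis (of_int k * (2 * pi)) / (\<i> * of_int k) - cis (of_int k * 0) / (\<i> * of_int k))) {0..2 * pi}"
    by simp
  moreover have "cis (of_int k * (2 * pi)) = 1" using cis_multiple_2pi[of "of_int k"] by (simp add: mult_ac)
  ultimately have "integral {0..2 * pi} (\<lambda>x. cis (of_int k * x)) = 0" by (simp add: integral_unique)
  then show ?thesis using False
    by (subst lebesgue_integral_eq_integral) (auto intro!: continuous_imp_integrable_real continuous_intros)
qed

lemma integrable_times_cis:
  assumes "square_integrable_on f {0..2 * pi}"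
  shows "integrable (lebesgue_on {0..2 * pi}) (\<lambda>x. f x * cis (c * x))"
proof (rule Bochner_Integration.integrable_bound[OF square_integrable_on_imp_integrable[OF assms]])
  have "(\<lambda>x. cis (c * x)) \<in> borel_measurable (lebesgue_on {0..2 * pi})"
    by (intro continuous_imp_measurable_on_sets_lebesgue continuous_intros) auto
  then show "(\<lambda>x. f x * cis (c * x)) \<in> borel_measurable (lebesgue_on {0..2 * pi})"
    using assms by (auto simp: square_integrable_on_def)
qed (simp add: norm_mult)

lemma fourier_coeff_trig_poly:
  assumes "finite S"
  shows "fourier_coeff (trig_poly S b) k = (if k \<in> S then b k else 0)"
proof -
  have "(LINT x|lebesgue_on {0..2 * pi}. trig_poly S b x * cis (- (of_int k * x)))
     = (LINT x|lebesgue_on {0..2 * pi}. (\<Sum>j\<in>S. b j * cis (of_int (j - k) * x)))"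
    by (simp add: trig_poly_def sum_distrib_right mult.assoc cis_mult left_diff_distrib)
  also have "\<dots> = (\<Sum>j\<in>S. b j * (LINT x|lebesgue_on {0..2 * pi}. cis (of_int (j - k) * x)))"
    by (subst Bochner_Integration.integral_sum) (auto intro!: continuous_imp_integrable_real continuous_intros)
  also have "\<dots> = (\<Sum>j\<in>S. if j = k then b j * of_real (2 * pi) else 0)"
    by (intro sum.cong refl, subst integral_cis_int) auto
  also have "\<dots> = (if k \<in> S then b k * of_real (2 * pi) else 0)" using assms by simp
  finally show ?thesis by (simp add: fourier_coeff_def)
qed

lemma integral_times_cnj_trig_poly:
  assumes f: "square_integrable_on f {0..2 * pi}"
  shows "integrable (lebesgue_on {0..2 * pi}) (\<lambda>x. f x * cnj (trig_poly S b x))"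
    and "(LINT x|lebesgue_on {0..2 * pi}. f x * cnj (trig_poly S b x)) = 2 * pi * (\<Sum>k\<in>S. cnj (b k) * fourier_coeff f k)"
proof -
  have e: "(\<lambda>x. f x * cnj (trig_poly S b x)) = (\<lambda>x. \<Sum>k\<in>S. cnj (b k) * (f x * cis (- of_int k * x)))"
    by (simp add: trig_poly_def sum_distrib_left cnj_sum cis_cnj mult_ac)
  show "integrable (lebesgue_on {0..2 * pi}) (\<lambda>x. f x * cnj (trig_poly S b x))"
    unfolding e by (intro Bochner_Integration.integrable_sum integrable_mult_right integrable_times_cis f)
  show "(LINT x|lebesgue_on {0..2 * pi}. f x * cnj (trig_poly S b x)) = 2 * pi * (\<Sum>k\<in>S. cnj (b k) * fourier_coeff f k)"
    unfolding e
    by (subst Bochner_Integration.integral_sum)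
       (auto intro!: integrable_mult_right integrable_times_cis[OF f, of "- of_int _", simplified] sum.cong
          simp: fourier_coeff_def sum_distrib_left)
qed

text \<open>Completing the square in the coefficients. The choice \<open>b = fourier_coeff f\<close>
  gives Bessel, dropping the last term gives Parseval by density, and taking \<open>f\<close> to be
  the polynomial itself computes its norm.\<close>

lemma integral_norm_sq_minus_trig_poly:
  assumes f: "square_integrable_on f {0..2 * pi}" and S: "finite S"
  shows "(LINT x|lebesgue_on {0..2 * pi}. (cmod (f x - trig_poly S b x))\<^sup>2)
    = (LINT x|lebesgue_on {0..2 * pi}. (cmod (f x))\<^sup>2) - 2 * pi * (\<Sum>k\<in>S. (cmod (fourier_coeff f k))\<^sup>2)
      + 2 * pi * (\<Sum>k\<in>S. (cmod (fourier_coeff f k - b k))\<^sup>2)"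
proof -
  let ?M = "lebesgue_on {0..2 * pi}" and ?P = "trig_poly S b" and ?c = "fourier_coeff f"
  have sqP: "square_integrable_on ?P {0..2 * pi}" by (rule square_integrable_on_trig_poly)
  note fP = integral_times_cnj_trig_poly[OF f, of S b]
  note PP = integral_times_cnj_trig_poly[OF sqP, of S b]
  have nd: "(cmod (z - w))\<^sup>2 = (cmod z)\<^sup>2 - 2 * Re (z * cnj w) + Re (w * cnj w)" for z w
    unfolding cmod_power2 by (simp add: power2_eq_square algebra_simps)
  have Re_2pi: "Re (2 * complex_of_real pi * z) = 2 * pi * Re z" for z by simp
  have "(LINT x|?M. (cmod (f x - ?P x))\<^sup>2) = (LINT x|?M. (cmod (f x))\<^sup>2 - 2 * Re (f x * cnj (?P x)) + Re (?P x * cnj (?P x)))"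
    by (simp only: nd)
  also have "\<dots> = (LINT x|?M. (cmod (f x))\<^sup>2) - 2 * (LINT x|?M. Re (f x * cnj (?P x))) + (LINT x|?M. Re (?P x * cnj (?P x)))"
    using f fP(1) PP(1) by (simp add: square_integrable_on_def del: complex_mult_cnj times_complex.sel)
  also have "(LINT x|?M. Re (f x * cnj (?P x))) = 2 * pi * (\<Sum>k\<in>S. Re (cnj (b k) * ?c k))"
    by (subst integral_Re[OF fP(1)]) (simp add: fP(2) Re_2pi del: times_complex.sel)
  also have "(LINT x|?M. Re (?P x * cnj (?P x))) = 2 * pi * (\<Sum>k\<in>S. Re (cnj (b k) * b k))"
    by (subst integral_Re[OF PP(1)]) (simp add: PP(2) Re_2pi fourier_coeff_trig_poly[OF S] del: times_complex.sel cong: sum.cong)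
  also have "(LINT x|?M. (cmod (f x))\<^sup>2) - 2 * (2 * pi * (\<Sum>k\<in>S. Re (cnj (b k) * ?c k))) + 2 * pi * (\<Sum>k\<in>S. Re (cnj (b k) * b k))
     = (LINT x|?M. (cmod (f x))\<^sup>2) - 2 * pi * (\<Sum>k\<in>S. (cmod (?c k))\<^sup>2) + 2 * pi * (\<Sum>k\<in>S. (cmod (?c k - b k))\<^sup>2)"
    unfolding nd by (simp add: sum.distrib sum_subtractf sum_distrib_left algebra_simps)
  finally show ?thesis .
qed

lemma bessel_inequality:
  assumes f: "square_integrable_on f {0..2 * pi}" and S: "finite S"
  shows "2 * pi * (\<Sum>k\<in>S. (cmod (fourier_coeff f k))\<^sup>2) \<le> (LINT x|lebesgue_on {0..2 * pi}. (cmod (f x))\<^sup>2)"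
proof -
  have "0 \<le> (LINT x|lebesgue_on {0..2 * pi}. (cmod (f x - trig_poly S (fourier_coeff f) x))\<^sup>2)" by simp
  then show ?thesis unfolding integral_norm_sq_minus_trig_poly[OF f S] by simp
qed

text \<open>Padding the approximant with zero coefficients does not change it, so every finite
  superset of S works; this admits the symmetric ranges over which the partial sums are
  taken.\<close>

lemma parseval_approx:
  assumes f: "square_integrable_on f {0..2 * pi}" and e: "e > 0"
  obtains S where "finite S" "\<And>T. finite T \<Longrightarrow> S \<subseteq> T \<Longrightarrow>
    (LINT x|lebesgue_on {0..2 * pi}. (cmod (f x))\<^sup>2) < 2 * pi * (\<Sum>k\<in>T. (cmod (fourier_coeff f k))\<^sup>2) + e"
proof -
  obtain P where P: "is_trig_poly P" "(LINT x|lebesgue_on {0..2 * pi}. (cmod (f x - P x))\<^sup>2) < e"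
    using trig_poly_dense_L2[OF f e] .
  then obtain S b where S: "finite S" "P = trig_poly S b" by (auto simp: is_trig_poly_def)
  show thesis
  proof (rule that[OF S(1)])
    fix T assume T: "finite T" "S \<subseteq> T"
    have "P = trig_poly T (\<lambda>k. if k \<in> S then b k else 0)" using trig_poly_extend[OF T] S by simp
    then have "(LINT x|lebesgue_on {0..2 * pi}. (cmod (f x))\<^sup>2) - 2 * pi * (\<Sum>k\<in>T. (cmod (fourier_coeff f k))\<^sup>2)
       + 2 * pi * (\<Sum>k\<in>T. (cmod (fourier_coeff f k - (if k \<in> S then b k else 0)))\<^sup>2) < e"
      using P(2) integral_norm_sq_minus_trig_poly[OF f T(1)] by simp
    moreover have "0 \<le> 2 * pi * (\<Sum>k\<in>T. (cmod (fourier_coeff f k - (if k \<in> S then b k else 0)))\<^sup>2)"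
      by (intro mult_nonneg_nonneg sum_nonneg) auto
    ultimately show "(LINT x|lebesgue_on {0..2 * pi}. (cmod (f x))\<^sup>2) < 2 * pi * (\<Sum>k\<in>T. (cmod (fourier_coeff f k))\<^sup>2) + e"
      by linarith
  qed
qed

text \<open>Chebyshev's counting bound applied to Bessel. Square summability enters the
  combinatorial argument in this form.\<close>

lemma fourier_coeff_decay:
  assumes f: "square_integrable_on f {0..2 * pi}" and "\<epsilon> > 0"
  shows "finite {k. \<epsilon> \<le> cmod (fourier_coeff f k)}"
proof (rule finite_if_finite_subsets_card_bdd[THEN conjunct1])
  let ?I = "LINT x|lebesgue_on {0..2 * pi}. (cmod (f x))\<^sup>2"
  fix F assume F: "F \<subseteq> {k. \<epsilon> \<le> cmod (fourier_coeff f k)}" "finite F"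
  have "real (card F) * \<epsilon>\<^sup>2 = (\<Sum>k\<in>F. \<epsilon>\<^sup>2)" by simp
  also have "\<dots> \<le> (\<Sum>k\<in>F. (cmod (fourier_coeff f k))\<^sup>2)"
    using F assms(2) by (intro sum_mono power_mono) auto
  finally have "2 * pi * (real (card F) * \<epsilon>\<^sup>2) \<le> ?I"
    using bessel_inequality[OF f F(2)] by (meson mult_left_mono order_trans pi_ge_zero zero_le_mult_iff zero_le_numeral)
  then have "real (card F) \<le> ?I / (2 * pi * \<epsilon>\<^sup>2)" using assms(2) by (simp add: field_simps)
  then show "card F \<le> nat \<lceil>?I / (2 * pi * \<epsilon>\<^sup>2)\<rceil>" by linarith
qed

lemma L2_zero_if_fourier_zero:
  assumes f: "square_integrable_on f {0..2 * pi}" and z: "\<And>k. fourier_coeff f k = 0"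
  shows "AE x in lebesgue_on {0..2 * pi}. f x = 0"
proof -
  have "(LINT x|lebesgue_on {0..2 * pi}. (cmod (f x))\<^sup>2) \<le> 0"
  proof (rule field_le_epsilon)
    fix \<epsilon> :: real assume "0 < \<epsilon>"
    then obtain S where "finite S" "\<And>T. finite T \<Longrightarrow> S \<subseteq> T \<Longrightarrow>
        (LINT x|lebesgue_on {0..2 * pi}. (cmod (f x))\<^sup>2) < 2 * pi * (\<Sum>k\<in>T. (cmod (fourier_coeff f k))\<^sup>2) + \<epsilon>"
      by (rule parseval_approx[OF f]) blast
    from this(2)[OF this(1)] show "(LINT x|lebesgue_on {0..2 * pi}. (cmod (f x))\<^sup>2) \<le> 0 + \<epsilon>" by (simp add: z)
  qed
  then have "(LINT x|lebesgue_on {0..2 * pi}. (cmod (f x))\<^sup>2) = 0"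
    by (intro antisym) auto
  then show ?thesis
    using f integral_nonneg_eq_0_iff_AE[of "lebesgue_on {0..2 * pi}" "\<lambda>x. (cmod (f x))\<^sup>2"]
    by (simp add: square_integrable_on_def)
qed

section \<open>The inequalities of Ingham and Haraux\<close>

text \<open>Indexed by the frequencies themselves: integers sharing a frequency are merged
  beforehand, and the coefficient is then a class sum.\<close>

definition expsum :: "real set \<Rightarrow> (real \<Rightarrow> complex) \<Rightarrow> real \<Rightarrow> complex" where
  "expsum F a t = (\<Sum>l\<in>F. a l * cis (l * t))"

lemma continuous_on_expsum [continuous_intros]:
  "continuous_on S g \<Longrightarrow> continuous_on S (\<lambda>t. expsum F a (g t))"
  unfolding expsum_def by (intro continuous_intros)

lemma integrable_on_continuous_UNIV:
  fixes f :: "real \<Rightarrow> 'a::banach"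
  assumes "continuous_on UNIV f"
  shows "f integrable_on {a..b}"
  using assms continuous_on_subset integrable_continuous_real by blast

lemma expsum_shift: "expsum F a (t + s) = expsum F (\<lambda>l. a l * cis (l * s)) t"
  unfolding expsum_def by (intro sum.cong refl) (simp add: cis_mult algebra_simps)

lemma expsum_remove:
  "finite F \<Longrightarrow> m \<in> F \<Longrightarrow> expsum F a t = a m * cis (m * t) + expsum (F - {m}) a t"
  unfolding expsum_def by (simp add: sum.remove)

text \<open>The Fourier transform of Ingham's weight on [0, T]. The weight vanishes at both ends, so
  the transform decays quadratically, which makes the row sums of the resulting quadratic form
  bounded.\<close>

lemma integral_sin_cis:
  fixes T x :: real
  assumes "T > 0" and x: "x\<^sup>2 \<noteq> (pi / T)\<^sup>2"
  shows "((\<lambda>t. of_real (sin (pi / T * t)) * cis (x * t)) has_integral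
           of_real (pi / T) * (1 + cis (x * T)) / of_real ((pi / T)\<^sup>2 - x\<^sup>2)) {0..T}"
proof -
  define a where "a = pi / T"
  \<comment> \<open>An antiderivative of sin (a t) e^(i x t), as obtained by integrating by parts
    twice.\<close>
  define G where "G t = (\<i> * of_real x * of_real (sin (a * t)) - of_real a * of_real (cos (a * t)))
      * cis (x * t) / of_real (a\<^sup>2 - x\<^sup>2)" for t
  have aT: "a * T = pi" using assms by (simp add: a_def)
  have nz: "complex_of_real (a\<^sup>2 - x\<^sup>2) \<noteq> 0" using x unfolding of_real_eq_0_iff by (simp add: a_def)
  have "(G has_vector_derivative of_real (sin (a * t)) * cis (x * t)) (at t within {0..T})" for t
  proof -
    define G' where "G' z = (\<i> * of_real x * sin (of_real a * z) - of_real a * cos (of_real a * z))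
      * exp (\<i> * of_real x * z) / of_real (a\<^sup>2 - x\<^sup>2)" for z :: complex
    have sq: "complex_of_real (a\<^sup>2 - x\<^sup>2) = of_real a * of_real a - of_real x * of_real x"
      by (simp add: power2_eq_square)
    have "(G' has_field_derivative sin (of_real a * z) * exp (\<i> * of_real x * z)) (at z)" for z
      unfolding G'_def
      by (rule derivative_eq_intros refl nz | simp)+
         (use nz in \<open>simp add: field_simps power2_eq_square\<close>)
    from has_vector_derivative_real_field[OF this, of t]
    have "((\<lambda>t. G' (of_real t)) has_vector_derivative
        sin (of_real a * of_real t) * exp (\<i> * of_real x * of_real t)) (at t within {0..T})"
      by (rule has_vector_derivative_at_within)
    moreover have "(\<lambda>t. G' (of_real t)) = G"
      unfolding G'_def G_def by (auto simp: fun_eq_iff cis_conv_exp sin_of_real cos_of_real mult_ac simp flip: of_real_mult)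
    moreover have "sin (of_real a * of_real t) * exp (\<i> * of_real x * of_real t)
       = of_real (sin (a * t)) * cis (x * t)"
      by (simp add: cis_conv_exp sin_of_real mult_ac flip: of_real_mult)
    ultimately show ?thesis by simp
  qed
  from fundamental_theorem_of_calculus[OF _ this] assms(1)
  have "((\<lambda>t. of_real (sin (a * t)) * cis (x * t)) has_integral G T - G 0) {0..T}"
    by simp
  moreover have "G T - G 0 = of_real a * (1 + cis (x * T)) / of_real (a\<^sup>2 - x\<^sup>2)"
  proof -
    have "G T = of_real a * cis (x * T) / of_real (a\<^sup>2 - x\<^sup>2)" unfolding G_def aT by simp
    moreover have "G 0 = - of_real a / of_real (a\<^sup>2 - x\<^sup>2)" unfolding G_def by simp
    ultimately show ?thesis by (simp add: add_divide_distrib distrib_left)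
  qed
  ultimately show ?thesis
    by (simp add: a_def)
qed

definition separated :: "real \<Rightarrow> real set \<Rightarrow> bool" where
  "separated g S \<longleftrightarrow> (\<forall>x\<in>S. \<forall>y\<in>S. x \<noteq> y \<longrightarrow> g \<le> \<bar>x - y\<bar>)"

text \<open>Telescoping through 1 / (4 j^2 - 1) = (1 / (2 j - 1) - 1 / (2 j + 1)) / 2. The limit 1/2
  on each side is what makes 2 pi / T the threshold for the gap.\<close>

lemma sum_inverse_4sq: "(\<Sum>j=1..n. 1 / (4 * (real j)\<^sup>2 - 1)) = (1 - 1 / (2 * real n + 1)) / 2"
proof (induction n)
  case (Suc n)
  have "4 * (real (Suc n))\<^sup>2 - 1 = (2 * real n + 1) * (2 * real n + 3)"
    by (simp add: power2_eq_square algebra_simps)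
  then have "1 / (4 * (real (Suc n))\<^sup>2 - 1) = (1 / (2 * real n + 1) - 1 / (2 * real n + 3)) / 2"
    by (simp add: divide_simps)
  moreover have "(\<Sum>j=1..Suc n. 1 / (4 * (real j)\<^sup>2 - 1))
      = (\<Sum>j=1..n. 1 / (4 * (real j)\<^sup>2 - 1)) + 1 / (4 * (real (Suc n))\<^sup>2 - 1)"
    by simp
  ultimately have "(\<Sum>j=1..Suc n. 1 / (4 * (real j)\<^sup>2 - 1)) = (1 - 1 / (2 * real n + 3)) / 2"
    unfolding Suc by (simp add: diff_divide_distrib)
  also have "2 * real n + 3 = 2 * real (Suc n) + 1" by simp
  finally show ?case .
qed auto

text \<open>Separation gives distinct points of A distinct values j = floor (x / g) >= 1, and
  \<open>q \<ge> 1\<close> gives 4 q^2 (x / g)^2 - 1 >= q^2 (4 j^2 - 1), so the telescoping series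
  dominates.\<close>

lemma one_sided_sum:
  fixes A :: "real set" and g q :: real
  assumes fin: "finite A" and g: "g > 0" and q: "q \<ge> 1" and sep: "separated g A"
    and far: "\<And>x. x \<in> A \<Longrightarrow> g \<le> x"
  shows "(\<Sum>x\<in>A. 1 / (4 * q\<^sup>2 * (x / g)\<^sup>2 - 1)) \<le> 1 / (2 * q\<^sup>2)"
proof -
  define J where "J x = nat \<lfloor>x / g\<rfloor>" for x
  have J1: "1 \<le> J x \<and> real (J x) \<le> x / g" if "x \<in> A" for x
  proof -
    have "1 \<le> x / g" using far[OF that] g by simp
    then have "1 \<le> \<lfloor>x / g\<rfloor>" by simp
    then show ?thesis unfolding J_def using of_int_floor_le[of "x / g"] by linarith
  qed
  have inj: "inj_on J A"
  proof (rule inj_onI, rule ccontr)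
    fix x y assume xy: "x \<in> A" "y \<in> A" "J x = J y" "x \<noteq> y"
    have "\<lfloor>x / g\<rfloor> = \<lfloor>y / g\<rfloor>"
      using xy J1[OF xy(1)] J1[OF xy(2)] by (auto simp: J_def)
    then have "\<bar>x / g - y / g\<bar> < 1" by linarith
    then have "\<bar>x - y\<bar> < g" using g by (simp add: abs_if field_simps split: if_splits)
    then show False using sep xy by (force simp: separated_def)
  qed
  have key: "1 / (4 * q\<^sup>2 * (x / g)\<^sup>2 - 1) \<le> 1 / q\<^sup>2 * (1 / (4 * (real (J x))\<^sup>2 - 1))" if "x \<in> A" for x
  proof -
    have j: "1 \<le> real (J x)" "real (J x) \<le> x / g" using J1[OF that] by auto
    have "(real (J x))\<^sup>2 \<le> (x / g)\<^sup>2" using j by (intro power_mono) auto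
    then have *: "q\<^sup>2 * (real (J x))\<^sup>2 \<le> q\<^sup>2 * (x / g)\<^sup>2" by (intro mult_left_mono) auto
    have q1: "1 \<le> q\<^sup>2" using q by simp
    have j1: "1 \<le> (real (J x))\<^sup>2" using j by simp
    have "q\<^sup>2 * (4 * (real (J x))\<^sup>2 - 1) \<le> 4 * q\<^sup>2 * (x / g)\<^sup>2 - 1"
      using * q1 by (simp add: algebra_simps)
    moreover have "0 < q\<^sup>2 * (4 * (real (J x))\<^sup>2 - 1)" using q1 j1 by (intro mult_pos_pos) auto
    ultimately show ?thesis by (simp add: frac_le)
  qed
  obtain n where n: "J ` A \<subseteq> {1..n}"
  proof
    show "J ` A \<subseteq> {1..Max (insert 0 (J ` A))}" using J1 fin by auto
  qed
  have "(\<Sum>x\<in>A. 1 / (4 * q\<^sup>2 * (x / g)\<^sup>2 - 1)) \<le> (\<Sum>x\<in>A. 1 / q\<^sup>2 * (1 / (4 * (real (J x))\<^sup>2 - 1)))"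
    by (intro sum_mono key)
  also have "\<dots> = 1 / q\<^sup>2 * (\<Sum>j\<in>J ` A. 1 / (4 * (real j)\<^sup>2 - 1))"
    by (simp add: sum.reindex[OF inj] sum_distrib_left)
  also have "\<dots> \<le> 1 / q\<^sup>2 * (\<Sum>j=1..n. 1 / (4 * (real j)\<^sup>2 - 1))"
  proof (intro mult_left_mono sum_mono2 n)
    fix j assume "j \<in> {1..n} - J ` A"
    then have "1 \<le> real j" by auto
    then have "1 \<le> (real j)\<^sup>2" by simp
    then show "0 \<le> 1 / (4 * (real j)\<^sup>2 - 1)" by simp
  qed auto
  also have "\<dots> \<le> 1 / q\<^sup>2 * (1 / 2)"
    unfolding sum_inverse_4sq by (intro mult_left_mono) (auto simp: field_simps)
  finally show ?thesis by simp
qed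

lemma row_sum_bound:
  fixes T g :: real
  assumes T: "T > 0" and fin: "finite F" and sep: "separated g F" and g: "g > 2 * pi / T" and l: "l \<in> F"
  shows "(\<Sum>m\<in>F - {l}. 2 * (pi / T) / ((l - m)\<^sup>2 - (pi / T)\<^sup>2)) \<le> 2 * T / pi * (2 * pi / (T * g))\<^sup>2"
proof -
  define a where "a = pi / T"
  \<comment> \<open>The gap condition becomes q > 1, and x^2 - a^2 = a^2 (4 q^2 (x / g)^2 - 1). The
    frequencies on either side of l contribute at most 1 / (2 q^2).\<close>
  define q where "q = g / (2 * a)"
  have a: "a > 0" using T by (simp add: a_def)
  have g0: "g > 2 * a" using g by (simp add: a_def)
  then have gpos: "g > 0" using a by simp
  have q: "q > 1" using a g0 by (simp add: q_def)
  have gq: "g = 2 * a * q" using a by (simp add: q_def)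
  have tr: "2 * a / (x\<^sup>2 - a\<^sup>2) = 2 / a * (1 / (4 * q\<^sup>2 * (x / g)\<^sup>2 - 1))" for x
  proof -
    have "x\<^sup>2 - a\<^sup>2 = a\<^sup>2 * (4 * q\<^sup>2 * (x / g)\<^sup>2 - 1)"
      using a q by (simp add: gq power_divide power_mult_distrib field_simps)
    then show ?thesis using a by (simp add: power2_eq_square)
  qed
  define R where "R = {m\<in>F. m > l}"
  define L where "L = {m\<in>F. m < l}"
  have FRL: "F - {l} = R \<union> L" "R \<inter> L = {}" by (auto simp: R_def L_def)
  have finRL: "finite R" "finite L" using fin by (auto simp: R_def L_def)
  have "(\<Sum>m\<in>R. 1 / (4 * q\<^sup>2 * ((l - m) / g)\<^sup>2 - 1)) = (\<Sum>x\<in>(\<lambda>m. m - l) ` R. 1 / (4 * q\<^sup>2 * (x / g)\<^sup>2 - 1))"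
    by (subst sum.reindex) (auto simp: inj_on_def power2_commute power_divide)
  also have "\<dots> \<le> 1 / (2 * q\<^sup>2)"
    using sep l finRL q gpos by (intro one_sided_sum) (force simp: separated_def R_def)+
  finally have 1: "(\<Sum>m\<in>R. 1 / (4 * q\<^sup>2 * ((l - m) / g)\<^sup>2 - 1)) \<le> 1 / (2 * q\<^sup>2)" .
  have "(\<Sum>m\<in>L. 1 / (4 * q\<^sup>2 * ((l - m) / g)\<^sup>2 - 1)) = (\<Sum>x\<in>(\<lambda>m. l - m) ` L. 1 / (4 * q\<^sup>2 * (x / g)\<^sup>2 - 1))"
    by (subst sum.reindex) (auto simp: inj_on_def)
  also have "\<dots> \<le> 1 / (2 * q\<^sup>2)"
    using sep l finRL q gpos by (intro one_sided_sum) (force simp: separated_def L_def)+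
  finally have 2: "(\<Sum>m\<in>L. 1 / (4 * q\<^sup>2 * ((l - m) / g)\<^sup>2 - 1)) \<le> 1 / (2 * q\<^sup>2)" .
  have "(\<Sum>m\<in>F - {l}. 2 * a / ((l - m)\<^sup>2 - a\<^sup>2))
      = 2 / a * ((\<Sum>m\<in>R. 1 / (4 * q\<^sup>2 * ((l - m) / g)\<^sup>2 - 1)) + (\<Sum>m\<in>L. 1 / (4 * q\<^sup>2 * ((l - m) / g)\<^sup>2 - 1)))"
    unfolding FRL(1) tr using finRL FRL(2) by (simp add: sum.union_disjoint sum_distrib_left distrib_left)
  also have "\<dots> \<le> 2 / a * (1 / q\<^sup>2)"
    using a 1 2 by (intro mult_left_mono) auto
  also have "\<dots> = 2 * T / pi * (2 * pi / (T * g))\<^sup>2"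
    using T by (simp add: q_def a_def power_divide field_simps power2_eq_square)
  finally show ?thesis by (simp add: a_def)
qed

lemma expsum_norm_sq:
  "complex_of_real ((cmod (expsum F a t))\<^sup>2) = (\<Sum>l\<in>F. \<Sum>m\<in>F. a l * cnj (a m) * cis ((l - m) * t))"
  unfolding complex_norm_square expsum_def
  by (simp add: sum_product cis_cnj cis_mult algebra_simps cnj_sum)

text \<open>Expanding the square gives a quadratic form with diagonal entries 2 T / pi. Its
  off-diagonal part is handled by a Schur test: |a_l| |a_m| <= (|a_l|^2 + |a_m|^2) / 2, with a
  symmetric kernel whose row sums are bounded. Being two-sided, the estimate serves for the lower
  and the upper inequality.\<close>

lemma ingham_weighted:
  fixes T g :: real
  assumes T: "T > 0" and fin: "finite F" and sep: "separated g F" and g: "g > 2 * pi / T"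
  shows "\<bar>integral {0..T} (\<lambda>t. sin (pi / T * t) * (cmod (expsum F a t))\<^sup>2) - 2 * T / pi * (\<Sum>l\<in>F. (cmod (a l))\<^sup>2)\<bar>
     \<le> 2 * T / pi * (2 * pi / (T * g))\<^sup>2 * (\<Sum>l\<in>F. (cmod (a l))\<^sup>2)"
proof -
  define K where "K x = of_real (pi / T) * (1 + cis (x * T)) / of_real ((pi / T)\<^sup>2 - x\<^sup>2)" for x
  define k where "k x = 2 * (pi / T) / (x\<^sup>2 - (pi / T)\<^sup>2)" for x :: real
  have piT: "0 < pi / T" using T by simp
  have gp: "g > pi / T" "g > 0" using g piT by (auto intro: less_trans[OF piT])
  have diff: "(pi / T)\<^sup>2 < (l - m)\<^sup>2" if "l \<in> F" "m \<in> F" "l \<noteq> m" for l m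
  proof -
    have "pi / T < \<bar>l - m\<bar>" using sep that gp(1) by (force simp: separated_def)
    then have "(pi / T)\<^sup>2 < \<bar>l - m\<bar>\<^sup>2" using piT by (intro power_strict_mono) auto
    then show ?thesis by simp
  qed
  have K0: "K 0 = of_real (2 * T / pi)" using T by (simp add: K_def power2_eq_square field_simps)
  have Kk: "cmod (K (l - m)) \<le> k (l - m)" if "l \<in> F" "m \<in> F" "l \<noteq> m" for l m
  proof -
    have "cmod (1 + cis ((l - m) * T)) \<le> 2" using norm_triangle_ineq[of 1 "cis ((l-m)*T)"] by simp
    then have "cmod (of_real (pi / T) * (1 + cis ((l - m) * T))) \<le> 2 * (pi / T)"
      unfolding norm_mult norm_of_real using piT T mult_left_mono[of _ 2 "pi / T"]
      by (simp add: mult.commute[of 2])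
    then have "cmod (K (l - m)) \<le> 2 * (pi / T) / \<bar>(pi / T)\<^sup>2 - (l - m)\<^sup>2\<bar>"
      unfolding K_def norm_divide norm_of_real by (intro divide_right_mono) auto
    then show ?thesis using diff[OF that] by (simp add: k_def)
  qed
  have hint: "((\<lambda>t. of_real (sin (pi / T * t)) * cis ((l - m) * t)) has_integral K (l - m)) {0..T}"
    if "l \<in> F" "m \<in> F" for l m
  proof -
    have "(l - m)\<^sup>2 \<noteq> (pi / T)\<^sup>2" using that diff[of l m] piT T by (cases "l = m") auto
    then show ?thesis unfolding K_def by (intro integral_sin_cis T)
  qed
  have "((\<lambda>t. \<Sum>l\<in>F. \<Sum>m\<in>F. a l * cnj (a m) * (of_real (sin (pi / T * t)) * cis ((l - m) * t)))
      has_integral (\<Sum>l\<in>F. \<Sum>m\<in>F. a l * cnj (a m) * K (l - m))) {0..T}"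
    by (intro has_integral_sum fin has_integral_mult_right hint)
  also have "(\<lambda>t. \<Sum>l\<in>F. \<Sum>m\<in>F. a l * cnj (a m) * (of_real (sin (pi / T * t)) * cis ((l - m) * t)))
     = (\<lambda>t. of_real (sin (pi / T * t) * (cmod (expsum F a t))\<^sup>2))"
    unfolding of_real_mult expsum_norm_sq sum_distrib_left by (simp add: mult_ac)
  finally have I: "((\<lambda>t. complex_of_real (sin (pi / T * t) * (cmod (expsum F a t))\<^sup>2))
      has_integral (\<Sum>l\<in>F. \<Sum>m\<in>F. a l * cnj (a m) * K (l - m))) {0..T}" .
  have "((\<lambda>t. sin (pi / T * t) * (cmod (expsum F a t))\<^sup>2) has_integral
      integral {0..T} (\<lambda>t. sin (pi / T * t) * (cmod (expsum F a t))\<^sup>2)) {0..T}"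
    by (intro integrable_integral integrable_on_continuous_UNIV continuous_intros)
  from has_integral_of_real[OF this, where 'b = complex] I
  have "of_real (integral {0..T} (\<lambda>t. sin (pi / T * t) * (cmod (expsum F a t))\<^sup>2))
     = (\<Sum>l\<in>F. \<Sum>m\<in>F. a l * cnj (a m) * K (l - m))"
    by (rule has_integral_unique)
  also have "\<dots> = (\<Sum>l\<in>F. of_real (2 * T / pi * (cmod (a l))\<^sup>2) + (\<Sum>m\<in>F - {l}. a l * cnj (a m) * K (l - m)))"
    using fin by (intro sum.cong refl) (simp add: sum.remove K0 complex_norm_square[symmetric] mult.commute)
  also have "\<dots> = of_real (2 * T / pi * (\<Sum>l\<in>F. (cmod (a l))\<^sup>2)) + (\<Sum>l\<in>F. \<Sum>m\<in>F - {l}. a l * cnj (a m) * K (l - m))"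
    by (simp add: sum.distrib sum_distrib_left)
  finally have "complex_of_real (integral {0..T} (\<lambda>t. sin (pi / T * t) * (cmod (expsum F a t))\<^sup>2)
       - 2 * T / pi * (\<Sum>l\<in>F. (cmod (a l))\<^sup>2)) = (\<Sum>l\<in>F. \<Sum>m\<in>F - {l}. a l * cnj (a m) * K (l - m))"
    by simp
  then have "\<bar>integral {0..T} (\<lambda>t. sin (pi / T * t) * (cmod (expsum F a t))\<^sup>2) - 2 * T / pi * (\<Sum>l\<in>F. (cmod (a l))\<^sup>2)\<bar>
      = cmod (\<Sum>l\<in>F. \<Sum>m\<in>F - {l}. a l * cnj (a m) * K (l - m))"
    by (simp only: flip: norm_of_real[where 'a = complex])
  also have "\<dots> \<le> (\<Sum>l\<in>F. \<Sum>m\<in>F - {l}. cmod (a l) * cmod (a m) * k (l - m))"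
    by (intro order_trans[OF norm_sum] sum_mono) (auto simp: norm_mult intro!: mult_left_mono Kk)
  also have "\<dots> \<le> (\<Sum>l\<in>F. \<Sum>m\<in>F - {l}. ((cmod (a l))\<^sup>2 / 2 + (cmod (a m))\<^sup>2 / 2) * k (l - m))"
  proof (intro sum_mono mult_right_mono)
    fix l m assume lm: "l \<in> F" "m \<in> F - {l}"
    show "cmod (a l) * cmod (a m) \<le> (cmod (a l))\<^sup>2 / 2 + (cmod (a m))\<^sup>2 / 2"
      using sum_squares_bound[of "cmod (a l)" "cmod (a m)"] by simp
    show "0 \<le> k (l - m)" using diff[of l m] lm piT T unfolding k_def by (intro divide_nonneg_nonneg) auto
  qed
  also have "\<dots> = (\<Sum>l\<in>F. \<Sum>m\<in>F - {l}. (cmod (a l))\<^sup>2 / 2 * k (l - m)) + (\<Sum>l\<in>F. \<Sum>m\<in>F - {l}. (cmod (a m))\<^sup>2 / 2 * k (l - m))"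
    by (simp add: sum.distrib distrib_right)
  also have "(\<Sum>l\<in>F. \<Sum>m\<in>F - {l}. (cmod (a m))\<^sup>2 / 2 * k (l - m)) = (\<Sum>l\<in>F. \<Sum>m\<in>F - {l}. (cmod (a l))\<^sup>2 / 2 * k (l - m))"
  proof -
    have e: "(\<Sum>l\<in>F. \<Sum>m\<in>F - {l}. f l m) = (\<Sum>l\<in>F. \<Sum>m\<in>F. if l = m then 0 else f l m)" for f :: "real \<Rightarrow> real \<Rightarrow> real"
      using fin by (intro sum.cong refl sum.mono_neutral_cong_left) auto
    show ?thesis unfolding e
      by (subst sum.swap) (auto intro!: sum.cong simp: k_def power2_commute)
  qed
  also have "(\<Sum>l\<in>F. \<Sum>m\<in>F - {l}. (cmod (a l))\<^sup>2 / 2 * k (l - m)) + (\<Sum>l\<in>F. \<Sum>m\<in>F - {l}. (cmod (a l))\<^sup>2 / 2 * k (l - m))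
     = (\<Sum>l\<in>F. (cmod (a l))\<^sup>2 * (\<Sum>m\<in>F - {l}. k (l - m)))"
    by (simp add: sum.distrib[symmetric] sum_distrib_left mult_ac)
  also have "\<dots> \<le> (\<Sum>l\<in>F. (cmod (a l))\<^sup>2 * (2 * T / pi * (2 * pi / (T * g))\<^sup>2))"
    unfolding k_def using row_sum_bound[OF T fin sep g] by (intro sum_mono mult_left_mono) auto
  finally show ?thesis by (simp only: sum_distrib_right[symmetric] mult.commute)
qed

text \<open>The constant is uniform over finite sets of frequencies; infinite series are reached
  only through partial sums.\<close>

definition riesz_lower :: "real \<Rightarrow> real set \<Rightarrow> bool" where
  "riesz_lower T S \<longleftrightarrow> (\<exists>C>0. \<forall>F a. finite F \<longrightarrow> F \<subseteq> S \<longrightarrow>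
     (\<Sum>l\<in>F. (cmod (a l))\<^sup>2) \<le> C * integral {0..T} (\<lambda>t. (cmod (expsum F a t))\<^sup>2))"

definition riesz_upper :: "real \<Rightarrow> real set \<Rightarrow> bool" where
  "riesz_upper T S \<longleftrightarrow> (\<exists>C>0. \<forall>F a. finite F \<longrightarrow> F \<subseteq> S \<longrightarrow>
     integral {0..T} (\<lambda>t. (cmod (expsum F a t))\<^sup>2) \<le> C * (\<Sum>l\<in>F. (cmod (a l))\<^sup>2))"

lemma separated_subset: "separated g S \<Longrightarrow> F \<subseteq> S \<Longrightarrow> separated g F"
  by (auto simp: separated_def)

text \<open>Ingham's inequality: the relative error r^2 of the weighted integral is below 1, and
  replacing the weight by 1 only increases the integral.\<close>

lemma riesz_lower_separated:
  assumes T: "T > 0" and sep: "separated g S" and g: "g > 2 * pi / T"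
  shows "riesz_lower T S"
proof -
  define r where "r = 2 * pi / (T * g)"
  have gpos: "g > 0" using T g by (auto intro: less_trans[of 0 "2 * pi / T"])
  have r: "0 < r" "r < 1" using T g gpos by (auto simp: r_def field_simps)
  then have r2: "r\<^sup>2 < 1" by (simp add: power_less_one_iff abs_square_less_1)
  define C where "C = 1 / (2 * T / pi * (1 - r\<^sup>2))"
  have c: "2 * T / pi * (1 - r\<^sup>2) > 0" using T r2 by simp
  show ?thesis unfolding riesz_lower_def
  proof (intro exI[of _ C] conjI allI impI)
    show "C > 0" unfolding C_def by (intro divide_pos_pos c) simp
    fix F :: "real set" and a :: "real \<Rightarrow> complex"
    assume F: "finite F" "F \<subseteq> S"
    have sep': "separated g F" using sep F by (rule_tac separated_subset)
    have "2 * T / pi * (1 - r\<^sup>2) * (\<Sum>l\<in>F. (cmod (a l))\<^sup>2)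
        \<le> integral {0..T} (\<lambda>t. sin (pi / T * t) * (cmod (expsum F a t))\<^sup>2)"
    proof -
      have "\<bar>I - c * A\<bar> \<le> c * r\<^sup>2 * A \<Longrightarrow> c * (1 - r\<^sup>2) * A \<le> I" for I c A :: real
        by (simp add: abs_le_iff algebra_simps)
      then show ?thesis
        using ingham_weighted[OF T F(1) sep' g, of a] unfolding r_def[symmetric] by blast
    qed
    also have "\<dots> \<le> integral {0..T} (\<lambda>t. (cmod (expsum F a t))\<^sup>2)"
    proof (intro integral_le integrable_on_continuous_UNIV continuous_intros)
      fix t show "sin (pi / T * t) * (cmod (expsum F a t))\<^sup>2 \<le> (cmod (expsum F a t))\<^sup>2"
        using mult_right_mono[OF sin_le_one, of "(cmod (expsum F a t))\<^sup>2"] by simp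
    qed
    finally show "(\<Sum>l\<in>F. (cmod (a l))\<^sup>2) \<le> C * integral {0..T} (\<lambda>t. (cmod (expsum F a t))\<^sup>2)"
      using c by (simp add: C_def field_simps)
  qed
qed

section \<open>The upper estimate for exponential sums\<close>

lemma integral_shift:
  fixes f :: "real \<Rightarrow> 'a::euclidean_space"
  assumes "continuous_on UNIV f"
  shows "integral {a..b} (\<lambda>t. f (t + s)) = integral {a + s..b + s} f"
proof -
  have "(f has_integral integral {a + s..b + s} f) (cbox (a + s) (b + s))"
    using assms by (simp add: integrable_integral integrable_on_continuous_UNIV)
  from has_integral_affinity'[OF this, of 1 s] show ?thesis by (simp add: integral_unique)
qed

text \<open>The weight is small near the ends of its interval, so the integral is moved to the
  middle half of [0, 2 * U], where the sine is at least 1/2. Enlarging the interval is free in an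
  upper estimate, which is why every positive T and g are allowed.\<close>

lemma riesz_upper_separated:
  assumes T: "T > 0" and sep: "separated g S" and g: "g > 0"
  shows "riesz_upper T S"
proof -
  \<comment> \<open>U covers [0, T], and U > 2 pi / g ensures the gap condition on an interval of
    length 2 * U.\<close>
  define U where "U = T + 2 * pi / g"
  have U: "U > 0" "T \<le> U" "g > 2 * pi / (2 * U)" "2 * U > 0" using T g by (auto simp: U_def field_simps add_pos_pos)
  show ?thesis unfolding riesz_upper_def
  proof (intro exI[of _ "8 * (2 * U) / pi"] conjI allI impI)
    show "0 < 8 * (2 * U) / pi" using U by simp
    fix F :: "real set" and a :: "real \<Rightarrow> complex"
    assume F: "finite F" "F \<subseteq> S"
    have sep': "separated g F" using sep F by (rule_tac separated_subset)
    define b where "b = (\<lambda>l. a l * cis (l * (- U / 2)))"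
    define A where "A = (\<Sum>l\<in>F. (cmod (a l))\<^sup>2)"
    have A: "(\<Sum>l\<in>F. (cmod (b l))\<^sup>2) = A" by (simp add: b_def A_def norm_mult)
    have bs: "expsum F b (t + U / 2) = expsum F a t" for t
      unfolding b_def expsum_shift[symmetric] by simp
    have cont: "continuous_on UNIV (\<lambda>t. (cmod (expsum F b t))\<^sup>2)"
      "continuous_on UNIV (\<lambda>t. sin (pi / (2 * U) * t) * (cmod (expsum F b t))\<^sup>2)"
      by (intro continuous_intros)+
    have nn: "0 \<le> sin (pi / (2 * U) * t)" if "t \<in> {0..2 * U}" for t
      using that U by (intro sin_ge_zero) (auto simp: field_simps)
    have half: "1 / 2 \<le> sin (pi / (2 * U) * t)" if "t \<in> {U / 2..U + U / 2}" for t
    proof -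
      define x where "x = pi / (2 * U) * t"
      have x: "pi / 4 \<le> x" "x \<le> 3 * pi / 4" using that U by (auto simp: field_simps x_def)
      have "cos (pi / 3) \<le> cos \<bar>pi / 2 - x\<bar>"
        using x by (intro cos_monotone_0_pi_le) (auto simp: abs_if)
      moreover have "cos \<bar>pi / 2 - x\<bar> = sin x" using sin_cos_eq[of x] by simp
      ultimately show ?thesis unfolding x_def[symmetric] by (simp add: cos_60)
    qed
    have "(2 * pi / (2 * U * g))\<^sup>2 \<le> 1"
      unfolding abs_square_le_1 using U g by (auto simp: field_simps)
    then have le1: "2 * (2 * U) / pi * (2 * pi / (2 * U * g))\<^sup>2 * A \<le> 2 * (2 * U) / pi * 1 * A"
      using U by (intro mult_right_mono mult_left_mono) (auto simp: A_def sum_nonneg)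
    have "integral {0..T} (\<lambda>t. (cmod (expsum F a t))\<^sup>2) \<le> integral {0..U} (\<lambda>t. (cmod (expsum F a t))\<^sup>2)"
      using U by (intro integral_subset_le integrable_on_continuous_UNIV continuous_intros) auto
    also have "\<dots> = integral {0 + U / 2..U + U / 2} (\<lambda>t. (cmod (expsum F b t))\<^sup>2)"
      using integral_shift[OF cont(1), of 0 U "U / 2"] by (simp add: bs)
    also have "\<dots> \<le> integral {0 + U / 2..U + U / 2} (\<lambda>t. 2 * (sin (pi / (2 * U) * t) * (cmod (expsum F b t))\<^sup>2))"
    proof (intro integral_le integrable_on_continuous_UNIV continuous_intros)
      fix t assume "t \<in> {0 + U / 2..U + U / 2}"
      then have "1 / 2 * (cmod (expsum F b t))\<^sup>2 \<le> sin (pi / (2 * U) * t) * (cmod (expsum F b t))\<^sup>2"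
        using half by (intro mult_right_mono) auto
      then show "(cmod (expsum F b t))\<^sup>2 \<le> 2 * (sin (pi / (2 * U) * t) * (cmod (expsum F b t))\<^sup>2)" by simp
    qed
    also have "\<dots> = 2 * integral {0 + U / 2..U + U / 2} (\<lambda>t. sin (pi / (2 * U) * t) * (cmod (expsum F b t))\<^sup>2)"
      by (rule integral_mult_right)
    also have "\<dots> \<le> 2 * integral {0..2 * U} (\<lambda>t. sin (pi / (2 * U) * t) * (cmod (expsum F b t))\<^sup>2)"
      using U nn by (intro mult_left_mono integral_subset_le integrable_on_continuous_UNIV cont) auto
    also have "\<dots> \<le> 2 * (2 * (2 * (2 * U) / pi * A))"
    proof -
      have "\<bar>I - c * A\<bar> \<le> c * r * A \<Longrightarrow> c * r * A \<le> c * 1 * A \<Longrightarrow> I \<le> 2 * (c * A)" for I c r :: real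
        by (simp add: abs_le_iff)
      from this[OF ingham_weighted[OF U(4) F(1) sep' U(3), of b, unfolded A] le1]
      show ?thesis by (intro mult_left_mono) auto
    qed
    finally show "integral {0..T} (\<lambda>t. (cmod (expsum F a t))\<^sup>2) \<le> 8 * (2 * U) / pi * (\<Sum>l\<in>F. (cmod (a l))\<^sup>2)"
      by (simp add: A_def[symmetric])
  qed
qed

lemma integral_expsum_split:
  assumes F: "finite F" and m: "m \<in> F"
  shows "integral {0..T} (\<lambda>t. (cmod (expsum F a t))\<^sup>2)
     \<le> 2 * (integral {0..T} (\<lambda>t. (cmod (a m))\<^sup>2)) + 2 * integral {0..T} (\<lambda>t. (cmod (expsum (F - {m}) a t))\<^sup>2)"
    and "integral {0..T} (\<lambda>t. (cmod (a m))\<^sup>2)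
     \<le> 2 * integral {0..T} (\<lambda>t. (cmod (expsum F a t))\<^sup>2) + 2 * integral {0..T} (\<lambda>t. (cmod (expsum (F - {m}) a t))\<^sup>2)"
proof -
  let ?i = "\<lambda>f::real \<Rightarrow> real. integral {0..T} f"
  let ?f = "\<lambda>t. (cmod (expsum F a t))\<^sup>2" and ?g = "\<lambda>t. (cmod (expsum (F - {m}) a t))\<^sup>2"
  have cont: "continuous_on UNIV ?f" "continuous_on UNIV ?g" by (intro continuous_intros)+
  have 1: "?i (\<lambda>t. 2 * (cmod (a m))\<^sup>2 + 2 * ?g t) = 2 * ?i (\<lambda>t. (cmod (a m))\<^sup>2) + 2 * ?i ?g"
    by (subst integral_add) (auto intro!: integrable_on_continuous_UNIV continuous_intros)
  have 2: "?i (\<lambda>t. 2 * ?f t + 2 * ?g t) = 2 * ?i ?f + 2 * ?i ?g"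
    by (subst integral_add) (auto intro!: integrable_on_continuous_UNIV continuous_intros)
  have "?i ?f \<le> ?i (\<lambda>t. 2 * (cmod (a m))\<^sup>2 + 2 * ?g t)"
  proof (intro integral_le integrable_on_continuous_UNIV continuous_intros)
    fix t
    show "?f t \<le> 2 * (cmod (a m))\<^sup>2 + 2 * ?g t"
      using norm_sq_add_le[of "a m * cis (m * t)" "expsum (F - {m}) a t"]
      by (simp add: expsum_remove[OF F m] norm_mult)
  qed
  then show "?i ?f \<le> 2 * (?i (\<lambda>t. (cmod (a m))\<^sup>2)) + 2 * ?i ?g" unfolding 1 .
  have "?i (\<lambda>t. (cmod (a m))\<^sup>2) \<le> ?i (\<lambda>t. 2 * ?f t + 2 * ?g t)"
  proof (intro integral_le integrable_on_continuous_UNIV continuous_intros)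
    fix t
    show "(cmod (a m))\<^sup>2 \<le> 2 * ?f t + 2 * ?g t"
      using norm_sq_diff_le[of "expsum F a t" "expsum (F - {m}) a t"]
      by (simp add: expsum_remove[OF F m] norm_mult)
  qed
  then show "?i (\<lambda>t. (cmod (a m))\<^sup>2) \<le> 2 * ?i ?f + 2 * ?i ?g" unfolding 2 .
qed

lemma riesz_upper_insert:
  assumes T: "T > 0" and S: "riesz_upper T S"
  shows "riesz_upper T (insert m S)"
proof -
  obtain C where C: "C > 0" "\<And>F a. finite F \<Longrightarrow> F \<subseteq> S \<Longrightarrow>
     integral {0..T} (\<lambda>t. (cmod (expsum F a t))\<^sup>2) \<le> C * (\<Sum>l\<in>F. (cmod (a l))\<^sup>2)"
    using S unfolding riesz_upper_def by blast
  show ?thesis unfolding riesz_upper_def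
  proof (intro exI[of _ "2 * T + 2 * C"] conjI allI impI)
    show "0 < 2 * T + 2 * C" using T C by simp
    fix F :: "real set" and a :: "real \<Rightarrow> complex"
    assume F: "finite F" "F \<subseteq> insert m S"
    let ?A = "\<lambda>F. \<Sum>l\<in>F. (cmod (a l))\<^sup>2"
    show "integral {0..T} (\<lambda>t. (cmod (expsum F a t))\<^sup>2) \<le> (2 * T + 2 * C) * ?A F"
    proof (cases "m \<in> F")
      case True
      have le: "(cmod (a m))\<^sup>2 \<le> ?A F" "?A (F - {m}) \<le> ?A F"
        using True F by (auto intro: member_le_sum sum_mono2)
      have "integral {0..T} (\<lambda>t. (cmod (expsum F a t))\<^sup>2)
         \<le> 2 * (T * (cmod (a m))\<^sup>2) + 2 * integral {0..T} (\<lambda>t. (cmod (expsum (F - {m}) a t))\<^sup>2)"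
        using integral_expsum_split(1)[OF F(1) True, of T a] T by simp
      also have "\<dots> \<le> 2 * (T * ?A F) + 2 * (C * ?A F)"
        using T F le C(1) by (intro add_mono mult_left_mono order_trans[OF C(2)]) auto
      finally show ?thesis by (simp add: algebra_simps)
    next
      case False
      then have "integral {0..T} (\<lambda>t. (cmod (expsum F a t))\<^sup>2) \<le> C * ?A F"
        using F by (intro C(2)) auto
      also have "\<dots> \<le> (2 * T + 2 * C) * ?A F"
        using T C by (intro mult_right_mono) (auto simp: sum_nonneg)
      finally show ?thesis .
    qed
  qed
qed

section \<open>Restoring exceptional frequencies in the lower estimate\<close>

lemma sin_less_self:
  assumes "0 < (x::real)"
  shows "sin x < x"
proof (cases "x \<le> 1")
  case True
  have "cos (x / 2) < cos 0"
    using True assms pi_gt3 by (intro cos_monotone_0_pi) auto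
  then have "x * cos (x / 2) < x" using assms by simp
  have "0 \<le> cos (x / 2)" using True assms pi_gt3 by (intro cos_ge_zero) auto
  then have "2 * sin (x / 2) * cos (x / 2) \<le> x * cos (x / 2)"
    using sin_x_le_x[of "x / 2"] assms by (intro mult_right_mono) auto
  then show ?thesis using \<open>x * cos (x / 2) < x\<close> sin_double[of "x / 2"] by simp
next
  case False
  then show ?thesis using sin_le_one[of x] by linarith
qed

text \<open>The function 1 - sin x / x is even, attains a positive minimum on the compact interval
  [x0, x0 + 2], and is at least 1/2 for |x| > 2.\<close>

lemma sinc_bound:
  assumes "(x0::real) > 0"
  shows "\<exists>c>0. \<forall>x. x0 \<le> \<bar>x\<bar> \<longrightarrow> c \<le> 1 - sin x / x"
proof -
  define h where "h x = 1 - sin x / x" for x :: real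
  have h_even: "h x = h \<bar>x\<bar>" for x by (simp add: h_def abs_if)
  have pos: "h x > 0" if "x > 0" for x using sin_less_self[OF that] that by (simp add: h_def)
  have "continuous_on {x0..x0 + 2} h"
    unfolding h_def using assms by (intro continuous_intros) auto
  then obtain y where y: "y \<in> {x0..x0 + 2}" "\<forall>x\<in>{x0..x0 + 2}. h y \<le> h x"
    using continuous_attains_inf[of "{x0..x0 + 2}" h] by auto
  have "min (h y) (1 / 2) \<le> h x" if "x0 \<le> \<bar>x\<bar>" for x
  proof (cases "\<bar>x\<bar> \<le> x0 + 2")
    case True
    then have "h y \<le> h \<bar>x\<bar>" using y that by auto
    then show ?thesis using h_even[of x] by simp
  next
    case False
    then have x: "2 < \<bar>x\<bar>" using assms by simp
    have "sin \<bar>x\<bar> / \<bar>x\<bar> \<le> 1 / 2"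
    proof -
      have "2 * sin \<bar>x\<bar> \<le> \<bar>x\<bar>" using x sin_le_one[of "\<bar>x\<bar>"] by linarith
      then show ?thesis using x by (simp add: divide_le_eq mult.commute)
    qed
    then show ?thesis using h_even[of x] by (simp add: h_def)
  qed
  moreover have "min (h y) (1 / 2) > 0" using pos[of y] y assms by auto
  ultimately show ?thesis unfolding h_def by blast
qed

lemma norm_cis_minus_1_sq: "(cmod (cis x - 1))\<^sup>2 = 2 - 2 * cos x"
proof -
  have "(cmod (cis x - 1))\<^sup>2 = (cos x)\<^sup>2 + (sin x)\<^sup>2 + 1 - 2 * cos x"
    by (simp add: cmod_power2 power2_diff)
  then show ?thesis by simp
qed

lemma integral_norm_cis_minus_1_sq:
  assumes "d > 0" "x \<noteq> 0"
  shows "((\<lambda>s. (cmod (cis (x * s) - 1))\<^sup>2) has_integral 2 * d * (1 - sin (x * d) / (x * d))) {0..d}"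
proof -
  have "((\<lambda>s. 2 - 2 * cos (x * s)) has_integral (2 * d - 2 * sin (x * d) / x) - (2 * 0 - 2 * sin (x * 0) / x)) {0..d}"
    using assms by (intro fundamental_theorem_of_calculus)
      (auto intro!: derivative_eq_intros simp flip: has_real_derivative_iff_has_vector_derivative)
  then show ?thesis using assms by (simp add: norm_cis_minus_1_sq right_diff_distrib)
qed

text \<open>The difference \<open>e\<^bsup>- i m s\<^esup> f(t + s) - f(t)\<close> no longer contains the frequency \<open>m\<close>; its other
  coefficients are those of \<open>f\<close> times \<open>e\<^bsup>i (l - m) s\<^esup> - 1\<close>, and the squares of these factors, integrated
  over \<open>s \<in> [0, d]\<close>, are bounded below uniformly in \<open>l\<close>.\<close>

lemma riesz_lower_insert:
  assumes d: "0 < d" "d < T" and e: "e > 0"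
    and low: "riesz_lower (T - d) S" and up: "riesz_upper T S"
    and far: "\<And>l. l \<in> S \<Longrightarrow> e \<le> \<bar>l - m\<bar>"
  shows "riesz_lower T (insert m S)"
proof -
  have T: "T > 0" using d by simp
  obtain C where C: "C > 0" "\<And>F a. finite F \<Longrightarrow> F \<subseteq> S \<Longrightarrow>
     (\<Sum>l\<in>F. (cmod (a l))\<^sup>2) \<le> C * integral {0..T - d} (\<lambda>t. (cmod (expsum F a t))\<^sup>2)"
    using low unfolding riesz_lower_def by blast
  obtain D where D: "D > 0" "\<And>F a. finite F \<Longrightarrow> F \<subseteq> S \<Longrightarrow>
     integral {0..T} (\<lambda>t. (cmod (expsum F a t))\<^sup>2) \<le> D * (\<Sum>l\<in>F. (cmod (a l))\<^sup>2)"
    using up unfolding riesz_upper_def by blast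
  obtain c where c: "c > 0" "\<And>x. e * d \<le> \<bar>x\<bar> \<Longrightarrow> c \<le> 1 - sin x / x"
    using sinc_bound[of "e * d"] e d by auto
  \<comment> \<open>4 * C * d comes from integrating the bound of \<open>step\<close> over s in
    [0, d]; 2 * d * c is the lower bound for the integrated factors.\<close>
  define K where "K = 4 * C * d / (2 * d * c)"
  have K: "K > 0" using C c d by (simp add: K_def)
  have rest: "(\<Sum>l\<in>F - {m}. (cmod (a l))\<^sup>2) \<le> K * integral {0..T} (\<lambda>t. (cmod (expsum F a t))\<^sup>2)"
    if F: "finite F" "F \<subseteq> insert m S" for F a
  proof -
    define I where "I = integral {0..T} (\<lambda>t. (cmod (expsum F a t))\<^sup>2)"
    define G where "G = F - {m}"
    have G: "finite G" "G \<subseteq> S" using F by (auto simp: G_def)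
    \<comment> \<open>The window [0, T - d] and its translate by s both lie in [0, T], and each
      contributes 2 * C * I.\<close>
    have step: "(\<Sum>l\<in>G. (cmod (a l))\<^sup>2 * (cmod (cis ((l - m) * s) - 1))\<^sup>2) \<le> 4 * C * I"
      if s: "s \<in> {0..d}" for s
    proof -
      define b where "b l = a l * (cis ((l - m) * s) - 1)" for l
      have bm: "b m = 0" by (simp add: b_def)
      have eq: "expsum G b t = cis (- (m * s)) * expsum F a (t + s) - expsum F a t" for t
      proof -
        have "expsum G b t = expsum F b t"
          unfolding expsum_def G_def using F bm by (intro sum.mono_neutral_left) auto
        also have "\<dots> = cis (- (m * s)) * expsum F a (t + s) - expsum F a t"
          unfolding expsum_def sum_distrib_left sum_subtractf[symmetric]
        proof (intro sum.cong refl)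
          fix l
          have "cis ((l - m) * s) * cis (l * t) = cis (- (m * s)) * cis (l * (t + s))"
            by (simp add: cis_mult algebra_simps)
          then show "b l * cis (l * t) = cis (- (m * s)) * (a l * cis (l * (t + s))) - a l * cis (l * t)"
            unfolding b_def by (simp add: algebra_simps)
        qed
        finally show ?thesis .
      qed
      have cF: "continuous_on UNIV (\<lambda>t. (cmod (expsum F a t))\<^sup>2)"
        "continuous_on UNIV (\<lambda>t. (cmod (expsum F a (t + s)))\<^sup>2)"
        by (intro continuous_intros)+
      have "(\<Sum>l\<in>G. (cmod (a l))\<^sup>2 * (cmod (cis ((l - m) * s) - 1))\<^sup>2) = (\<Sum>l\<in>G. (cmod (b l))\<^sup>2)"
        by (simp add: b_def norm_mult power_mult_distrib)
      also have "\<dots> \<le> C * integral {0..T - d} (\<lambda>t. (cmod (expsum G b t))\<^sup>2)"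
        by (rule C(2)[OF G])
      also have "\<dots> \<le> C * integral {0..T - d} (\<lambda>t. 2 * (cmod (expsum F a (t + s)))\<^sup>2 + 2 * (cmod (expsum F a t))\<^sup>2)"
      proof (intro mult_left_mono integral_le integrable_on_continuous_UNIV continuous_intros)
        fix t
        show "(cmod (expsum G b t))\<^sup>2 \<le> 2 * (cmod (expsum F a (t + s)))\<^sup>2 + 2 * (cmod (expsum F a t))\<^sup>2"
          unfolding eq using norm_sq_diff_le[of "cis (- (m * s)) * expsum F a (t + s)" "expsum F a t"]
          by (simp add: norm_mult)
      qed (use C in auto)
      also have "integral {0..T - d} (\<lambda>t. 2 * (cmod (expsum F a (t + s)))\<^sup>2 + 2 * (cmod (expsum F a t))\<^sup>2)
         = 2 * integral {0..T - d} (\<lambda>t. (cmod (expsum F a (t + s)))\<^sup>2) + 2 * integral {0..T - d} (\<lambda>t. (cmod (expsum F a t))\<^sup>2)"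
        by (subst integral_add) (auto intro!: integrable_on_continuous_UNIV continuous_intros)
      also have "integral {0..T - d} (\<lambda>t. (cmod (expsum F a (t + s)))\<^sup>2) = integral {0 + s..T - d + s} (\<lambda>t. (cmod (expsum F a t))\<^sup>2)"
        by (rule integral_shift) (rule cF)
      also have "C * (2 * \<dots> + 2 * integral {0..T - d} (\<lambda>t. (cmod (expsum F a t))\<^sup>2)) \<le> C * (2 * I + 2 * I)"
        unfolding I_def using s d C
        by (intro mult_left_mono add_mono integral_subset_le integrable_on_continuous_UNIV cF) auto
      finally show ?thesis by (simp add: algebra_simps)
    qed
    have hi: "((\<lambda>s. \<Sum>l\<in>G. (cmod (a l))\<^sup>2 * (cmod (cis ((l - m) * s) - 1))\<^sup>2) has_integral
        (\<Sum>l\<in>G. (cmod (a l))\<^sup>2 * (2 * d * (1 - sin ((l - m) * d) / ((l - m) * d))))) {0..d}"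
    proof (intro has_integral_sum G has_integral_mult_right integral_norm_cis_minus_1_sq d)
      fix l assume "l \<in> G" then show "l - m \<noteq> 0" by (auto simp: G_def)
    qed
    have "(2 * d * c) * (\<Sum>l\<in>G. (cmod (a l))\<^sup>2) = (\<Sum>l\<in>G. (cmod (a l))\<^sup>2 * (2 * d * c))"
      by (simp add: sum_distrib_left mult_ac)
    also have "\<dots> \<le> (\<Sum>l\<in>G. (cmod (a l))\<^sup>2 * (2 * d * (1 - sin ((l - m) * d) / ((l - m) * d))))"
    proof (intro sum_mono mult_left_mono c)
      fix l assume "l \<in> G"
      then have "e \<le> \<bar>l - m\<bar>" using far G by auto
      then show "e * d \<le> \<bar>(l - m) * d\<bar>" using d by (simp add: abs_mult)
    qed (use d in auto)
    also have "\<dots> \<le> (d - 0) * (4 * C * I)"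
      using has_integral_le[OF hi _ step, of "(d - 0) * (4 * C * I)"] has_integral_const_real[of "4 * C * I" 0 d] d by simp
    finally have "(2 * d * c) * (\<Sum>l\<in>G. (cmod (a l))\<^sup>2) \<le> 4 * C * d * I" by (simp add: mult_ac)
    then show ?thesis using c d unfolding K_def G_def[symmetric] I_def[symmetric] by (simp add: field_simps)
  qed
  \<comment> \<open>The summand K pays for the frequencies other than m. For m itself, T |a m|^2 is
    at most 2 * I plus twice the integral of the remaining sum, which is bounded by D * K *
    I.\<close>
  define B where "B = K + (2 + 2 * D * K) / T"
  show ?thesis unfolding riesz_lower_def
  proof (intro exI[of _ B] conjI allI impI)
    have pos: "0 < (2 + 2 * D * K) / T" using T D K by (intro divide_pos_pos add_pos_pos mult_pos_pos) auto
    then show "B > 0" using K by (simp add: B_def)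
    fix F :: "real set" and a :: "real \<Rightarrow> complex"
    assume F: "finite F" "F \<subseteq> insert m S"
    define I where "I = integral {0..T} (\<lambda>t. (cmod (expsum F a t))\<^sup>2)"
    have I0: "0 \<le> I" unfolding I_def by (intro integral_nonneg integrable_on_continuous_UNIV continuous_intros) auto
    note r = rest[OF F, of a, folded I_def]
    show "(\<Sum>l\<in>F. (cmod (a l))\<^sup>2) \<le> B * I"
    proof (cases "m \<in> F")
      case True
      have "T * (cmod (a m))\<^sup>2 \<le> 2 * I + 2 * integral {0..T} (\<lambda>t. (cmod (expsum (F - {m}) a t))\<^sup>2)"
        using integral_expsum_split(2)[OF F(1) True, of T a] T by (simp add: I_def)
      also have "\<dots> \<le> 2 * I + 2 * (D * (K * I))"
        using F D(1) by (intro add_mono mult_left_mono order_trans[OF D(2)] r) auto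
      finally have "(cmod (a m))\<^sup>2 \<le> (2 + 2 * D * K) / T * I"
        using T by (simp add: field_simps)
      then show ?thesis using r True F(1) by (simp add: sum.remove B_def algebra_simps)
    next
      case False
      then have "(\<Sum>l\<in>F. (cmod (a l))\<^sup>2) \<le> K * I" using r by simp
      also have "\<dots> \<le> B * I" using pos I0 by (intro mult_right_mono) (auto simp: B_def)
      finally show ?thesis .
    qed
  qed
qed

text \<open>At most one point of S lies within g / 2 of m, so a minimum over finitely many distances
  suffices.\<close>

lemma separated_away:
  assumes "separated g S" "g > 0" "finite W"
  shows "\<exists>e>0. \<forall>l\<in>S \<union> W. l \<noteq> m \<longrightarrow> e \<le> \<bar>l - m\<bar>"
proof -
  define N where "N = ({l \<in> S. \<bar>l - m\<bar> < g / 2} \<union> W) - {m}"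
  have "finite {l \<in> S. \<bar>l - m\<bar> < g / 2}"
  proof (cases "{l \<in> S. \<bar>l - m\<bar> < g / 2} = {}")
    case False
    then obtain x where x: "x \<in> S" "\<bar>x - m\<bar> < g / 2" by auto
    have "{l \<in> S. \<bar>l - m\<bar> < g / 2} \<subseteq> {x}"
    proof
      fix y assume "y \<in> {l \<in> S. \<bar>l - m\<bar> < g / 2}"
      then have "y \<in> S" "\<bar>y - m\<bar> < g / 2" by auto
      then have "\<bar>y - x\<bar> < g" using x by arith
      with \<open>y \<in> S\<close> show "y \<in> {x}" using assms(1) x(1) unfolding separated_def by (smt (verit) singleton_iff)
    qed
    then show ?thesis using finite_subset by blast
  next
    case True
    then show ?thesis by (simp only: finite.emptyI)
  qed
  then have fin: "finite N" using assms by (simp add: N_def)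
  define e where "e = Min (insert (g / 2) ((\<lambda>l. \<bar>l - m\<bar>) ` N))"
  have "e > 0" unfolding e_def using fin assms by (subst Min_gr_iff) (auto simp: N_def)
  moreover have "e \<le> \<bar>l - m\<bar>" if "l \<in> S \<union> W" "l \<noteq> m" for l
  proof (cases "l \<in> N")
    case True
    then show ?thesis unfolding e_def using fin by (intro Min_le) auto
  next
    case False
    then have "g / 2 \<le> \<bar>l - m\<bar>" using that by (auto simp: N_def)
    moreover have "e \<le> g / 2" unfolding e_def using fin by (intro Min_le) auto
    ultimately show ?thesis by simp
  qed
  ultimately show ?thesis by blast
qed

text \<open>Haraux's argument. Each inserted frequency shortens the time available to the others by
  d; taking for d half of the slack T - 2 pi / g keeps the shortened time above the threshold. Hence
  T is generalized in the induction while g stays fixed.\<close>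

lemma riesz_lower_ess_separated:
  assumes sep: "separated g S" and W: "finite W" and T: "T > 0" and g: "g > 2 * pi / T"
  shows "riesz_lower T (S \<union> W)"
proof -
  have "0 < 2 * pi / T" using T by simp
  then have gpos: "g > 0" using g by linarith
  have up: "riesz_upper T (S \<union> W)" if T: "T > 0" and W: "finite W" for T W
    using W
  proof induction
    case empty
    show ?case using riesz_upper_separated[OF T sep gpos] by simp
  next
    case (insert m W)
    then show ?case using riesz_upper_insert[OF T, of "S \<union> W" m] by simp
  qed
  show ?thesis using W T g
  proof (induction W arbitrary: T rule: finite_induct)
    case empty
    show ?case using riesz_lower_separated[OF empty(1) sep empty(2)] by simp
  next
    case (insert m W)
    show ?case
    proof (cases "m \<in> S")
      case True
      then have "S \<union> insert m W = S \<union> W" by auto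
      then show ?thesis using insert.IH[OF insert.prems] by simp
    next
      case False
      define d where "d = (T - 2 * pi / g) / 2"
      have "2 * pi / g < T" using insert.prems gpos by (simp add: divide_less_eq mult.commute)
      moreover have "0 < 2 * pi / g" using gpos by simp
      moreover have "2 * d = T - 2 * pi / g" by (simp add: d_def)
      ultimately have d: "0 < d" "d < T" "T - d > 0" "2 * pi / g < T - d" by linarith+
      have g': "2 * pi / (T - d) < g" using d gpos by (simp add: divide_less_eq mult.commute)
      have m: "m \<notin> S \<union> W" using False insert.hyps by auto
      obtain e where e: "e > 0" "\<And>l. l \<in> S \<union> W \<Longrightarrow> e \<le> \<bar>l - m\<bar>"
        using separated_away[OF sep gpos insert.hyps(1), of m] m by metis
      have "riesz_lower T (insert m (S \<union> W))"
        using riesz_lower_insert[OF d(1,2) e(1) insert.IH[OF d(3) g'] up[OF insert.prems(1) insert.hyps(1)] e(2)] .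
      then show ?thesis by simp
    qed
  qed
qed

section \<open>Alternating walks in the graph\<close>

text \<open>Subtracting the equations leaves (k - m) (v1 - v2) = 0. Hence no edge has both
  colors.\<close>

lemma lam_eq_both:
  assumes "v1 \<noteq> v2" "lam p v1 k = lam p v1 m" "lam p v2 k = lam p v2 m"
  shows "k = m"
proof -
  have "(of_int k - of_int m) * (v1 - v2) = 0"
    using assms(2,3) by (simp add: lam_def algebra_simps)
  then show ?thesis using assms(1) by simp
qed

lemma red_edgesI: "k \<noteq> m \<Longrightarrow> lam p v1 k = lam p v1 m \<Longrightarrow> (k, m) \<in> red_edges p v1 v2"
  unfolding red_edges_def G_verts_def Pi_set_def by (auto intro: exI[of _ k] exI[of _ m])

lemma blue_edgesI: "k \<noteq> m \<Longrightarrow> lam p v2 k = lam p v2 m \<Longrightarrow> (k, m) \<in> blue_edges p v1 v2"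
  unfolding blue_edges_def G_verts_def Pi_set_def by (auto intro: exI[of _ k] exI[of _ m])

text \<open>Parity fixes the color, so an alternating walk starts with a red edge; walks starting
  with a blue edge are obtained by exchanging v1 and v2.\<close>

definition speed :: "real \<Rightarrow> real \<Rightarrow> nat \<Rightarrow> real" where
  "speed v1 v2 j = (if even j then v1 else v2)"

definition alternating_walk :: "(int \<Rightarrow> real) \<Rightarrow> real \<Rightarrow> real \<Rightarrow> nat \<Rightarrow> (nat \<Rightarrow> int) \<Rightarrow> bool" where
  "alternating_walk p v1 v2 n w \<longleftrightarrow> (\<forall>j<n. w j \<noteq> w (Suc j) \<and>
     lam p (speed v1 v2 j) (w j) = lam p (speed v1 v2 j) (w (Suc j)))"

lemma alternating_walk_edge:
  assumes "alternating_walk p v1 v2 n w" "j < n"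
  shows "even j \<Longrightarrow> (w j, w (Suc j)) \<in> red_edges p v1 v2"
    and "odd j \<Longrightarrow> (w j, w (Suc j)) \<in> blue_edges p v1 v2"
    and "(w j, w (Suc j)) \<in> G_edges p v1 v2"
proof -
  have *: "w j \<noteq> w (Suc j)" "lam p (speed v1 v2 j) (w j) = lam p (speed v1 v2 j) (w (Suc j))"
    using assms by (auto simp: alternating_walk_def)
  show red: "(w j, w (Suc j)) \<in> red_edges p v1 v2" if "even j"
    using * that by (intro red_edgesI) (auto simp: speed_def)
  show blue: "(w j, w (Suc j)) \<in> blue_edges p v1 v2" if "odd j"
    using * that by (intro blue_edgesI) (auto simp: speed_def)
  show "(w j, w (Suc j)) \<in> G_edges p v1 v2"
    using red blue by (auto simp: G_edges_def)
qed

text \<open>A shortest closed subwalk of an alternating walk would be a two-colored cycle.\<close>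

lemma alternating_walk_inj:
  assumes v: "v1 \<noteq> v2" and nc: "\<not> has_two_colored_cycle p v1 v2" and w: "alternating_walk p v1 v2 n w"
  shows "inj_on w {..n}"
proof (rule ccontr)
  define P where "P d \<longleftrightarrow> (\<exists>i. d > 0 \<and> i + d \<le> n \<and> w i = w (i + d))" for d
  assume "\<not> inj_on w {..n}"
  then obtain i j where "i < j" "j \<le> n" "w i = w j"
    unfolding inj_on_def by (metis atMost_iff linorder_neqE_nat)
  then have "P (j - i)" by (auto simp: P_def intro!: exI[of _ i])
  define d where "d = (LEAST d. P d)"
  have "P d" unfolding d_def by (rule LeastI) fact
  then obtain i where i: "d > 0" "i + d \<le> n" "w i = w (i + d)" by (auto simp: P_def)
  have least: "\<not> P d'" if "d' < d" for d' using that not_less_Least unfolding d_def by blast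
  have d1: "d \<noteq> 1" using w i by (auto simp: alternating_walk_def)
  \<comment> \<open>Returning after two steps would join the same two vertices by a red and a blue
    edge.\<close>
  have d2: "d \<noteq> 2"
  proof
    assume "d = 2"
    then have "i < n" "Suc i < n" "w i = w (Suc (Suc i))" using i by (auto simp: numeral_2_eq_2)
    then have "lam p v1 (w i) = lam p v1 (w (Suc i))" "lam p v2 (w i) = lam p v2 (w (Suc i))"
      using w unfolding alternating_walk_def speed_def by (metis even_Suc)+
    then have "w i = w (Suc i)" using lam_eq_both[OF v] by blast
    then show False using w \<open>i < n\<close> by (auto simp: alternating_walk_def)
  qed
  have d3: "3 \<le> d" using i d1 d2 by linarith
  define ks where "ks = map (\<lambda>j. w (i + j)) [0..<d]"
  have len: "length ks = d" by (simp add: ks_def)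
  have nth: "ks ! j = w (i + j)" if "j < d" for j using that by (simp add: ks_def)
  \<comment> \<open>At the last index the cyclic successor is \<open>ks ! 0\<close>, and
    \<open>w i = w (i + d)\<close> makes the closing edge a step of the walk.\<close>
  have nth_Suc: "ks ! (Suc j mod d) = w (Suc (i + j))" if "j < d" for j
    using that i nth[of 0] nth[of "Suc j"] by (cases "Suc j = d") auto
  have edges: "cycle_edges ks = {(w (i + j), w (Suc (i + j))) |j. j < d}"
    unfolding cycle_edges_def len using nth nth_Suc by force
  have "inj_on (\<lambda>j. w (i + j)) {0..<d}"
  proof (rule inj_onI, rule ccontr)
    fix a b assume ab: "a \<in> {0..<d}" "b \<in> {0..<d}" "w (i + a) = w (i + b)" "a \<noteq> b"
    have "P (max a b - min a b)"
      unfolding P_def using ab i by (intro exI[of _ "i + min a b"]) (auto simp: max_def min_def)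
    moreover have "max a b - min a b < d" using ab by auto
    ultimately show False using least by blast
  qed
  then have "distinct ks" by (simp add: ks_def distinct_map)
  have edge: "(w (i + j), w (Suc (i + j))) \<in> G_edges p v1 v2" if "j < d" for j
    using alternating_walk_edge(3)[OF w, of "i + j"] that i by auto
  have "set ks \<subseteq> G_verts p v1 v2"
  proof
    fix k assume "k \<in> set ks"
    then obtain j where "j < d" "k = w (i + j)" by (auto simp: ks_def)
    then show "k \<in> G_verts p v1 v2" using edge[of j] by (auto simp: G_edges_def red_edges_def blue_edges_def)
  qed
  with \<open>distinct ks\<close> d3 have "is_cycle p v1 v2 ks"
    unfolding is_cycle_def len edges using edge by auto
  \<comment> \<open>Two consecutive steps already show both colors; this covers odd d, where the two
    edges at the closing vertex have the same color.\<close>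
  moreover obtain a b where ab: "a < d" "even (i + a)" "b < d" "odd (i + b)"
  proof (cases "even i")
    case True
    then show ?thesis using d3 that[of 0 1] by simp
  next
    case False
    then show ?thesis using d3 that[of 1 0] by simp
  qed
  then have "(w (i + a), w (Suc (i + a))) \<in> red_edges p v1 v2" "(w (i + b), w (Suc (i + b))) \<in> blue_edges p v1 v2"
    using alternating_walk_edge(1,2)[OF w] i by auto
  then have "cycle_edges ks \<inter> red_edges p v1 v2 \<noteq> {}" "cycle_edges ks \<inter> blue_edges p v1 v2 \<noteq> {}"
    unfolding edges using ab by blast+
  ultimately show False using nc unfolding has_two_colored_cycle_def by blast
qed

section \<open>Linear relations from two-colored cycles\<close>

lemma sum_cyclic_shift:
  fixes f :: "nat \<Rightarrow> 'a::comm_monoid_add"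
  shows "(\<Sum>i<n. f (Suc i mod n)) = (\<Sum>i<n. f i)"
proof (cases n)
  case (Suc m)
  have "(\<Sum>i<Suc m. f (Suc i mod Suc m)) = (\<Sum>i<m. f (Suc i)) + f 0"
    by (simp add: sum.lessThan_Suc)
  then show ?thesis unfolding Suc by (simp add: sum.lessThan_Suc_shift add.commute del: sum.lessThan_Suc)
qed simp

text \<open>Relations among class sums are stated dually, by pairing with such functions; the
  exponentials \<open>cis (lam p v k * t)\<close>, as functions of k, are the ones to which they are
  applied.\<close>

definition class_function :: "(int \<Rightarrow> real) \<Rightarrow> real \<Rightarrow> (int \<Rightarrow> complex) \<Rightarrow> bool" where
  "class_function p v \<phi> \<longleftrightarrow> (\<forall>k m. lam p v k = lam p v m \<longrightarrow> \<phi> k = \<phi> m)"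

lemma class_functionD: "class_function p v \<phi> \<Longrightarrow> lam p v k = lam p v m \<Longrightarrow> \<phi> k = \<phi> m"
  unfolding class_function_def by blast

text \<open>The function \<open>e\<close> is the boundary of the formal sum of the red edges of the cycle. The boundary
  of a red edge pairs to zero with functions that are constant on red classes, and \<open>- e\<close> is the
  boundary of the sum of the blue edges.\<close>

lemma two_colored_cycle_relation:
  assumes v: "v1 \<noteq> v2" and cyc: "has_two_colored_cycle p v1 v2"
  obtains S and e :: "int \<Rightarrow> complex" and k where "finite S" "k \<in> S" "e k \<noteq> 0"
    "\<And>\<phi> v. v \<in> {v1, v2} \<Longrightarrow> class_function p v \<phi> \<Longrightarrow> (\<Sum>k\<in>S. e k * \<phi> k) = 0"
proof -
  obtain ks where ks: "is_cycle p v1 v2 ks" "cycle_edges ks \<inter> red_edges p v1 v2 \<noteq> {}"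
    "cycle_edges ks \<inter> blue_edges p v1 v2 \<noteq> {}"
    using cyc unfolding has_two_colored_cycle_def by auto
  define n where "n = length ks"
  have n: "3 \<le> n" and dist: "distinct ks" and edges: "cycle_edges ks \<subseteq> G_edges p v1 v2"
    using ks by (auto simp: is_cycle_def n_def)
  define a where "a i = ks ! i" for i
  define s where "s i = Suc i mod n" for i
  have s_lt: "s i < n" for i using n by (simp add: s_def)
  have s_inj: "s i = s j \<longleftrightarrow> i = j" if "i < n" "j < n" for i j
    using that by (auto simp: s_def mod_Suc split: if_splits)
  have a_inj: "a i = a j \<longleftrightarrow> i = j" if "i < n" "j < n" for i j
    using that dist by (simp add: a_def n_def nth_eq_iff_index_eq)
  define r :: "nat \<Rightarrow> complex" where "r i = (if (a i, a (s i)) \<in> red_edges p v1 v2 then 1 else 0)" for i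
  have red: "lam p v1 (a i) = lam p v1 (a (s i))" if "r i \<noteq> 0" for i
    using that by (auto simp: r_def red_edges_def split: if_splits)
  have blue: "lam p v2 (a i) = lam p v2 (a (s i))" if "i < n" "r i \<noteq> 1" for i
  proof -
    have "(a i, a (s i)) \<in> cycle_edges ks" using that by (auto simp: cycle_edges_def a_def s_def n_def)
    then show ?thesis using that edges by (auto simp: r_def G_edges_def blue_edges_def split: if_splits)
  qed
  define e where "e k = (\<Sum>i<n. r i * ((if a (s i) = k then 1 else 0) - (if a i = k then 1 else 0)))" for k
  have pairing: "(\<Sum>k\<in>set ks. e k * \<phi> k) = (\<Sum>i<n. r i * (\<phi> (a (s i)) - \<phi> (a i)))" for \<phi>
  proof -
    have m: "a i \<in> set ks" if "i < n" for i using that by (simp add: a_def n_def)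
    have "(\<Sum>k\<in>set ks. e k * \<phi> k) = (\<Sum>i<n. \<Sum>k\<in>set ks. r i * ((if a (s i) = k then \<phi> k else 0) - (if a i = k then \<phi> k else 0)))"
      unfolding e_def sum_distrib_right by (subst sum.swap) (auto intro!: sum.cong)
    also have "\<dots> = (\<Sum>i<n. r i * (\<phi> (a (s i)) - \<phi> (a i)))"
      using m s_lt by (intro sum.cong refl) (simp add: sum_subtractf flip: sum_distrib_left)
    finally show ?thesis .
  qed
  have zero: "(\<Sum>k\<in>set ks. e k * \<phi> k) = 0"
    if "v \<in> {v1, v2}" and cf: "class_function p v \<phi>" for \<phi> v
  proof (cases "v = v1")
    case True
    then have "r i * (\<phi> (a (s i)) - \<phi> (a i)) = 0" for i
      using red[of i] class_functionD[OF cf, of "a i" "a (s i)"] by (cases "r i = 0") auto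
    then show ?thesis unfolding pairing by (intro sum.neutral) blast
  next
    case False
    then have v: "v = v2" using that by simp
    \<comment> \<open>Around the whole cycle the differences cancel. Blue edges contribute nothing
      when the function is constant on blue classes, so the sum over the red edges alone vanishes as
      well.\<close>
    have "(\<Sum>i<n. \<phi> (a (s i)) - \<phi> (a i)) = 0"
      unfolding s_def sum_subtractf sum_cyclic_shift[of "\<lambda>i. \<phi> (a i)" n] by simp
    moreover have "r i * (\<phi> (a (s i)) - \<phi> (a i)) = \<phi> (a (s i)) - \<phi> (a i)" if "i < n" for i
      using blue[OF that] class_functionD[OF cf, of "a i" "a (s i)"] v by (cases "r i = 1") auto
    then have "(\<Sum>i<n. r i * (\<phi> (a (s i)) - \<phi> (a i))) = (\<Sum>i<n. \<phi> (a (s i)) - \<phi> (a i))"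
      by (intro sum.cong) auto
    ultimately show ?thesis unfolding pairing by simp
  qed
  \<comment> \<open>The color changes somewhere on the cycle; at that vertex exactly one of the two
    cycle edges is red, so the boundary does not cancel.\<close>
  have "\<exists>i<n. r i \<noteq> r (s i)"
  proof (rule ccontr)
    assume "\<not> ?thesis"
    then have eq: "r i = r (s i)" if "i < n" for i using that by blast
    have const: "r i = r 0" if "i < n" for i
      using that
    proof (induction i)
      case (Suc i)
      then show ?case using eq[of i] by (simp add: s_def)
    qed simp
    obtain i where i: "i < n" "(a i, a (s i)) \<in> red_edges p v1 v2"
      using ks(2) by (auto simp: cycle_edges_def n_def a_def s_def)
    obtain j where j: "j < n" "(a j, a (s j)) \<in> blue_edges p v1 v2"
      using ks(3) by (auto simp: cycle_edges_def n_def a_def s_def)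
    have "r i = 1" using i by (simp add: r_def)
    then have "r j \<noteq> 0" using const[OF i(1)] const[OF j(1)] by simp
    from red[OF this] j(2) show False
      using lam_eq_both[OF v, of p "a j" "a (s j)"] by (auto simp: blue_edges_def)
  qed
  then obtain i where i: "i < n" "r i \<noteq> r (s i)" by blast
  have "e (a (s i)) = (\<Sum>j<n. r j * (if j = i then 1 else 0)) - (\<Sum>j<n. r j * (if j = s i then 1 else 0))"
    unfolding e_def right_diff_distrib sum_subtractf using i s_lt a_inj s_inj
    by (intro arg_cong2[of _ _ _ _ "(-)"] sum.cong refl) auto
  also have "\<dots> = r i - r (s i)"
    using i s_lt by (simp add: if_distrib[of "\<lambda>x. r _ * x"] cong: if_cong)
  finally have "e (a (s i)) \<noteq> 0" using i by simp
  moreover have "a (s i) \<in> set ks" using s_lt by (simp add: a_def n_def)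
  ultimately show thesis using that[of "set ks" "a (s i)" e] zero by blast
qed

section \<open>Determining coefficients from their class sums\<close>

text \<open>A vanishing class sum never has exactly one nonzero term, so the walk can be continued
  forever. Being injective, it leaves [-N, N] for good, and from then on each class it uses is a
  pair with opposite coefficients.\<close>

lemma vanishing_class_sums_imp_zero:
  fixes e :: "int \<Rightarrow> complex"
  assumes v: "v1 \<noteq> v2" and nc: "\<not> has_two_colored_cycle p v1 v2"
    and fin: "\<And>v k. v \<in> {v1, v2} \<Longrightarrow> finite (Xi p v k)"
    and small: "\<And>v k. v \<in> {v1, v2} \<Longrightarrow> \<bar>k\<bar> \<ge> N \<Longrightarrow> card (Xi p v k) \<le> 2"
    and zero: "\<And>v k. v \<in> {v1, v2} \<Longrightarrow> (\<Sum>m\<in>Xi p v k. e m) = 0"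
    and decay: "\<And>\<epsilon>. \<epsilon> > 0 \<Longrightarrow> finite {k. \<epsilon> \<le> cmod (e k)}"
  shows "e k = 0"
proof (rule ccontr)
  assume k: "e k \<noteq> 0"
  have "\<exists>m. m \<noteq> k \<and> lam p v k = lam p v m \<and> e m \<noteq> 0" if "v \<in> {v1, v2}" "e k \<noteq> 0" for v k
  proof (rule ccontr)
    assume "\<not> ?thesis"
    then have "\<forall>m\<in>Xi p v k - {k}. e m = 0" unfolding Xi_def by (metis DiffE mem_Collect_eq singletonI)
    then have "(\<Sum>m\<in>Xi p v k - {k}. e m) = 0" by (rule sum.neutral)
    moreover have "k \<in> Xi p v k" by (simp add: Xi_def)
    ultimately show False using zero[OF that(1), of k] fin[OF that(1), of k] that(2) by (simp add: sum.remove)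
  qed
  then obtain nx where nx: "\<And>v k. v \<in> {v1, v2} \<Longrightarrow> e k \<noteq> 0 \<Longrightarrow>
      nx v k \<noteq> k \<and> lam p v k = lam p v (nx v k) \<and> e (nx v k) \<noteq> 0" by metis
  define w where "w = rec_nat k (\<lambda>j x. nx (speed v1 v2 j) x)"
  have w_simps: "w 0 = k" "w (Suc j) = nx (speed v1 v2 j) (w j)" for j by (simp_all add: w_def)
  have sp: "speed v1 v2 j \<in> {v1, v2}" for j by (simp add: speed_def)
  have nz: "e (w j) \<noteq> 0" for j
    by (induction j) (use k nx[OF sp] w_simps in auto)
  have walk: "w j \<noteq> w (Suc j)" "lam p (speed v1 v2 j) (w j) = lam p (speed v1 v2 j) (w (Suc j))" for j
    using nx[OF sp nz, of j j] by (auto simp: w_simps)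
  have "inj_on w {..n}" for n
    using walk by (intro alternating_walk_inj[OF v nc]) (auto simp: alternating_walk_def)
  then have inj: "inj w" unfolding inj_on_def by (metis UNIV_I atMost_iff nat_le_linear)
  have "finite (w -` {-N..N})" using inj by (intro finite_vimageI) auto
  then obtain J where J: "\<And>j. j \<ge> J \<Longrightarrow> w j \<notin> {-N..N}"
    by (metis (no_types, lifting) finite_nat_set_iff_bounded not_le vimageI)
  have step: "cmod (e (w (Suc j))) = cmod (e (w j))" if "j \<ge> J" for j
  proof -
    let ?X = "Xi p (speed v1 v2 j) (w j)"
    have "\<bar>w j\<bar> \<ge> N" using J[OF that] by auto
    then have "card ?X \<le> 2" "finite ?X" using small[OF sp] fin[OF sp] by auto
    moreover have "{w j, w (Suc j)} \<subseteq> ?X" using walk(2)[of j] by (auto simp: Xi_def)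
    ultimately have "?X = {w j, w (Suc j)}"
      using walk(1)[of j] card_seteq[of ?X "{w j, w (Suc j)}"] by auto
    then have "e (w j) + e (w (Suc j)) = 0" using zero[OF sp, of j "w j"] walk(1)[of j] by simp
    then have "e (w (Suc j)) = - e (w j)" by (simp add: add_eq_0_iff)
    then show ?thesis by simp
  qed
  have const: "cmod (e (w (J + j))) = cmod (e (w J))" for j
    by (induction j) (use step in auto)
  \<comment> \<open>Infinitely many vertices carry the same positive modulus, against
    \<open>decay\<close>.\<close>
  have "range (\<lambda>j. w (J + j)) \<subseteq> {k. cmod (e (w J)) \<le> cmod (e k)}" using const by auto
  then have "finite (range (\<lambda>j. w (J + j)))"
    using decay[of "cmod (e (w J))"] nz[of J] finite_subset by auto
  moreover have "inj (\<lambda>j. w (J + j))" using inj by (intro injI) (auto dest: injD)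
  ultimately show False using finite_imageD infinite_UNIV_nat by blast
qed

text \<open>If |e x| > 2 d, the other members of the class of x, at most g in number, together carry
  at least |e x| / 2, so one of them has modulus at least |e x| / (2 g). Each step of the walk thus
  loses a factor 2 g.\<close>

lemma component_coefficient_bound:
  fixes e :: "int \<Rightarrow> complex"
  assumes v: "v1 \<noteq> v2" and nc: "\<not> has_two_colored_cycle p v1 v2"
    and H: "finite H" "card H \<le> g" "g \<ge> 1"
    and closed: "\<And>v k. v \<in> {v1, v2} \<Longrightarrow> k \<in> H \<Longrightarrow> Xi p v k \<subseteq> H"
    and d: "\<And>v k. v \<in> {v1, v2} \<Longrightarrow> k \<in> H \<Longrightarrow> cmod (\<Sum>m\<in>Xi p v k. e m) \<le> d"
    and k: "k \<in> H"
  shows "cmod (e k) \<le> 2 * (2 * real g) ^ g * d"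
proof (rule ccontr)
  assume "\<not> ?thesis"
  then have big: "2 * (2 * real g) ^ g * d < cmod (e k)" by simp
  have d0: "0 \<le> d" using d[of v1 k] k norm_ge_zero order_trans by blast
  have g2: "1 \<le> 2 * real g" using H by simp
  have nbr: "\<exists>m\<in>H. m \<noteq> x \<and> lam p v x = lam p v m \<and> cmod (e x) / (2 * real g) \<le> cmod (e m)"
    if vx: "v \<in> {v1, v2}" "x \<in> H" and x: "2 * d < cmod (e x)" for v x
  proof (rule ccontr)
    assume no: "\<not> ?thesis"
    let ?X = "Xi p v x"
    have X: "finite ?X" "x \<in> ?X" "?X \<subseteq> H" using closed[OF vx] H finite_subset by (auto simp: Xi_def)
    have "card (?X - {x}) \<le> g" using X H card_mono[of H "?X - {x}"] by (meson Diff_subset order_trans)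
    have "(\<Sum>m\<in>?X. e m) = e x + (\<Sum>m\<in>?X - {x}. e m)" using X by (simp add: sum.remove)
    then have "cmod (e x) \<le> d + cmod (\<Sum>m\<in>?X - {x}. e m)"
      using d[OF vx] norm_triangle_ineq4[of "\<Sum>m\<in>?X. e m" "\<Sum>m\<in>?X - {x}. e m"] by simp
    also have "cmod (\<Sum>m\<in>?X - {x}. e m) \<le> (\<Sum>m\<in>?X - {x}. cmod (e x) / (2 * real g))"
    proof (intro order_trans[OF norm_sum] sum_mono)
      fix m assume "m \<in> ?X - {x}"
      then have "m \<in> H" "m \<noteq> x" "lam p v x = lam p v m" using X by (auto simp: Xi_def)
      then show "cmod (e m) \<le> cmod (e x) / (2 * real g)" using no by fastforce
    qed
    also have "\<dots> = real (card (?X - {x})) * (cmod (e x) / (2 * real g))" by simp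
    also have "\<dots> \<le> real g * (cmod (e x) / (2 * real g))"
      using \<open>card (?X - {x}) \<le> g\<close> by (intro mult_right_mono) auto
    also have "\<dots> = cmod (e x) / 2" using H by simp
    finally show False using x by simp
  qed
  then obtain nx where nx: "\<And>v x. v \<in> {v1, v2} \<Longrightarrow> x \<in> H \<Longrightarrow> 2 * d < cmod (e x) \<Longrightarrow>
    nx v x \<in> H \<and> nx v x \<noteq> x \<and> lam p v x = lam p v (nx v x) \<and> cmod (e x) / (2 * real g) \<le> cmod (e (nx v x))"
    by metis
  define w where "w = rec_nat k (\<lambda>j x. nx (speed v1 v2 j) x)"
  have w_simps: "w 0 = k" "w (Suc j) = nx (speed v1 v2 j) (w j)" for j by (simp_all add: w_def)
  have sp: "speed v1 v2 j \<in> {v1, v2}" for j by (simp add: speed_def)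
  \<comment> \<open>The exponent g in the constant keeps the guaranteed modulus above 2 * d for g
    steps, so the walk meets g + 1 distinct vertices of H, one more than its size permits.\<close>
  have large: "2 * d < cmod (e k) / (2 * real g) ^ j" if "j \<le> g" for j
  proof -
    have "2 * d * (2 * real g) ^ j \<le> 2 * d * (2 * real g) ^ g"
      using d0 g2 that by (intro mult_left_mono power_increasing) auto
    then have "2 * d * (2 * real g) ^ j < cmod (e k)" using big by (simp add: mult_ac)
    moreover have "0 < (2 * real g) ^ j" using g2 by (intro zero_less_power) linarith
    ultimately show ?thesis by (simp add: pos_less_divide_eq)
  qed
  have inv: "w j \<in> H \<and> cmod (e k) / (2 * real g) ^ j \<le> cmod (e (w j))" if "j \<le> g" for j
    using that
  proof (induction j)
    case 0
    then show ?case using k by (simp add: w_simps)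
  next
    case (Suc j)
    then have IH: "w j \<in> H" "cmod (e k) / (2 * real g) ^ j \<le> cmod (e (w j))" by auto
    then have "2 * d < cmod (e (w j))" using large[of j] Suc.prems by linarith
    note n = nx[OF sp IH(1) this, of j]
    have "cmod (e k) / (2 * real g) ^ Suc j = cmod (e k) / (2 * real g) ^ j / (2 * real g)" by (simp add: mult.commute)
    also have "\<dots> \<le> cmod (e (w j)) / (2 * real g)" using IH(2) g2 by (intro divide_right_mono) auto
    finally show ?case using n by (simp add: w_simps)
  qed
  have "alternating_walk p v1 v2 g w"
    unfolding alternating_walk_def
  proof (intro allI impI)
    fix j assume "j < g"
    then have "w j \<in> H" "2 * d < cmod (e (w j))" using inv[of j] large[of j] by auto
    from nx[OF sp this, of j] show "w j \<noteq> w (Suc j) \<and> lam p (speed v1 v2 j) (w j) = lam p (speed v1 v2 j) (w (Suc j))"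
      by (auto simp: w_simps)
  qed
  then have "inj_on w {..g}" by (rule alternating_walk_inj[OF v nc])
  then have "card (w ` {..g}) = Suc g" by (simp add: card_image)
  moreover have "w ` {..g} \<subseteq> H" using inv by auto
  ultimately show False using card_mono[OF H(1), of "w ` {..g}"] H(2) by simp
qed

section \<open>Connected components and the quadratic bound\<close>

definition component :: "(int \<Rightarrow> real) \<Rightarrow> real \<Rightarrow> real \<Rightarrow> int \<Rightarrow> int set" where
  "component p v1 v2 k = {m. (k, m) \<in> (G_edges p v1 v2)\<^sup>*}"

lemma component_refl: "k \<in> component p v1 v2 k"
  by (simp add: component_def)

lemma component_sym: "m \<in> component p v1 v2 k \<longleftrightarrow> k \<in> component p v1 v2 m"
proof -
  have "sym (G_edges p v1 v2)" by (auto simp: sym_def G_edges_def red_edges_def blue_edges_def)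
  then have "sym ((G_edges p v1 v2)\<^sup>*)" by (rule sym_rtrancl)
  then show ?thesis unfolding component_def by (auto dest: symD)
qed

lemma component_closed:
  assumes "v \<in> {v1, v2}" "x \<in> component p v1 v2 k"
  shows "Xi p v x \<subseteq> component p v1 v2 k"
proof
  fix m assume m: "m \<in> Xi p v x"
  show "m \<in> component p v1 v2 k"
  proof (cases "m = x")
    case False
    then have "(x, m) \<in> G_edges p v1 v2"
      using m assms red_edgesI[of x m p v1 v2] blue_edgesI[of x m p v2 v1] by (auto simp: Xi_def G_edges_def)
    then show ?thesis using assms(2) by (auto simp: component_def intro: rtrancl_into_rtrancl)
  qed (use assms in simp)
qed

lemma component_finite:
  assumes "g_max p v1 v2 < \<infinity>"
  obtains g where "g \<ge> 1" "\<And>k. finite (component p v1 v2 k)" "\<And>k. card (component p v1 v2 k) \<le> g"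
proof -
  obtain n where n: "g_max p v1 v2 = enat n" using assms by auto
  \<comment> \<open>The 1 accounts for integers outside the graph, whose component is a
    singleton.\<close>
  have "finite (component p v1 v2 k) \<and> card (component p v1 v2 k) \<le> max n 1" for k
  proof (cases "k \<in> G_verts p v1 v2")
    case True
    then have "component p v1 v2 k \<in> G_components p v1 v2" by (auto simp: G_components_def component_def)
    then have "ecard (component p v1 v2 k) \<le> enat n" unfolding n[symmetric] g_max_def by (intro SUP_upper)
    then show ?thesis by (auto simp: ecard_def split: if_splits)
  next
    case False
    have "component p v1 v2 k = {k}"
    proof -
      have "m = k" if "(k, m) \<in> (G_edges p v1 v2)\<^sup>*" for m
        using that False by (cases rule: converse_rtranclE) (auto simp: G_edges_def red_edges_def blue_edges_def)
      then show ?thesis by (auto simp: component_def)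
    qed
    then show ?thesis by simp
  qed
  then show thesis using that[of "max n 1"] by auto
qed

text \<open>The class is cut down to S because a partial sum on a line only sees this part of
  it.\<close>

definition class_sum :: "(int \<Rightarrow> real) \<Rightarrow> real \<Rightarrow> int set \<Rightarrow> (int \<Rightarrow> complex) \<Rightarrow> real \<Rightarrow> complex" where
  "class_sum p v S e l = (\<Sum>m\<in>{m\<in>S. lam p v m = l}. e m)"

text \<open>Each coefficient is bounded by all class sums of its component in the square mean.
  Summing over S counts a vertex at most g times, and a class sum is attached to at most g vertices,
  whence the two factors g.\<close>

lemma coefficients_le_class_sums:
  assumes v: "v1 \<noteq> v2" and nc: "\<not> has_two_colored_cycle p v1 v2" and gf: "g_max p v1 v2 < \<infinity>"
  obtains K :: real where "K > 0" "\<And>S e. finite S \<Longrightarrow> (\<Sum>k\<in>S. (cmod (e k))\<^sup>2)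
    \<le> K * ((\<Sum>l\<in>lam p v1 ` S. (cmod (class_sum p v1 S e l))\<^sup>2) + (\<Sum>l\<in>lam p v2 ` S. (cmod (class_sum p v2 S e l))\<^sup>2))"
proof -
  obtain g where g: "g \<ge> 1" "\<And>k. finite (component p v1 v2 k)" "\<And>k. card (component p v1 v2 k) \<le> g"
    using component_finite[OF gf] by blast
  define C where "C = 2 * (2 * real g) ^ g"
  have C: "C > 0" using g(1) by (simp add: C_def)
  let ?H = "component p v1 v2"
  show thesis
  proof (rule that[of "C\<^sup>2 * real g * real g"])
    show "C\<^sup>2 * real g * real g > 0" using C g by simp
    fix S :: "int set" and e :: "int \<Rightarrow> complex" assume S: "finite S"
    define A where "A v l = (cmod (class_sum p v S e l))\<^sup>2" for v l
    define f where "f k = A v1 (lam p v1 k) + A v2 (lam p v2 k)" for k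
    have A0: "0 \<le> A v l" for v l by (simp add: A_def)
    have f0: "0 \<le> f k" for k by (simp add: f_def A0)
    define U where "U = (\<Union>k\<in>S. ?H k)"
    have U: "finite U" using S g by (simp add: U_def)
    have single: "(cmod (e k))\<^sup>2 \<le> C\<^sup>2 * (\<Sum>m\<in>?H k. f m)" if "k \<in> S" for k
    proof -
      define d where "d = sqrt (\<Sum>m\<in>?H k. f m)"
      have d2: "d\<^sup>2 = (\<Sum>m\<in>?H k. f m)" by (simp add: d_def sum_nonneg f0)
      \<comment> \<open>Extension by zero turns truncated class sums into sums over full
        classes.\<close>
      let ?e = "\<lambda>m. if m \<in> S then e m else 0"
      have "cmod (?e k) \<le> 2 * (2 * real g) ^ g * d"
      proof (rule component_coefficient_bound[OF v nc g(2) g(3) g(1)])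
        fix v x assume vx: "v \<in> {v1, v2}" "x \<in> ?H k"
        show "Xi p v x \<subseteq> ?H k" using component_closed[OF vx] .
        have "finite (Xi p v x)" using component_closed[OF vx] g(2) finite_subset by blast
        then have "(\<Sum>m\<in>Xi p v x. ?e m) = class_sum p v S e (lam p v x)"
          unfolding class_sum_def using S by (subst sum.inter_restrict[symmetric]) (auto intro!: sum.cong simp: Xi_def)
        then have "(cmod (\<Sum>m\<in>Xi p v x. ?e m))\<^sup>2 = A v (lam p v x)" by (simp add: A_def)
        also have "\<dots> \<le> f x" using vx A0 by (auto simp: f_def)
        also have "\<dots> \<le> (\<Sum>m\<in>?H k. f m)" using vx g f0 by (intro member_le_sum) auto
        finally show "cmod (\<Sum>m\<in>Xi p v x. ?e m) \<le> d" unfolding d_def by (intro real_le_rsqrt)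
      qed (rule component_refl)
      then have "cmod (e k) \<le> C * d" using that by (simp add: C_def)
      then have "(cmod (e k))\<^sup>2 \<le> (C * d)\<^sup>2" by (intro power_mono) auto
      then show ?thesis by (simp add: power_mult_distrib d2)
    qed
    have Uf: "(\<Sum>m\<in>U. A v (lam p v m)) \<le> real g * (\<Sum>l\<in>lam p v ` S. A v l)" if "v \<in> {v1, v2}" for v
    proof -
      have z: "A v l = 0" if "l \<notin> lam p v ` S" for l
      proof -
        have "{m \<in> S. lam p v m = l} = {}" using that by auto
        then show ?thesis unfolding A_def class_sum_def by (simp only: sum.empty) simp
      qed
      have "(\<Sum>m\<in>U. A v (lam p v m)) = (\<Sum>l\<in>lam p v ` U. \<Sum>m\<in>{m\<in>U. lam p v m = l}. A v (lam p v m))"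
        by (rule sum.image_gen[OF U])
      also have "\<dots> = (\<Sum>l\<in>lam p v ` U. real (card {m\<in>U. lam p v m = l}) * A v l)"
        by (intro sum.cong refl) simp
      also have "\<dots> \<le> (\<Sum>l\<in>lam p v ` U. real g * A v l)"
      proof (intro sum_mono mult_right_mono A0)
        fix l assume "l \<in> lam p v ` U"
        then obtain x where x: "l = lam p v x" by auto
        have "{m\<in>U. lam p v m = l} \<subseteq> ?H x"
          using component_closed[OF that component_refl[of x]] by (auto simp: Xi_def x)
        then have "card {m\<in>U. lam p v m = l} \<le> g" using card_mono[OF g(2)] g(3) order_trans by blast
        then show "real (card {m\<in>U. lam p v m = l}) \<le> real g" by simp
      qed
      also have "\<dots> = (\<Sum>l\<in>lam p v ` S. real g * A v l)"
      proof (intro sum.mono_neutral_right)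
        have "S \<subseteq> U" using component_refl by (auto simp: U_def)
        then show "lam p v ` S \<subseteq> lam p v ` U" by blast
      qed (use U z in auto)
      finally show ?thesis by (simp add: sum_distrib_left)
    qed
    have "(\<Sum>k\<in>S. (cmod (e k))\<^sup>2) \<le> (\<Sum>k\<in>S. C\<^sup>2 * (\<Sum>m\<in>?H k. f m))"
      by (intro sum_mono single)
    also have "\<dots> = C\<^sup>2 * (\<Sum>k\<in>S. \<Sum>m\<in>U. if m \<in> ?H k then f m else 0)"
      unfolding sum_distrib_left[symmetric] using U
      by (intro arg_cong2[of _ _ _ _ "(*)"] sum.cong refl sum.mono_neutral_cong_left) (auto simp: U_def)
    \<comment> \<open>By symmetry of the component relation, f m is counted once for every k of S in
      the component of m.\<close>
    also have "(\<Sum>k\<in>S. \<Sum>m\<in>U. if m \<in> ?H k then f m else 0) = (\<Sum>m\<in>U. \<Sum>k\<in>S. if k \<in> ?H m then f m else 0)"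
      by (subst sum.swap) (simp add: component_sym)
    also have "\<dots> = (\<Sum>m\<in>U. real (card (S \<inter> ?H m)) * f m)"
      using S by (simp add: sum.inter_restrict[symmetric])
    also have "\<dots> \<le> (\<Sum>m\<in>U. real g * f m)"
    proof (intro sum_mono mult_right_mono f0)
      fix m
      have "card (S \<inter> ?H m) \<le> g" using card_mono[OF g(2), of "S \<inter> ?H m" m] g(3) order_trans by blast
      then show "real (card (S \<inter> ?H m)) \<le> real g" by simp
    qed
    also have "\<dots> = real g * ((\<Sum>m\<in>U. A v1 (lam p v1 m)) + (\<Sum>m\<in>U. A v2 (lam p v2 m)))"
      by (simp add: f_def sum.distrib sum_distrib_left distrib_left)
    also have "\<dots> \<le> real g * (real g * (\<Sum>l\<in>lam p v1 ` S. A v1 l) + real g * (\<Sum>l\<in>lam p v2 ` S. A v2 l))"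
      using Uf by (intro mult_left_mono add_mono) auto
    finally have "(\<Sum>k\<in>S. (cmod (e k))\<^sup>2) \<le> C\<^sup>2 * (real g * (real g * (\<Sum>l\<in>lam p v1 ` S. A v1 l) + real g * (\<Sum>l\<in>lam p v2 ` S. A v2 l)))"
      by (simp add: mult_left_mono)
    then show "(\<Sum>k\<in>S. (cmod (e k))\<^sup>2) \<le> C\<^sup>2 * real g * real g * ((\<Sum>l\<in>lam p v1 ` S. (cmod (class_sum p v1 S e l))\<^sup>2)
        + (\<Sum>l\<in>lam p v2 ` S. (cmod (class_sum p v2 S e l))\<^sup>2))"
      by (simp add: A_def algebra_simps)
  qed
qed

section \<open>Long alternating paths in large components\<close>

text \<open>(H2) makes the finiteness in (H1) uniform: only finitely many k have |k| < N, and their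
  class sizes are bounded by the sum of all of them.\<close>

lemma Xi_card_bounded:
  assumes H1: "\<forall>k. n_mult p v k < \<infinity>"
    and H2: "\<exists>N::nat. N \<ge> 1 \<and> (\<forall>k. \<bar>k\<bar> \<ge> int N \<longrightarrow> n_mult p v k \<le> 2)"
  obtains B N where "\<And>k. finite (Xi p v k)" "\<And>k. card (Xi p v k) \<le> B" "\<And>k. \<bar>k\<bar> \<ge> int N \<Longrightarrow> card (Xi p v k) \<le> 2"
proof -
  have fin: "finite (Xi p v k)" for k
    using H1[rule_format, of k] by (auto simp: n_mult_def ecard_def split: if_splits)
  obtain N :: nat where N: "\<And>k. \<bar>k\<bar> \<ge> int N \<Longrightarrow> n_mult p v k \<le> 2" using H2 by blast
  have 2: "card (Xi p v k) \<le> 2" if "\<bar>k\<bar> \<ge> int N" for k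
  proof -
    have "enat (card (Xi p v k)) \<le> enat 2" using N[OF that] fin by (simp add: n_mult_def ecard_def numeral_eq_enat)
    then show ?thesis by simp
  qed
  have "card (Xi p v k) \<le> 2 + (\<Sum>k\<in>{- int N..int N}. card (Xi p v k))" for k
  proof (cases "\<bar>k\<bar> \<ge> int N")
    case False
    then have "card (Xi p v k) \<le> (\<Sum>k\<in>{- int N..int N}. card (Xi p v k))"
      by (intro member_le_sum) auto
    then show ?thesis by simp
  qed (use 2 in fastforce)
  then show thesis using that fin 2 by blast
qed

section \<open>Balls in the graph and geodesics\<close>

primrec graph_ball :: "(int \<Rightarrow> real) \<Rightarrow> real \<Rightarrow> real \<Rightarrow> int \<Rightarrow> nat \<Rightarrow> int set" where
  "graph_ball p v1 v2 k 0 = {k}"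
| "graph_ball p v1 v2 k (Suc n) = (\<Union>x\<in>graph_ball p v1 v2 k n. Xi p v1 x \<union> Xi p v2 x)"

lemma graph_ball_mono: "i \<le> j \<Longrightarrow> graph_ball p v1 v2 k i \<subseteq> graph_ball p v1 v2 k j"
  by (rule lift_Suc_mono_le[of "graph_ball p v1 v2 k"]) (auto simp: Xi_def)

lemma Xi_subset_graph_ball:
  "x \<in> graph_ball p v1 v2 k n \<Longrightarrow> v \<in> {v1, v2} \<Longrightarrow> Xi p v x \<subseteq> graph_ball p v1 v2 k (Suc n)"
  by auto

lemma card_graph_ball:
  assumes "\<And>v k. v \<in> {v1, v2} \<Longrightarrow> finite (Xi p v k) \<and> card (Xi p v k) \<le> B"
  shows "finite (graph_ball p v1 v2 k n) \<and> card (graph_ball p v1 v2 k n) \<le> (2 * B) ^ n"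
proof (induction n)
  case (Suc n)
  have "card (graph_ball p v1 v2 k (Suc n)) \<le> (\<Sum>x\<in>graph_ball p v1 v2 k n. card (Xi p v1 x \<union> Xi p v2 x))"
    using Suc by (simp add: card_UN_le)
  also have "\<dots> \<le> (\<Sum>x\<in>graph_ball p v1 v2 k n. 2 * B)"
  proof (intro sum_mono)
    fix x
    have "card (Xi p v1 x \<union> Xi p v2 x) \<le> card (Xi p v1 x) + card (Xi p v2 x)" by (rule card_Un_le)
    then show "card (Xi p v1 x \<union> Xi p v2 x) \<le> 2 * B" using assms[of v1 x] assms[of v2 x] by simp
  qed
  also have "\<dots> = card (graph_ball p v1 v2 k n) * (2 * B)" by simp
  also have "\<dots> \<le> (2 * B) ^ n * (2 * B)" using Suc by (intro mult_right_mono) auto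
  finally show ?case using Suc assms by (simp add: mult.commute)
qed simp

text \<open>A ball that stops growing is closed under edges of both colors.\<close>

lemma component_subset_graph_ball:
  assumes "graph_ball p v1 v2 k (Suc n) = graph_ball p v1 v2 k n"
  shows "component p v1 v2 k \<subseteq> graph_ball p v1 v2 k n"
proof
  fix m assume "m \<in> component p v1 v2 k"
  then have "(k, m) \<in> (G_edges p v1 v2)\<^sup>*" by (simp add: component_def)
  then show "m \<in> graph_ball p v1 v2 k n"
  proof induction
    case base
    then show ?case using graph_ball_mono[of 0 n p v1 v2 k] by simp
  next
    case (step x y)
    then have "y \<in> Xi p v1 x \<union> Xi p v2 x" by (auto simp: G_edges_def red_edges_def blue_edges_def Xi_def)
    then show ?case using Xi_subset_graph_ball[OF step.IH, of v1] Xi_subset_graph_ball[OF step.IH, of v2] assms by auto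
  qed
qed

text \<open>Traced back from x: were its predecessor closer to the center than n, x would be closer
  as well. Recording that \<open>w j\<close> has distance exactly j makes the vertices distinct and
  rules out shortcuts.\<close>

lemma geodesic:
  assumes "x \<in> graph_ball p v1 v2 k n" "\<And>m. m < n \<Longrightarrow> x \<notin> graph_ball p v1 v2 k m"
  shows "\<exists>w. w n = x \<and> (\<forall>j\<le>n. w j \<in> graph_ball p v1 v2 k j \<and> (\<forall>m<j. w j \<notin> graph_ball p v1 v2 k m))
    \<and> (\<forall>j<n. \<exists>v\<in>{v1, v2}. lam p v (w j) = lam p v (w (Suc j)))"
  using assms
proof (induction n arbitrary: x)
  case 0
  then show ?case by (intro exI[of _ "\<lambda>_. x"]) auto
next
  case (Suc n)
  from Suc.prems(1) obtain y where y: "y \<in> graph_ball p v1 v2 k n" "x \<in> Xi p v1 y \<union> Xi p v2 y" by auto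
  have "y \<notin> graph_ball p v1 v2 k m" if "m < n" for m
  proof
    assume "y \<in> graph_ball p v1 v2 k m"
    then have "x \<in> graph_ball p v1 v2 k (Suc m)"
      using y(2) Xi_subset_graph_ball[of y p v1 v2 k m] by blast
    then show False using Suc.prems(2)[of "Suc m"] that by simp
  qed
  from Suc.IH[OF y(1) this] obtain w where w: "w n = y"
    "\<And>j. j \<le> n \<Longrightarrow> w j \<in> graph_ball p v1 v2 k j \<and> (\<forall>m<j. w j \<notin> graph_ball p v1 v2 k m)"
    "\<And>j. j < n \<Longrightarrow> \<exists>v\<in>{v1, v2}. lam p v (w j) = lam p v (w (Suc j))" by blast
  define w' where "w' = w(Suc n := x)"
  show ?case
  proof (intro exI[of _ w'] conjI allI impI)
    show "w' (Suc n) = x" by (simp add: w'_def)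
    fix j
    show "w' j \<in> graph_ball p v1 v2 k j" if "j \<le> Suc n"
      using w(2)[of j] Suc.prems that by (cases "j = Suc n") (auto simp: w'_def)
    show "w' j \<notin> graph_ball p v1 v2 k m" if "j \<le> Suc n" "m < j" for m
      using w(2)[of j] Suc.prems that by (cases "j = Suc n") (auto simp: w'_def)
    show "\<exists>v\<in>{v1, v2}. lam p v (w' j) = lam p v (w' (Suc j))" if "j < Suc n"
    proof (cases "j = n")
      case True
      then show ?thesis using y(2) w(1) by (auto simp: w'_def Xi_def)
    next
      case False
      then show ?thesis using w(3)[of j] that by (simp add: w'_def)
    qed
  qed
qed

text \<open>Two consecutive edges of a geodesic cannot have the same color, as the geodesic could then be shortened.\<close>

lemma long_alternating_path:
  assumes Xi: "\<And>v k. v \<in> {v1, v2} \<Longrightarrow> finite (Xi p v k) \<and> card (Xi p v k) \<le> B"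
    and g: "\<not> g_max p v1 v2 < \<infinity>"
  obtains w where "inj_on w {..Suc n}" "alternating_walk p v1 v2 (Suc n) w \<or> alternating_walk p v2 v1 (Suc n) w"
proof -
  let ?b = "graph_ball p v1 v2"
  \<comment> \<open>If all balls stopped growing at radius n, every component would have at most (2
    * B)^n vertices.\<close>
  have "\<exists>k. ?b k (Suc n) \<noteq> ?b k n"
  proof (rule ccontr)
    assume "\<not> ?thesis"
    then have sub: "component p v1 v2 k \<subseteq> ?b k n" for k by (intro component_subset_graph_ball) simp
    have "ecard H \<le> enat ((2 * B) ^ n)" if H: "H \<in> G_components p v1 v2" for H
    proof -
      obtain k where "H = component p v1 v2 k" using H by (auto simp: G_components_def component_def)
      then have "H \<subseteq> ?b k n" using sub by simp
      then have "finite H" "card H \<le> card (?b k n)"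
        using card_graph_ball[of v1 v2 p B k n, OF Xi] finite_subset card_mono by blast+
      then show ?thesis using card_graph_ball[of v1 v2 p B k n, OF Xi] by (simp add: ecard_def)
    qed
    then have "g_max p v1 v2 \<le> enat ((2 * B) ^ n)" unfolding g_max_def by (intro SUP_least)
    then show False using g by (metis enat_ord_code(4) leD linorder_not_less order_le_less_trans)
  qed
  then obtain k x where x: "x \<in> ?b k (Suc n)" "x \<notin> ?b k n"
    using graph_ball_mono[of n "Suc n" p v1 v2] by (metis le_SucI order_refl subsetI subset_antisym)
  then have "x \<notin> ?b k m" if "m < Suc n" for m using graph_ball_mono[of m n p v1 v2 k] that by auto
  from geodesic[OF x(1) this] obtain w where
    w: "\<And>j. j \<le> Suc n \<Longrightarrow> w j \<in> ?b k j" "\<And>j m. j \<le> Suc n \<Longrightarrow> m < j \<Longrightarrow> w j \<notin> ?b k m"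
    "\<And>j. j < Suc n \<Longrightarrow> \<exists>v\<in>{v1, v2}. lam p v (w j) = lam p v (w (Suc j))" by blast
  have ne: "w i \<noteq> w j" if "i < j" "j \<le> Suc n" for i j
    using w(1)[of i] w(2)[of j i] that by auto
  have inj: "inj_on w {..Suc n}"
    using ne by (intro inj_onI) (metis atMost_iff linorder_neqE_nat)
  have change: "lam p v (w (Suc j)) \<noteq> lam p v (w (Suc (Suc j)))"
    if "lam p v (w j) = lam p v (w (Suc j))" "Suc j < Suc n" "v \<in> {v1, v2}" for j v
  proof
    assume "lam p v (w (Suc j)) = lam p v (w (Suc (Suc j)))"
    then have "w (Suc (Suc j)) \<in> Xi p v (w j)" using that by (simp add: Xi_def)
    then have "w (Suc (Suc j)) \<in> ?b k (Suc j)"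
      using Xi_subset_graph_ball[of "w j" p v1 v2 k j v] w(1)[of j] that by auto
    then show False using w(2)[of "Suc (Suc j)" "Suc j"] that by simp
  qed
  \<comment> \<open>The first color of the geodesic is not prescribed, so both orders of the speeds
    are treated at once.\<close>
  have alt: "alternating_walk p va vb (Suc n) w"
    if "lam p va (w 0) = lam p va (w 1)" "{va, vb} = {v1, v2}" for va vb
  proof -
    have "lam p (speed va vb j) (w j) = lam p (speed va vb j) (w (Suc j))" if "j < Suc n" for j
      using that
    proof (induction j)
      case 0
      then show ?case using \<open>lam p va (w 0) = _\<close> by (simp add: speed_def)
    next
      case (Suc j)
      have "speed va vb j \<in> {v1, v2}" using \<open>{va, vb} = _\<close> by (auto simp: speed_def)
      then have "lam p (speed va vb j) (w (Suc j)) \<noteq> lam p (speed va vb j) (w (Suc (Suc j)))"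
        using Suc by (intro change) auto
      moreover obtain v where "v \<in> {va, vb}" "lam p v (w (Suc j)) = lam p v (w (Suc (Suc j)))"
        using w(3)[of "Suc j"] Suc.prems \<open>{va, vb} = _\<close> by auto
      ultimately show ?case by (auto simp: speed_def split: if_splits)
    qed
    then show ?thesis using ne by (auto simp: alternating_walk_def)
  qed
  obtain v where "v \<in> {v1, v2}" "lam p v (w 0) = lam p v (w 1)" using w(3)[of 0] by auto
  then show thesis using that[OF inj] alt[of v1 v2] alt[of v2 v1] by (auto simp: insert_commute)
qed

section \<open>Alternating signs along a path\<close>

lemma norm_alternating_sum_even_pairs:
  fixes f :: "nat \<Rightarrow> complex"
  assumes "\<And>j. j < n \<Longrightarrow> even j \<Longrightarrow> f j = f (Suc j)" "\<And>j. cmod (f j) \<le> 1"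
  shows "cmod (\<Sum>j\<le>n. (- 1) ^ j * f j) \<le> 1"
proof -
  have "(\<Sum>j\<le>n. (- 1) ^ j * f j) = (if even n then f n else 0)"
    using assms(1)
  proof (induction n)
    case (Suc n)
    then have "(\<Sum>j\<le>n. (- 1) ^ j * f j) = (if even n then f n else 0)" by simp
    then show ?case using Suc.prems[of n] by auto
  qed simp
  then show ?thesis using assms(2)[of n] by simp
qed

text \<open>According to the color of the first edge, the terms cancel in pairs starting at index 0
  or at index 1; at most the two end terms survive.\<close>

lemma norm_alternating_sum:
  fixes f :: "nat \<Rightarrow> complex"
  assumes pair: "(\<forall>j<n. even j \<longrightarrow> f j = f (Suc j)) \<or> (\<forall>j<n. odd j \<longrightarrow> f j = f (Suc j))"
    and le: "\<And>j. cmod (f j) \<le> 1"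
  shows "cmod (\<Sum>j\<le>n. (- 1) ^ j * f j) \<le> 2"
  using pair
proof
  assume "\<forall>j<n. even j \<longrightarrow> f j = f (Suc j)"
  then show ?thesis using norm_alternating_sum_even_pairs[of n f] le by simp
next
  assume *: "\<forall>j<n. odd j \<longrightarrow> f j = f (Suc j)"
  show ?thesis
  proof (cases n)
    case 0
    then show ?thesis using le[of 0] by simp
  next
    case (Suc m)
    have "(\<Sum>j\<le>n. (- 1) ^ j * f j) = f 0 - (\<Sum>j\<le>m. (- 1) ^ j * f (Suc j))"
      unfolding Suc sum.atMost_Suc_shift by (simp add: sum_negf)
    moreover have "cmod (\<Sum>j\<le>m. (- 1) ^ j * f (Suc j)) \<le> 1"
      using * Suc le by (intro norm_alternating_sum_even_pairs) auto
    ultimately show ?thesis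
      using le[of 0] norm_triangle_ineq4[of "f 0" "\<Sum>j\<le>m. (- 1) ^ j * f (Suc j)"] by simp
  qed
qed

text \<open>The signs alternate along a path of n + 2 vertices. The square norm grows with n while
  every pairing stays below 2, which defeats any constant in the quantitative estimate.\<close>

lemma large_component_relation:
  assumes Xi: "\<And>v k. v \<in> {v1, v2} \<Longrightarrow> finite (Xi p v k) \<and> card (Xi p v k) \<le> B"
    and g: "\<not> g_max p v1 v2 < \<infinity>"
  obtains S and e :: "int \<Rightarrow> complex" where "finite S" "real n \<le> (\<Sum>k\<in>S. (cmod (e k))\<^sup>2)"
    "\<And>\<phi> v. v \<in> {v1, v2} \<Longrightarrow> class_function p v \<phi> \<Longrightarrow> (\<forall>k. cmod (\<phi> k) \<le> 1)
       \<Longrightarrow> cmod (\<Sum>k\<in>S. e k * \<phi> k) \<le> 2"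
proof -
  obtain w where inj: "inj_on w {..Suc n}"
    and alt: "alternating_walk p v1 v2 (Suc n) w \<or> alternating_walk p v2 v1 (Suc n) w"
    using long_alternating_path[OF Xi g] .
  define e :: "int \<Rightarrow> complex" where "e k = (- 1) ^ inv_into {..Suc n} w k" for k
  have ew: "e (w j) = (- 1) ^ j" if "j \<le> Suc n" for j using inj that by (simp add: e_def)
  show thesis
  proof (rule that[of "w ` {..Suc n}" e])
    have "(\<Sum>k\<in>w ` {..Suc n}. (cmod (e k))\<^sup>2) = real (card (w ` {..Suc n}))"
      by (simp add: e_def norm_power)
    then show "real n \<le> (\<Sum>k\<in>w ` {..Suc n}. (cmod (e k))\<^sup>2)" using inj by (simp add: card_image)
    fix \<phi> :: "int \<Rightarrow> complex" and v
    assume v: "v \<in> {v1, v2}" and \<phi>: "class_function p v \<phi>" "\<forall>k. cmod (\<phi> k) \<le> 1"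
    have "(\<Sum>k\<in>w ` {..Suc n}. e k * \<phi> k) = (\<Sum>j\<le>Suc n. (- 1) ^ j * \<phi> (w j))"
      using ew by (subst sum.reindex[OF inj]) (auto intro!: sum.cong simp del: sum.atMost_Suc)
    moreover have "(\<forall>j<Suc n. even j \<longrightarrow> \<phi> (w j) = \<phi> (w (Suc j))) \<or> (\<forall>j<Suc n. odd j \<longrightarrow> \<phi> (w j) = \<phi> (w (Suc j)))"
    proof -
      have "\<phi> (w j) = \<phi> (w (Suc j))" if "alternating_walk p va vb (Suc n) w" "v = speed va vb j" "j < Suc n" for va vb j
        using that by (intro class_functionD[OF \<phi>(1)]) (auto simp: alternating_walk_def)
      then show ?thesis using alt v by (auto simp: speed_def)
    qed
    ultimately show "cmod (\<Sum>k\<in>w ` {..Suc n}. e k * \<phi> k) \<le> 2"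
      using norm_alternating_sum[of "Suc n" "\<lambda>j. \<phi> (w j)"] \<phi>(2) by simp
  qed simp
qed

section \<open>Frequency gaps\<close>

lemma gamma'_separated:
  assumes "ereal r < gamma' p v"
  obtains W g where "finite W" "W \<subseteq> Lam p v" "r < g" "separated g (Lam p v - W)"
proof -
  obtain W where W: "finite W" "W \<subseteq> Lam p v"
    "ereal r < (INF (a, b)\<in>{(a, b). a \<in> Lam p v - W \<and> b \<in> Lam p v - W \<and> a \<noteq> b}. ereal \<bar>a - b\<bar>)"
    using assms unfolding gamma'_def less_SUP_iff by auto
  \<comment> \<open>The infimum may be infinite, so a real number strictly below it is
    chosen.\<close>
  obtain g where g: "ereal r < ereal g" "ereal g < (INF (a, b)\<in>{(a, b). a \<in> Lam p v - W \<and> b \<in> Lam p v - W \<and> a \<noteq> b}. ereal \<bar>a - b\<bar>)"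
    using ereal_dense2[OF W(3)] by blast
  have "separated g (Lam p v - W)"
    unfolding separated_def
  proof (intro ballI impI)
    fix a b assume "a \<in> Lam p v - W" "b \<in> Lam p v - W" "a \<noteq> b"
    then have "(INF (a, b)\<in>{(a, b). a \<in> Lam p v - W \<and> b \<in> Lam p v - W \<and> a \<noteq> b}. ereal \<bar>a - b\<bar>) \<le> ereal \<bar>a - b\<bar>"
      by (intro INF_lower2[of "(a, b)"]) auto
    then have "ereal g < ereal \<bar>a - b\<bar>" using g(2) by (rule less_le_trans[rotated])
    then show "g \<le> \<bar>a - b\<bar>" by simp
  qed
  then show thesis using that W g by auto
qed

lemma riesz_lower_Lam:
  assumes "T > 0" "ereal (2 * pi / T) < gamma' p v"
  shows "riesz_lower T (Lam p v)"
proof -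
  obtain W g where W: "finite W" "W \<subseteq> Lam p v" "2 * pi / T < g" "separated g (Lam p v - W)"
    using gamma'_separated[OF assms(2)] .
  from riesz_lower_ess_separated[OF W(4,1) assms(1) W(3)] show ?thesis
    using W(2) by (simp add: Un_absorb2)
qed

text \<open>For infinite m the quotient is 0 and the assumption reads T > 0.\<close>

lemma time_threshold:
  assumes "m > (0::ereal)" "ereal T > ereal (2 * pi) / m"
  shows "T > 0" "ereal (2 * pi / T) < m"
proof -
  have "T > 0 \<and> ereal (2 * pi / T) < m"
  proof (cases m)
    case (real r)
    then have r: "r > 0" "2 * pi / r < T" using assms by auto
    have "0 < 2 * pi / r" using r by simp
    then have "T > 0" using r(2) by linarith
    then show ?thesis using r real by (simp add: field_simps)
  qed (use assms in auto)
  then show "T > 0" "ereal (2 * pi / T) < m" by auto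
qed

section \<open>Solutions on lines through a common point\<close>

text \<open>Moving the base point along the line changes the phase by a factor that depends on k
  only through its frequency, so it comes out of class sums with modulus 1. The phase at (ts, xs)
  that remains does not involve v.\<close>

lemma phase_at_intersection:
  assumes "x0 - xs = v * (ts - t0)"
  shows "cis (p k * t0 + of_int k * x0) * cis (lam p v k * t)
    = cis (p k * ts + of_int k * xs) * cis (lam p v k * (t0 - ts)) * cis (lam p v k * t)"
proof -
  have "x0 = xs + v * (ts - t0)" using assms by simp
  have "p k * t0 + of_int k * x0 = p k * ts + of_int k * xs + lam p v k * (t0 - ts)"
    unfolding lam_def \<open>x0 = _\<close> by (simp add: algebra_simps)
  then show ?thesis by (simp add: cis_mult)
qed

lemma line_partial_sum_expsum:
  assumes u: "solution p u0 u" and x: "x0 - xs = v * (ts - t0)"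
    and e: "\<And>k. e k = fourier_coeff u0 k * cis (p k * ts + of_int k * xs)"
  shows "line_partial_sum u t0 x0 v N t
    = expsum (lam p v ` {- int N..int N}) (\<lambda>l. class_sum p v {- int N..int N} e l * cis (l * (t0 - ts))) t"
proof -
  let ?S = "{- int N..int N}"
  have "line_partial_sum u t0 x0 v N t = (\<Sum>k\<in>?S. e k * cis (lam p v k * (t0 - ts)) * cis (lam p v k * t))"
    unfolding line_partial_sum_eq[OF u] e
    by (intro sum.cong refl) (simp only: mult.assoc phase_at_intersection[OF x])
  also have "\<dots> = (\<Sum>l\<in>lam p v ` ?S. \<Sum>k\<in>{k\<in>?S. lam p v k = l}. e k * cis (lam p v k * (t0 - ts)) * cis (lam p v k * t))"
    by (rule sum.image_gen) simp
  also have "\<dots> = (\<Sum>l\<in>lam p v ` ?S. class_sum p v ?S e l * cis (l * (t0 - ts)) * cis (l * t))"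
    unfolding class_sum_def sum_distrib_right by (intro sum.cong refl) auto
  finally show ?thesis by (simp add: expsum_def)
qed

text \<open>The lower estimate is applied to the partial sum, written as f minus its error; the
  error term vanishes as N grows. The constant is fixed before the solution, f and N.\<close>

lemma class_sums_le_restriction:
  assumes low: "riesz_lower T (Lam p v)" and x: "x0 - xs = v * (ts - t0)"
  obtains C where "C > 0" "\<And>u0 u f e N. solution p u0 u \<Longrightarrow> line_restriction u t0 x0 v T f
    \<Longrightarrow> (\<And>k. e k = fourier_coeff u0 k * cis (p k * ts + of_int k * xs))
    \<Longrightarrow> (\<Sum>l\<in>lam p v ` {- int N..int N}. (cmod (class_sum p v {- int N..int N} e l))\<^sup>2)
        \<le> C * ((LINT t|lebesgue_on {0<..<T}. (cmod (f t))\<^sup>2)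
             + (LINT t|lebesgue_on {0<..<T}. (cmod (f t - line_partial_sum u t0 x0 v N t))\<^sup>2))"
proof -
  obtain C where C: "C > 0" "\<And>F a. finite F \<Longrightarrow> F \<subseteq> Lam p v \<Longrightarrow>
     (\<Sum>l\<in>F. (cmod (a l))\<^sup>2) \<le> C * integral {0..T} (\<lambda>t. (cmod (expsum F a t))\<^sup>2)"
    using low unfolding riesz_lower_def by blast
  show thesis
  proof (rule that[of "2 * C"])
    fix u0 u f e and N :: nat
    assume u: "solution p u0 u" and f: "line_restriction u t0 x0 v T f"
      and e: "\<And>k. e k = fourier_coeff u0 k * cis (p k * ts + of_int k * xs)"
    let ?S = "{- int N..int N}" and ?s = "line_partial_sum u t0 x0 v N"
    define a where "a l = class_sum p v ?S e l * cis (l * (t0 - ts))" for l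
    have s: "?s = expsum (lam p v ` ?S) a"
      unfolding a_def using line_partial_sum_expsum[OF u x e] by (simp add: fun_eq_iff)
    have cs: "continuous_on UNIV ?s" unfolding s by (intro continuous_intros)
    have sqs: "square_integrable_on ?s {0<..<T}" using cs by (rule square_integrable_on_continuous_open)
    have sqf: "square_integrable_on f {0<..<T}" using f by (simp add: line_restriction_def)
    have "(\<Sum>l\<in>lam p v ` ?S. (cmod (class_sum p v ?S e l))\<^sup>2) = (\<Sum>l\<in>lam p v ` ?S. (cmod (a l))\<^sup>2)"
      by (simp add: a_def norm_mult)
    also have "\<dots> \<le> C * integral {0..T} (\<lambda>t. (cmod (expsum (lam p v ` ?S) a t))\<^sup>2)"
      by (rule C(2)) (auto simp: Lam_def)
    also have "integral {0..T} (\<lambda>t. (cmod (expsum (lam p v ` ?S) a t))\<^sup>2) = (LINT t|lebesgue_on {0<..<T}. (cmod (f t - (f t - ?s t)))\<^sup>2)"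
      unfolding s by (subst continuous_open_interval(2)) (auto intro!: continuous_intros)
    also have "\<dots> \<le> 2 * (LINT t|lebesgue_on {0<..<T}. (cmod (f t))\<^sup>2) + 2 * (LINT t|lebesgue_on {0<..<T}. (cmod (f t - ?s t))\<^sup>2)"
      by (intro integral_norm_sq_diff_le square_integrable_on_diff sqf sqs)
    finally show "(\<Sum>l\<in>lam p v ` ?S. (cmod (class_sum p v ?S e l))\<^sup>2)
        \<le> 2 * C * ((LINT t|lebesgue_on {0<..<T}. (cmod (f t))\<^sup>2) + (LINT t|lebesgue_on {0<..<T}. (cmod (f t - ?s t))\<^sup>2))"
      using C(1) by (simp add: distrib_left mult.assoc mult_left_mono)
  qed (use C in simp)
qed

lemma finite_int_set_bounded:
  assumes "finite S"
  shows "\<exists>N::nat. S \<subseteq> {- int N..int N}"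
proof
  show "S \<subseteq> {- int (nat (\<Sum>k\<in>S. \<bar>k\<bar>))..int (nat (\<Sum>k\<in>S. \<bar>k\<bar>))}"
  proof
    fix k assume "k \<in> S"
    then have "\<bar>k\<bar> \<le> (\<Sum>k\<in>S. \<bar>k\<bar>)" using assms by (intro member_le_sum) auto
    then show "k \<in> {- int (nat (\<Sum>k\<in>S. \<bar>k\<bar>))..int (nat (\<Sum>k\<in>S. \<bar>k\<bar>))}" by auto
  qed
qed

text \<open>Any finitely supported e is realized as the phase-corrected coefficients of a solution,
  simultaneously for all lines through (ts, xs). The partial sums are eventually constant in N, so
  the restriction is the finite sum.\<close>

lemma trig_poly_solution:
  assumes S: "finite S"
  obtains u0 u where "solution p u0 u" "(LINT x|lebesgue_on {0..2 * pi}. (cmod (u0 x))\<^sup>2) = 2 * pi * (\<Sum>k\<in>S. (cmod (e k))\<^sup>2)"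
    "\<And>t0 x0 v T. x0 - xs = v * (ts - t0) \<Longrightarrow>
       line_restriction u t0 x0 v T (\<lambda>t. \<Sum>k\<in>S. e k * cis (lam p v k * (t0 - ts + t)))"
proof -
  define c where "c k = e k * cis (- (p k * ts + of_int k * xs))" for k
  define u0 where "u0 = trig_poly S c"
  define u where "u t = trig_poly S (\<lambda>k. c k * cis (p k * t))" for t
  have L2: "L2_circle (trig_poly S b)" for b
    unfolding L2_circle_def
  proof (intro conjI allI square_integrable_on_trig_poly)
    fix x
    have "cis (of_int k * (x + 2 * pi)) = cis (of_int k * x)" for k :: int
    proof -
      have "of_int k * (x + 2 * pi) = of_int k * x + 2 * pi * of_int k" by (simp add: algebra_simps)
      then show ?thesis using cis_multiple_2pi[of "of_int k"] by (simp flip: cis_mult)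
    qed
    then show "trig_poly S b (x + 2 * pi) = trig_poly S b x" by (simp add: trig_poly_def)
  qed
  have sol: "solution p u0 u"
    unfolding solution_def
  proof (intro conjI allI)
    show "L2_circle u0" "L2_circle (u t)" for t by (simp_all add: u0_def u_def L2)
    show "AE x in lebesgue_on {0..2 * pi}. u 0 x = u0 x" by (simp add: u_def u0_def)
    fix k t
    have fc: "fourier_coeff (u s) k = (if k \<in> S then c k else 0) * cis (p k * s)" for s
      unfolding u_def fourier_coeff_trig_poly[OF S] by simp
    have "((\<lambda>z. exp (\<i> * of_real (p k) * z)) has_field_derivative
             \<i> * of_real (p k) * exp (\<i> * of_real (p k) * of_real t)) (at (of_real t))"
      by (auto intro!: derivative_eq_intros)
    from has_vector_derivative_real_field[OF this]
    have "((\<lambda>s. cis (p k * s)) has_vector_derivative \<i> * of_real (p k) * cis (p k * t)) (at t)"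
      by (simp add: cis_conv_exp mult_ac)
    from has_vector_derivative_mult_right[OF this, of "if k \<in> S then c k else 0"]
    show "((\<lambda>s. fourier_coeff (u s) k) has_vector_derivative \<i> * of_real (p k) * fourier_coeff (u t) k) (at t)"
      unfolding fc by (simp add: mult_ac)
  qed
  have fc0: "fourier_coeff u0 k = (if k \<in> S then c k else 0)" for k
    unfolding u0_def by (rule fourier_coeff_trig_poly[OF S])
  \<comment> \<open>Subtracting the polynomial from itself turns the completed square into
    Parseval's identity for it.\<close>
  have "(LINT x|lebesgue_on {0..2 * pi}. (cmod (u0 x - u0 x))\<^sup>2) = (LINT x|lebesgue_on {0..2 * pi}. (cmod (u0 x))\<^sup>2)
      - 2 * pi * (\<Sum>k\<in>S. (cmod (fourier_coeff u0 k))\<^sup>2) + 2 * pi * (\<Sum>k\<in>S. (cmod (fourier_coeff u0 k - c k))\<^sup>2)"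
    using integral_norm_sq_minus_trig_poly[OF square_integrable_on_trig_poly[of S c] S, of c] by (simp add: u0_def)
  then have norm: "(LINT x|lebesgue_on {0..2 * pi}. (cmod (u0 x))\<^sup>2) = 2 * pi * (\<Sum>k\<in>S. (cmod (e k))\<^sup>2)"
    by (simp add: fc0 c_def norm_mult)
  have "line_restriction u t0 x0 v T (\<lambda>t. \<Sum>k\<in>S. e k * cis (lam p v k * (t0 - ts + t)))"
    if x: "x0 - xs = v * (ts - t0)" for t0 x0 v T
  proof -
    let ?f = "\<lambda>t. \<Sum>k\<in>S. e k * cis (lam p v k * (t0 - ts + t))"
    obtain N :: nat where N: "S \<subseteq> {- int N..int N}"
      using finite_int_set_bounded[OF S] by blast
    have "line_partial_sum u t0 x0 v n t = ?f t" if "n \<ge> N" for n t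
    proof -
      have sub: "S \<subseteq> {- int n..int n}" using N that by (force simp: subset_iff)
      have "line_partial_sum u t0 x0 v n t = (\<Sum>k\<in>{- int n..int n}. fourier_coeff u0 k * (cis (p k * t0 + of_int k * x0) * cis (lam p v k * t)))"
        unfolding line_partial_sum_eq[OF sol] by (simp only: mult.assoc)
      also have "\<dots> = (\<Sum>k\<in>S. c k * (cis (p k * t0 + of_int k * x0) * cis (lam p v k * t)))"
        using sub by (intro sum.mono_neutral_cong_right) (auto simp: fc0)
      also have "\<dots> = ?f t"
        unfolding phase_at_intersection[OF x] c_def by (intro sum.cong refl) (simp add: cis_mult mult.assoc algebra_simps)
      finally show ?thesis .
    qed
    then have "(\<lambda>n. LINT t|lebesgue_on {0<..<T}. (cmod (?f t - line_partial_sum u t0 x0 v n t))\<^sup>2) \<longlonglongrightarrow> 0"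
      by (intro tendsto_eventually) (auto simp: eventually_sequentially intro!: exI[of _ N])
    moreover have "square_integrable_on ?f {0<..<T}"
      by (intro square_integrable_on_continuous_open continuous_intros)
    ultimately show ?thesis by (simp add: line_restriction_def)
  qed
  then show thesis using that sol norm by blast
qed

section \<open>Observability from two lines\<close>

locale two_lines =
  fixes p :: "int \<Rightarrow> real" and t1 x1 t2 x2 v1 v2 T :: real
  assumes v: "v1 \<noteq> v2" and T: "T > 0"
    and gap1: "ereal (2 * pi / T) < gamma' p v1" and gap2: "ereal (2 * pi / T) < gamma' p v2"
    and H1: "\<forall>v k. n_mult p v k < \<infinity>"
    and H2: "\<forall>v. \<exists>N::nat. N \<ge> 1 \<and> (\<forall>k. \<bar>k\<bar> \<ge> int N \<longrightarrow> n_mult p v k \<le> 2)"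
begin

text \<open>The solution of x1 - v1 (ts - t1) = x2 - v2 (ts - t2). It may lie outside both
  observation windows, since only phases are transported there.\<close>

definition ts :: real where "ts = (x1 - x2 + v1 * t1 - v2 * t2) / (v1 - v2)"

definition xs :: real where "xs = x1 - v1 * (ts - t1)"

lemma meet: "x1 - xs = v1 * (ts - t1)" "x2 - xs = v2 * (ts - t2)"
proof -
  show "x1 - xs = v1 * (ts - t1)" by (simp add: xs_def)
  have "ts * (v1 - v2) = x1 - x2 + v1 * t1 - v2 * t2" using v by (simp add: ts_def)
  then show "x2 - xs = v2 * (ts - t2)" by (simp add: xs_def algebra_simps)
qed

definition observable :: bool where
  "observable \<longleftrightarrow> (\<forall>u0 u. solution p u0 u \<longrightarrow>
          line_restriction u t1 x1 v1 T (\<lambda>t. 0) \<longrightarrow>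
          line_restriction u t2 x2 v2 T (\<lambda>t. 0) \<longrightarrow>
          (AE x in lebesgue_on {0..2 * pi}. u0 x = 0))"

definition observable_with :: "real \<Rightarrow> bool" where
  "observable_with C \<longleftrightarrow> (\<forall>u0 u f1 f2. solution p u0 u \<longrightarrow>
          line_restriction u t1 x1 v1 T f1 \<longrightarrow>
          line_restriction u t2 x2 v2 T f2 \<longrightarrow>
          (LINT x|lebesgue_on {0..2 * pi}. (cmod (u0 x))\<^sup>2)
            \<le> C * (LINT t|lebesgue_on {0<..<T}. (cmod (f1 t))\<^sup>2 + (cmod (f2 t))\<^sup>2))"

section \<open>Necessity of the graph conditions\<close>

lemma invisible_solution:
  assumes "has_two_colored_cycle p v1 v2"
  obtains u0 u where "solution p u0 u" "0 < (LINT x|lebesgue_on {0..2 * pi}. (cmod (u0 x))\<^sup>2)"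
    "line_restriction u t1 x1 v1 T (\<lambda>t. 0)" "line_restriction u t2 x2 v2 T (\<lambda>t. 0)"
proof -
  obtain S and e :: "int \<Rightarrow> complex" and k where S: "finite S" "k \<in> S" "e k \<noteq> 0"
    and z: "\<And>\<phi> v. v \<in> {v1, v2} \<Longrightarrow> class_function p v \<phi> \<Longrightarrow> (\<Sum>k\<in>S. e k * \<phi> k) = 0"
    by (rule two_colored_cycle_relation[OF v assms]) blast
  obtain u0 u where u: "solution p u0 u" "(LINT x|lebesgue_on {0..2 * pi}. (cmod (u0 x))\<^sup>2) = 2 * pi * (\<Sum>k\<in>S. (cmod (e k))\<^sup>2)"
    "\<And>t0 x0 v T. x0 - xs = v * (ts - t0) \<Longrightarrow>
       line_restriction u t0 x0 v T (\<lambda>t. \<Sum>k\<in>S. e k * cis (lam p v k * (t0 - ts + t)))"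
    by (rule trig_poly_solution[OF S(1), where p = p and e = e and ts = ts and xs = xs]) blast
  \<comment> \<open>At each time t the exponential depends on k only through its frequency, hence is
    a class function.\<close>
  have f: "(\<lambda>t. \<Sum>k\<in>S. e k * cis (lam p v k * (t0 - ts + t))) = (\<lambda>t. 0)" if "v \<in> {v1, v2}" for v t0
    by (intro ext z[OF that]) (auto simp: class_function_def)
  have "0 < (\<Sum>k\<in>S. (cmod (e k))\<^sup>2)" using S by (intro sum_pos2[of _ k]) auto
  then show thesis
    using that[of u0 u] u(1,2) u(3)[OF meet(1), of T] u(3)[OF meet(2), of T] f[of v1 t1] f[of v2 t2] by auto
qed

lemma observable_imp_no_cycle:
  assumes observable shows "\<not> has_two_colored_cycle p v1 v2"
proof
  assume "has_two_colored_cycle p v1 v2"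
  then obtain u0 u where u: "solution p u0 u" "0 < (LINT x|lebesgue_on {0..2 * pi}. (cmod (u0 x))\<^sup>2)"
    "line_restriction u t1 x1 v1 T (\<lambda>t. 0)" "line_restriction u t2 x2 v2 T (\<lambda>t. 0)"
    using invisible_solution by blast
  then have "AE x in lebesgue_on {0..2 * pi}. u0 x = 0" using assms unfolding observable_def by blast
  then have "(LINT x|lebesgue_on {0..2 * pi}. (cmod (u0 x))\<^sup>2) = 0"
    by (intro integral_eq_zero_AE) auto
  then show False using u(2) by simp
qed

lemma observable_with_imp_no_cycle:
  assumes "observable_with C" shows "\<not> has_two_colored_cycle p v1 v2"
proof
  assume "has_two_colored_cycle p v1 v2"
  then obtain u0 u where u: "solution p u0 u" "0 < (LINT x|lebesgue_on {0..2 * pi}. (cmod (u0 x))\<^sup>2)"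
    "line_restriction u t1 x1 v1 T (\<lambda>t. 0)" "line_restriction u t2 x2 v2 T (\<lambda>t. 0)"
    using invisible_solution by blast
  then have "(LINT x|lebesgue_on {0..2 * pi}. (cmod (u0 x))\<^sup>2)
      \<le> C * (LINT t|lebesgue_on {0<..<T}. (cmod 0)\<^sup>2 + (cmod 0)\<^sup>2)"
    using assms unfolding observable_with_def by blast
  then show False using u(2) by simp
qed

lemma Xi_bounds:
  obtains B N where "\<And>v k. v \<in> {v1, v2} \<Longrightarrow> finite (Xi p v k)"
    "\<And>v k. v \<in> {v1, v2} \<Longrightarrow> card (Xi p v k) \<le> B"
    "\<And>v k. v \<in> {v1, v2} \<Longrightarrow> \<bar>k\<bar> \<ge> int N \<Longrightarrow> card (Xi p v k) \<le> 2"
proof -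
  obtain B1 N1 where 1: "\<And>k. finite (Xi p v1 k)" "\<And>k. card (Xi p v1 k) \<le> B1" "\<And>k. \<bar>k\<bar> \<ge> int N1 \<Longrightarrow> card (Xi p v1 k) \<le> 2"
    using Xi_card_bounded[of p v1] H1 H2 by metis
  obtain B2 N2 where 2: "\<And>k. finite (Xi p v2 k)" "\<And>k. card (Xi p v2 k) \<le> B2" "\<And>k. \<bar>k\<bar> \<ge> int N2 \<Longrightarrow> card (Xi p v2 k) \<le> 2"
    using Xi_card_bounded[of p v2] H1 H2 by metis
  show thesis
    by (rule that[of "max B1 B2" "max N1 N2"]) (use 1 2 in \<open>auto simp: le_max_iff_disj\<close>)
qed

lemma observable_with_imp_g_finite:
  assumes C: "observable_with C" "C > 0" shows "g_max p v1 v2 < \<infinity>"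
proof (rule ccontr)
  assume g: "\<not> g_max p v1 v2 < \<infinity>"
  obtain B N where B: "\<And>v k. v \<in> {v1, v2} \<Longrightarrow> finite (Xi p v k)"
    "\<And>v k. v \<in> {v1, v2} \<Longrightarrow> card (Xi p v k) \<le> B"
    "\<And>v k. v \<in> {v1, v2} \<Longrightarrow> \<bar>k\<bar> \<ge> int N \<Longrightarrow> card (Xi p v k) \<le> 2"
    using Xi_bounds by blast
  have B': "finite (Xi p v k) \<and> card (Xi p v k) \<le> B" if "v \<in> {v1, v2}" for v k
    using B that by blast
  \<comment> \<open>Both restrictions are at most 2 in modulus, so the observed energy is at most 8
    * T however long the path is.\<close>
  obtain n :: nat where n: "C * (8 * T) < real n" using reals_Archimedean2 by blast
  obtain S and e :: "int \<Rightarrow> complex" where S: "finite S" "real n \<le> (\<Sum>k\<in>S. (cmod (e k))\<^sup>2)"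
    and z: "\<And>\<phi> v. v \<in> {v1, v2} \<Longrightarrow> class_function p v \<phi> \<Longrightarrow> (\<forall>k. cmod (\<phi> k) \<le> 1)
       \<Longrightarrow> cmod (\<Sum>k\<in>S. e k * \<phi> k) \<le> 2"
    by (rule large_component_relation[OF B' g, of n]) blast+
  obtain u0 u where u: "solution p u0 u" "(LINT x|lebesgue_on {0..2 * pi}. (cmod (u0 x))\<^sup>2) = 2 * pi * (\<Sum>k\<in>S. (cmod (e k))\<^sup>2)"
    "\<And>t0 x0 v T. x0 - xs = v * (ts - t0) \<Longrightarrow>
       line_restriction u t0 x0 v T (\<lambda>t. \<Sum>k\<in>S. e k * cis (lam p v k * (t0 - ts + t)))"
    by (rule trig_poly_solution[OF S(1), where p = p and e = e and ts = ts and xs = xs]) blast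
  define f where "f v t0 t = (\<Sum>k\<in>S. e k * cis (lam p v k * (t0 - ts + t)))" for v t0 t
  have f2: "(cmod (f v t0 t))\<^sup>2 \<le> 4" if "v \<in> {v1, v2}" for v t0 t
  proof -
    have "cmod (f v t0 t) \<le> 2"
      unfolding f_def by (intro z[OF that]) (auto simp: class_function_def)
    then have "(cmod (f v t0 t))\<^sup>2 \<le> 2\<^sup>2" by (intro power_mono) auto
    then show ?thesis by simp
  qed
  have cf: "continuous_on UNIV (f v t0)" for v t0 unfolding f_def by (intro continuous_intros)
  have "2 * pi * (\<Sum>k\<in>S. (cmod (e k))\<^sup>2) \<le> C * (LINT t|lebesgue_on {0<..<T}. (cmod (f v1 t1 t))\<^sup>2 + (cmod (f v2 t2 t))\<^sup>2)"
    using C(1) u(1) u(3)[OF meet(1), of T] u(3)[OF meet(2), of T]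
    unfolding observable_with_def f_def u(2)[symmetric] by blast
  also have "(LINT t|lebesgue_on {0<..<T}. (cmod (f v1 t1 t))\<^sup>2 + (cmod (f v2 t2 t))\<^sup>2) \<le> (LINT t|lebesgue_on {0<..<T}. 8)"
  proof (intro integral_mono continuous_open_interval continuous_intros cf)
    show "(cmod (f v1 t1 t))\<^sup>2 + (cmod (f v2 t2 t))\<^sup>2 \<le> 8" for t
      using f2[of v1 t1 t] f2[of v2 t2 t] by simp
  qed
  also have "\<dots> = 8 * T" using T by (simp add: measure_restrict_space)
  finally have "2 * pi * (\<Sum>k\<in>S. (cmod (e k))\<^sup>2) \<le> C * (8 * T)" using C(2) by simp
  moreover have "1 * real n \<le> 2 * pi * (\<Sum>k\<in>S. (cmod (e k))\<^sup>2)"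
    using S(2) pi_gt3 by (intro mult_mono) auto
  ultimately show False using n by simp
qed

section \<open>Sufficiency of the graph conditions\<close>

lemma no_cycle_imp_observable:
  assumes nc: "\<not> has_two_colored_cycle p v1 v2"
  shows observable
  unfolding observable_def
proof (intro allI impI)
  fix u0 u
  assume u: "solution p u0 u" and z1: "line_restriction u t1 x1 v1 T (\<lambda>t. 0)" and z2: "line_restriction u t2 x2 v2 T (\<lambda>t. 0)"
  have sq: "square_integrable_on u0 {0..2 * pi}" using u by (simp add: solution_def L2_circle_def)
  define e where "e k = fourier_coeff u0 k * cis (p k * ts + of_int k * xs)" for k
  have ne: "cmod (e k) = cmod (fourier_coeff u0 k)" for k by (simp add: e_def norm_mult)
  obtain B N where B: "\<And>v k. v \<in> {v1, v2} \<Longrightarrow> finite (Xi p v k)"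
    "\<And>v k. v \<in> {v1, v2} \<Longrightarrow> card (Xi p v k) \<le> B"
    "\<And>v k. v \<in> {v1, v2} \<Longrightarrow> \<bar>k\<bar> \<ge> int N \<Longrightarrow> card (Xi p v k) \<le> 2"
    using Xi_bounds by blast
  have zero: "(\<Sum>m\<in>Xi p v k. e m) = 0"
    if v: "v \<in> {v1, v2}" and gap: "ereal (2 * pi / T) < gamma' p v" and x: "x0 - xs = v * (ts - t0)"
      and lr: "line_restriction u t0 x0 v T (\<lambda>t. 0)" for v t0 x0 k
  proof -
    obtain C where C: "C > 0" "\<And>u0 u f e N. solution p u0 u \<Longrightarrow> line_restriction u t0 x0 v T f
      \<Longrightarrow> (\<And>k. e k = fourier_coeff u0 k * cis (p k * ts + of_int k * xs))
      \<Longrightarrow> (\<Sum>l\<in>lam p v ` {- int N..int N}. (cmod (class_sum p v {- int N..int N} e l))\<^sup>2)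
          \<le> C * ((LINT t|lebesgue_on {0<..<T}. (cmod (f t))\<^sup>2)
               + (LINT t|lebesgue_on {0<..<T}. (cmod (f t - line_partial_sum u t0 x0 v N t))\<^sup>2))"
      by (rule class_sums_le_restriction[OF riesz_lower_Lam[OF T gap] x]) blast
    obtain M :: nat where M: "\<And>m. m \<in> Xi p v k \<Longrightarrow> \<bar>m\<bar> \<le> int M"
    proof
      fix m assume "m \<in> Xi p v k"
      then have "\<bar>m\<bar> \<le> (\<Sum>m\<in>Xi p v k. \<bar>m\<bar>)" using B(1)[OF v] by (intro member_le_sum) auto
      then show "\<bar>m\<bar> \<le> int (nat (\<Sum>m\<in>Xi p v k. \<bar>m\<bar>))" by simp
    qed
    \<comment> \<open>Once [-n, n] contains the finite class, its truncated sum is the full one, and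
      it is controlled by the approximation error alone.\<close>
    have "(cmod (\<Sum>m\<in>Xi p v k. e m))\<^sup>2 \<le> C * (LINT t|lebesgue_on {0<..<T}. (cmod (0 - line_partial_sum u t0 x0 v n t))\<^sup>2)"
      if "n \<ge> M" for n
    proof -
      have X: "{m\<in>{- int n..int n}. lam p v m = lam p v k} = Xi p v k"
        using M that by (force simp: Xi_def)
      have "k \<in> Xi p v k" by (simp add: Xi_def)
      then have k: "k \<in> {- int n..int n}" unfolding X[symmetric] by simp
      have "(cmod (\<Sum>m\<in>Xi p v k. e m))\<^sup>2 = (cmod (class_sum p v {- int n..int n} e (lam p v k)))\<^sup>2"
        by (simp only: class_sum_def X)
      also have "\<dots> \<le> (\<Sum>l\<in>lam p v ` {- int n..int n}. (cmod (class_sum p v {- int n..int n} e l))\<^sup>2)"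
        using k by (intro member_le_sum) auto
      also note C(2)[OF u lr e_def]
      finally show ?thesis by simp
    qed
    then have ev: "\<forall>\<^sub>F n in sequentially. (cmod (\<Sum>m\<in>Xi p v k. e m))\<^sup>2 \<le> C * (LINT t|lebesgue_on {0<..<T}. (cmod (0 - line_partial_sum u t0 x0 v n t))\<^sup>2)"
      by (auto simp: eventually_sequentially)
    have "(\<lambda>n. C * (LINT t|lebesgue_on {0<..<T}. (cmod (0 - line_partial_sum u t0 x0 v n t))\<^sup>2)) \<longlonglongrightarrow> C * 0"
      using lr by (intro tendsto_mult tendsto_const) (simp only: line_restriction_def)
    from tendsto_lowerbound[OF this ev] show ?thesis by simp
  qed
  have "e k = 0" for k
  proof (rule vanishing_class_sums_imp_zero[OF v nc B(1) B(3)])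
    show "(\<Sum>m\<in>Xi p v k. e m) = 0" if "v \<in> {v1, v2}" for v k
      using that zero[of v1, OF _ gap1 meet(1) z1] zero[of v2, OF _ gap2 meet(2) z2] by auto
    show "finite {k. \<epsilon> \<le> cmod (e k)}" if "\<epsilon> > 0" for \<epsilon>
      unfolding ne by (rule fourier_coeff_decay[OF sq that])
  qed auto
  then have "fourier_coeff u0 k = 0" for k using ne[of k] by simp
  then show "AE x in lebesgue_on {0..2 * pi}. u0 x = 0" by (rule L2_zero_if_fourier_zero[OF sq])
qed

lemma no_cycle_imp_observable_with:
  assumes nc: "\<not> has_two_colored_cycle p v1 v2" and g: "g_max p v1 v2 < \<infinity>"
  shows "\<exists>C>0. observable_with C"
proof -
  obtain K :: real where K: "K > 0" "\<And>S e. finite S \<Longrightarrow> (\<Sum>k\<in>S. (cmod (e k))\<^sup>2)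
    \<le> K * ((\<Sum>l\<in>lam p v1 ` S. (cmod (class_sum p v1 S e l))\<^sup>2) + (\<Sum>l\<in>lam p v2 ` S. (cmod (class_sum p v2 S e l))\<^sup>2))"
    using coefficients_le_class_sums[OF v nc g] by blast
  let ?J = "\<lambda>f. LINT t|lebesgue_on {0<..<T}. (cmod (f t))\<^sup>2"
  let ?A = "\<lambda>v e N. \<Sum>l\<in>lam p v ` {- int N..int N}. (cmod (class_sum p v {- int N..int N} e l))\<^sup>2"
  obtain C1 where C1: "C1 > 0" "\<And>u0 u f e N. solution p u0 u \<Longrightarrow> line_restriction u t1 x1 v1 T f
    \<Longrightarrow> (\<And>k. e k = fourier_coeff u0 k * cis (p k * ts + of_int k * xs))
    \<Longrightarrow> ?A v1 e N \<le> C1 * (?J f + ?J (\<lambda>t. f t - line_partial_sum u t1 x1 v1 N t))"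
    by (rule class_sums_le_restriction[OF riesz_lower_Lam[OF T gap1] meet(1)]) blast
  obtain C2 where C2: "C2 > 0" "\<And>u0 u f e N. solution p u0 u \<Longrightarrow> line_restriction u t2 x2 v2 T f
    \<Longrightarrow> (\<And>k. e k = fourier_coeff u0 k * cis (p k * ts + of_int k * xs))
    \<Longrightarrow> ?A v2 e N \<le> C2 * (?J f + ?J (\<lambda>t. f t - line_partial_sum u t2 x2 v2 N t))"
    by (rule class_sums_le_restriction[OF riesz_lower_Lam[OF T gap2] meet(2)]) blast
  \<comment> \<open>The factor 2 * pi is from Parseval, and C1 + C2 is a common bound for the
    constants of the two lines.\<close>
  define D where "D = 2 * pi * K * (C1 + C2)"
  have "observable_with D"
    unfolding observable_with_def
  proof (intro allI impI)
    fix u0 u f1 f2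
    assume u: "solution p u0 u" and l1: "line_restriction u t1 x1 v1 T f1" and l2: "line_restriction u t2 x2 v2 T f2"
    have sq: "square_integrable_on u0 {0..2 * pi}" using u by (simp add: solution_def L2_circle_def)
    define e where "e k = fourier_coeff u0 k * cis (p k * ts + of_int k * xs)" for k
    have ne: "cmod (e k) = cmod (fourier_coeff u0 k)" for k by (simp add: e_def norm_mult)
    define I1 where "I1 N = ?J (\<lambda>t. f1 t - line_partial_sum u t1 x1 v1 N t)" for N
    define I2 where "I2 N = ?J (\<lambda>t. f2 t - line_partial_sum u t2 x2 v2 N t)" for N
    have lim: "I1 \<longlonglongrightarrow> 0" "I2 \<longlonglongrightarrow> 0"
      using l1 l2 by (simp_all add: line_restriction_def I1_def[abs_def] I2_def[abs_def])
    have J: "0 \<le> ?J f1" "0 \<le> ?J f2" by simp_all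
    have bound: "2 * pi * (\<Sum>k\<in>{- int N..int N}. (cmod (fourier_coeff u0 k))\<^sup>2)
        \<le> 2 * pi * (K * (C1 * (?J f1 + I1 N) + C2 * (?J f2 + I2 N)))" for N
    proof (rule mult_left_mono)
      have "(\<Sum>k\<in>{- int N..int N}. (cmod (fourier_coeff u0 k))\<^sup>2) \<le> K * (?A v1 e N + ?A v2 e N)"
        using K(2)[of "{- int N..int N}" e] by (simp add: ne)
      also have "\<dots> \<le> K * (C1 * (?J f1 + I1 N) + C2 * (?J f2 + I2 N))"
        unfolding I1_def I2_def using K(1) by (intro mult_left_mono add_mono C1(2)[OF u l1 e_def] C2(2)[OF u l2 e_def]) auto
      finally show "(\<Sum>k\<in>{- int N..int N}. (cmod (fourier_coeff u0 k))\<^sup>2) \<le> K * (C1 * (?J f1 + I1 N) + C2 * (?J f2 + I2 N))" .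
    qed simp
    have "(LINT x|lebesgue_on {0..2 * pi}. (cmod (u0 x))\<^sup>2) \<le> 2 * pi * (K * (C1 * (?J f1 + 0) + C2 * (?J f2 + 0)))"
    proof (rule field_le_epsilon)
      fix \<epsilon> :: real assume "\<epsilon> > 0"
      then obtain S where S: "finite S" "\<And>T. finite T \<Longrightarrow> S \<subseteq> T \<Longrightarrow>
          (LINT x|lebesgue_on {0..2 * pi}. (cmod (u0 x))\<^sup>2) < 2 * pi * (\<Sum>k\<in>T. (cmod (fourier_coeff u0 k))\<^sup>2) + \<epsilon>"
        by (rule parseval_approx[OF sq]) blast
      obtain M :: nat where M: "S \<subseteq> {- int M..int M}"
        using finite_int_set_bounded[OF S(1)] by blast
      have "(LINT x|lebesgue_on {0..2 * pi}. (cmod (u0 x))\<^sup>2) \<le> 2 * pi * (K * (C1 * (?J f1 + I1 n) + C2 * (?J f2 + I2 n))) + \<epsilon>"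
        if "n \<ge> M" for n
      proof -
        have "S \<subseteq> {- int n..int n}" using M that by (force simp: subset_iff)
        then have "(LINT x|lebesgue_on {0..2 * pi}. (cmod (u0 x))\<^sup>2)
            < 2 * pi * (\<Sum>k\<in>{- int n..int n}. (cmod (fourier_coeff u0 k))\<^sup>2) + \<epsilon>"
          by (intro S(2)) auto
        then show ?thesis using bound[of n] by linarith
      qed
      then have ev: "\<forall>\<^sub>F n in sequentially. (LINT x|lebesgue_on {0..2 * pi}. (cmod (u0 x))\<^sup>2)
          \<le> 2 * pi * (K * (C1 * (?J f1 + I1 n) + C2 * (?J f2 + I2 n))) + \<epsilon>"
        by (auto simp: eventually_sequentially)
      \<comment> \<open>For fixed epsilon, n tends to infinity: the errors on both lines vanish
        while the Parseval error stays below epsilon.\<close>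
      have "(\<lambda>n. 2 * pi * (K * (C1 * (?J f1 + I1 n) + C2 * (?J f2 + I2 n))) + \<epsilon>)
          \<longlonglongrightarrow> 2 * pi * (K * (C1 * (?J f1 + 0) + C2 * (?J f2 + 0))) + \<epsilon>"
        by (intro tendsto_intros lim)
      from tendsto_lowerbound[OF this ev]
      show "(LINT x|lebesgue_on {0..2 * pi}. (cmod (u0 x))\<^sup>2) \<le> 2 * pi * (K * (C1 * (?J f1 + 0) + C2 * (?J f2 + 0))) + \<epsilon>"
        by simp
    qed
    also have "\<dots> \<le> 2 * pi * (K * ((C1 + C2) * ?J f1 + (C1 + C2) * ?J f2))"
    proof -
      have "C1 * ?J f1 \<le> (C1 + C2) * ?J f1" using C2(1) by (intro mult_right_mono J) simp
      moreover have "C2 * ?J f2 \<le> (C1 + C2) * ?J f2" using C1(1) by (intro mult_right_mono J) simp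
      ultimately show ?thesis using K(1) by (intro mult_left_mono add_mono) auto
    qed
    also have "\<dots> = D * (?J f1 + ?J f2)" by (simp add: D_def algebra_simps)
    also have "?J f1 + ?J f2 = (LINT t|lebesgue_on {0<..<T}. (cmod (f1 t))\<^sup>2 + (cmod (f2 t))\<^sup>2)"
      using l1 l2 by (subst Bochner_Integration.integral_add) (auto simp: line_restriction_def square_integrable_on_def)
    finally show "(LINT x|lebesgue_on {0..2 * pi}. (cmod (u0 x))\<^sup>2)
            \<le> D * (LINT t|lebesgue_on {0<..<T}. (cmod (f1 t))\<^sup>2 + (cmod (f2 t))\<^sup>2)" .
  qed
  moreover have "D > 0" using K C1(1) C2(1) by (simp add: D_def)
  ultimately show ?thesis by blast
qed

end

theorem theorem1p5:
  fixes p :: "int \<Rightarrow> real" and t1 x1 t2 x2 v1 v2 T :: real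
  assumes "v1 \<noteq> v2"
    and "gamma' p v1 > 0" and "gamma' p v2 > 0"
    and "ereal T > ereal (2 * pi) / min (gamma' p v1) (gamma' p v2)"
    and H1: "\<forall>v k. n_mult p v k < \<infinity>"
    and H2: "\<forall>v. \<exists>N::nat. N \<ge> 1 \<and> (\<forall>k. \<bar>k\<bar> \<ge> int N \<longrightarrow> n_mult p v k \<le> 2)"
  shows
    "((\<forall>u0 u. solution p u0 u \<longrightarrow>
          line_restriction u t1 x1 v1 T (\<lambda>t. 0) \<longrightarrow>
          line_restriction u t2 x2 v2 T (\<lambda>t. 0) \<longrightarrow>
          (AE x in lebesgue_on {0..2 * pi}. u0 x = 0))
        \<longleftrightarrow> \<not> has_two_colored_cycle p v1 v2)
     \<and>
     ((\<exists>C>0. \<forall>u0 u f1 f2. solution p u0 u \<longrightarrow>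
          line_restriction u t1 x1 v1 T f1 \<longrightarrow>
          line_restriction u t2 x2 v2 T f2 \<longrightarrow>
          (LINT x|lebesgue_on {0..2 * pi}. (cmod (u0 x))\<^sup>2)
            \<le> C * (LINT t|lebesgue_on {0<..<T}. (cmod (f1 t))\<^sup>2 + (cmod (f2 t))\<^sup>2))
        \<longleftrightarrow> \<not> has_two_colored_cycle p v1 v2 \<and> g_max p v1 v2 < \<infinity>)"
proof -
  have "0 < min (gamma' p v1) (gamma' p v2)" using assms(2,3) by simp
  note T = time_threshold[OF this assms(4)]
  interpret two_lines p t1 x1 t2 x2 v1 v2 T
    by unfold_locales (use assms T in auto)
  show ?thesis
    unfolding observable_def[symmetric] observable_with_def[symmetric]
    using observable_imp_no_cycle no_cycle_imp_observable observable_with_imp_no_cycle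
      observable_with_imp_g_finite no_cycle_imp_observable_with by blast
qed

end
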